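(* If a tight decomposition space $X$ is a Segal space, then it is Rezk complete.
   Context: $\mathbf{Grpd}$ is the $\infty$-category of $\infty$-groupoids; pullbacks and fibres are homotopy pullbacks and fibres; a monomorphism of $\infty$-groupoids is a map whose fibres are empty or contractible. $\Delta$ is the category of nonempty finite ordinals. A map in $\Delta$ is generic if it preserves both end-points, and free if $f(i+1)=f(i)+1$ for all $i$; generic and free maps admit pushouts along each other. A decomposition space is a functor $X:\Delta^{\mathrm{op}}\to\mathbf{Grpd}$ sending every pushout square in $\Delta$ of a generic map along a free map to a pullback. It is complete if $s_0:X_0\to X_1$ is a monomorphism. For a complete decomposition space $X$, an edge in $X_1$ is nondegenerate if it lies in the complement of $s_0(X_0)\subset X_1$, and $\vec X_r\subset X_r$ denotes the full subgroupoid of $r$-simplices all of whose principal edges are nondegenerate (with $\vec X_0=X_0$). A decomposition space is called tight (or of locally finite length) if it is complete and for each $a\in X_1$ the fibre over $a$ of $\vec X_r\to X_1$ (restriction of the map induced by the unique generic map $[1]\to[r]$) is empty for $r$ sufficiently large. A Segal space is a simplicial $\infty$-groupoid whose Segal maps $X_r\to X_1\times_{X_0}\cdots\times_{X_0}X_1$ are equivalences. A Segal space $X$ is Rezk complete if the map $\mathrm{Map}( *,X)\to\mathrm{Map}(J,X)$ given by precomposition with $J\to *$ is an equivalence, where $J$ is the (ordinary) nerve of the groupoid generated by one isomorphism $0\to1$. *)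

theory Defs
  imports Main "HOL-Library.FuncSet"
begin

text \<open>
  \<infinity>-groupoids are modelled by Kan complexes, and functors from \<open>\<Delta>\<close>-op to \<infinity>-groupoids by Reedy
  fibrant simplicial objects in Kan complexes.  Every such functor is presented by a Reedy fibrant
  one, and for those the derived mapping spaces \<open>Map(K, X)\<close> out of a discrete simplicial space
  \<open>K\<close> are computed strictly.  Pullbacks and fibres are explicit homotopy pullbacks and
  homotopy fibres.
\<close>

section \<open>The category \<open>\<Delta>\<close>\<close>

text \<open>
  A morphism \<open>[m] \<rightarrow> [n]\<close> is represented by any function on the natural numbers that restricts to
  a monotone map \<open>{..m} \<rightarrow> {..n}\<close>; two functions represent the same morphism iff they agree on
  \<open>{..m}\<close>.
\<close>

definition delta_map :: "nat \<Rightarrow> nat \<Rightarrow> (nat \<Rightarrow> nat) \<Rightarrow> bool" where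
  "delta_map m n \<theta> \<longleftrightarrow> \<theta> \<in> {..m} \<rightarrow> {..n} \<and> mono_on {..m} \<theta>"

definition delta_eq :: "nat \<Rightarrow> (nat \<Rightarrow> nat) \<Rightarrow> (nat \<Rightarrow> nat) \<Rightarrow> bool" where
  "delta_eq m \<theta> \<phi> \<longleftrightarrow> (\<forall>i\<le>m. \<theta> i = \<phi> i)"

definition generic_map :: "nat \<Rightarrow> nat \<Rightarrow> (nat \<Rightarrow> nat) \<Rightarrow> bool" where
  "generic_map m n \<theta> \<longleftrightarrow> delta_map m n \<theta> \<and> \<theta> 0 = 0 \<and> \<theta> m = n"

definition free_map :: "nat \<Rightarrow> nat \<Rightarrow> (nat \<Rightarrow> nat) \<Rightarrow> bool" where
  "free_map m n \<theta> \<longleftrightarrow> delta_map m n \<theta> \<and> (\<forall>i<m. \<theta> (Suc i) = Suc (\<theta> i))"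

text \<open>
  \<open>[l]\<close> with \<open>g' : [n] \<rightarrow> [l]\<close> and \<open>f' : [k] \<rightarrow> [l]\<close> is a pushout in \<open>\<Delta>\<close> of \<open>g : [m] \<rightarrow> [n]\<close> and
  \<open>f : [m] \<rightarrow> [k]\<close>.
\<close>

definition delta_pushout ::
  "nat \<Rightarrow> nat \<Rightarrow> nat \<Rightarrow> nat \<Rightarrow> (nat \<Rightarrow> nat) \<Rightarrow> (nat \<Rightarrow> nat) \<Rightarrow> (nat \<Rightarrow> nat) \<Rightarrow> (nat \<Rightarrow> nat) \<Rightarrow> bool"
where
  "delta_pushout m n k l g f g' f' \<longleftrightarrow>
     delta_map m n g \<and> delta_map m k f \<and> delta_map n l g' \<and> delta_map k l f' \<and>
     delta_eq m (g' \<circ> g) (f' \<circ> f) \<and>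
     (\<forall>t u v. delta_map n t u \<and> delta_map k t v \<and> delta_eq m (u \<circ> g) (v \<circ> f) \<longrightarrow>
        (\<exists>w. delta_map l t w \<and> delta_eq n (w \<circ> g') u \<and> delta_eq k (w \<circ> f') v \<and>
           (\<forall>w'. delta_map l t w' \<and> delta_eq n (w' \<circ> g') u \<and> delta_eq k (w' \<circ> f') v
              \<longrightarrow> delta_eq l w' w)))"

section \<open>Simplicial sets\<close>

text \<open>\<open>act K m n \<theta>\<close> is the map \<open>K\<^sub>n \<rightarrow> K\<^sub>m\<close> induced by \<open>\<theta> : [m] \<rightarrow> [n]\<close>.\<close>

record 'a sset =
  cells :: "nat \<Rightarrow> 'a set"
  act :: "nat \<Rightarrow> nat \<Rightarrow> (nat \<Rightarrow> nat) \<Rightarrow> 'a \<Rightarrow> 'a"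

definition simplicial_set :: "'a sset \<Rightarrow> bool" where
  "simplicial_set K \<longleftrightarrow>
     (\<forall>m n \<theta>. delta_map m n \<theta> \<longrightarrow> act K m n \<theta> \<in> cells K n \<rightarrow> cells K m) \<and>
     (\<forall>m n \<theta> \<phi>. \<forall>x\<in>cells K n. delta_map m n \<theta> \<and> delta_map m n \<phi> \<and> delta_eq m \<theta> \<phi> \<longrightarrow>
        act K m n \<theta> x = act K m n \<phi> x) \<and>
     (\<forall>n. \<forall>x\<in>cells K n. act K n n id x = x) \<and>
     (\<forall>l m n \<theta> \<phi>. \<forall>x\<in>cells K n. delta_map l m \<phi> \<and> delta_map m n \<theta> \<longrightarrow>
        act K l n (\<theta> \<circ> \<phi>) x = act K l m \<phi> (act K m n \<theta> x))"

definition simplicial_map :: "'a sset \<Rightarrow> 'b sset \<Rightarrow> (nat \<Rightarrow> 'a \<Rightarrow> 'b) \<Rightarrow> bool" where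
  "simplicial_map K L f \<longleftrightarrow>
     (\<forall>n. f n \<in> cells K n \<rightarrow> cells L n) \<and>
     (\<forall>m n \<theta>. \<forall>x\<in>cells K n. delta_map m n \<theta> \<longrightarrow> f m (act K m n \<theta> x) = act L m n \<theta> (f n x))"

text \<open>Extensionality makes equality in the hom-set coincide with equality of simplicial maps.\<close>

definition sset_hom :: "'a sset \<Rightarrow> 'b sset \<Rightarrow> (nat \<Rightarrow> 'a \<Rightarrow> 'b) set" where
  "sset_hom K L = {f. simplicial_map K L f \<and> (\<forall>n. f n \<in> extensional (cells K n))}"

text \<open>
  The nerve of the preorder \<open>R\<close> on \<open>A\<close>, regarded as a category with at most one morphism between
  any two objects: an \<open>n\<close>-simplex is a functor \<open>[n] \<rightarrow> (A, R)\<close>, written as the list of its \<open>n + 1\<close>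
  values.
\<close>

definition nerve :: "'a set \<Rightarrow> ('a \<Rightarrow> 'a \<Rightarrow> bool) \<Rightarrow> 'a list sset" where
  "nerve A R =
     \<lparr>cells = (\<lambda>n. {xs. length xs = Suc n \<and> set xs \<subseteq> A \<and> sorted_wrt R xs}),
      act = (\<lambda>m n \<theta> xs. map (\<lambda>i. xs ! \<theta> i) [0..<Suc m])\<rparr>"

definition std_simplex :: "nat \<Rightarrow> nat list sset" where
  "std_simplex n = nerve {..n} (\<le>)"

definition simplex_boundary :: "nat \<Rightarrow> nat list sset" where
  "simplex_boundary n =
     \<lparr>cells = (\<lambda>m. {xs \<in> cells (std_simplex n) m. set xs \<noteq> {..n}}),
      act = act (std_simplex n)\<rparr>"

text \<open>
  The nerve of the groupoid generated by one isomorphism \<open>0 \<rightarrow> 1\<close>: this groupoid has the two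
  objects \<open>0\<close> and \<open>1\<close> and exactly one morphism between any two objects.
\<close>

definition walking_iso :: "nat list sset" where
  "walking_iso = nerve {0, 1} (\<lambda>_ _. True)"

definition sset_prod :: "'a sset \<Rightarrow> 'b sset \<Rightarrow> ('a \<times> 'b) sset" where
  "sset_prod K L =
     \<lparr>cells = (\<lambda>n. cells K n \<times> cells L n),
      act = (\<lambda>m n \<theta>. map_prod (act K m n \<theta>) (act L m n \<theta>))\<rparr>"

text \<open>The internal hom \<open>L\<^sup>K\<close>, with \<open>n\<close>-simplices the maps \<open>\<Delta>[n] \<times> K \<rightarrow> L\<close>.\<close>

definition sset_exp :: "'k sset \<Rightarrow> 'a sset \<Rightarrow> (nat \<Rightarrow> nat list \<times> 'k \<Rightarrow> 'a) sset" where
  "sset_exp K L =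
     \<lparr>cells = (\<lambda>n. sset_hom (sset_prod (std_simplex n) K) L),
      act = (\<lambda>m n \<theta> \<phi> q. restrict (\<lambda>(s, k). \<phi> q (map \<theta> s, k))
                               (cells (sset_prod (std_simplex m) K) q))\<rparr>"

definition full_sub :: "'a sset \<Rightarrow> 'a set \<Rightarrow> 'a sset" where
  "full_sub K V =
     \<lparr>cells = (\<lambda>n. {x \<in> cells K n. \<forall>i\<le>n. act K 0 n (\<lambda>_. i) x \<in> V}), act = act K\<rparr>"

section \<open>Kan complexes and equivalences\<close>

definition coface :: "nat \<Rightarrow> nat \<Rightarrow> nat" where
  "coface i j = (if j < i then j else Suc j)"

definition face :: "'a sset \<Rightarrow> nat \<Rightarrow> nat \<Rightarrow> 'a \<Rightarrow> 'a" where
  "face K n i = act K (n - 1) n (coface i)"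

text \<open>
  A map \<open>\<Lambda>\<^sup>k[n+1] \<rightarrow> E\<close> is given by a family of \<open>n\<close>-simplices \<open>x i\<close>, \<open>i \<noteq> k\<close>, such that
  \<open>d\<^sub>i (x j) = d\<^bsub>j-1\<^esub> (x i)\<close> whenever \<open>i < j\<close>.  For \<open>n = 0\<close> there is no pair \<open>i < j\<close> to consider.
\<close>

definition horn :: "'a sset \<Rightarrow> nat \<Rightarrow> nat \<Rightarrow> (nat \<Rightarrow> 'a) \<Rightarrow> bool" where
  "horn E n k x \<longleftrightarrow>
     (\<forall>i\<le>Suc n. i \<noteq> k \<longrightarrow> x i \<in> cells E n) \<and>
     (\<forall>i j. i < j \<and> j \<le> Suc n \<and> i \<noteq> k \<and> j \<noteq> k \<longrightarrow> face E n i (x j) = face E n (j - 1) (x i))"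

definition kan_fibration :: "'a sset \<Rightarrow> 'b sset \<Rightarrow> (nat \<Rightarrow> 'a \<Rightarrow> 'b) \<Rightarrow> bool" where
  "kan_fibration E B p \<longleftrightarrow>
     simplicial_map E B p \<and>
     (\<forall>n k x b. k \<le> Suc n \<and> horn E n k x \<and> b \<in> cells B (Suc n) \<and>
        (\<forall>i\<le>Suc n. i \<noteq> k \<longrightarrow> face B (Suc n) i b = p n (x i)) \<longrightarrow>
        (\<exists>y\<in>cells E (Suc n). p (Suc n) y = b \<and>
           (\<forall>i\<le>Suc n. i \<noteq> k \<longrightarrow> face E (Suc n) i y = x i)))"

definition to_point :: "nat \<Rightarrow> 'a \<Rightarrow> nat list" where
  "to_point n x = replicate (Suc n) 0"

definition kan_complex :: "'a sset \<Rightarrow> bool" where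
  "kan_complex K \<longleftrightarrow> simplicial_set K \<and> kan_fibration K (std_simplex 0) to_point"

definition homotopic ::
  "'a sset \<Rightarrow> 'b sset \<Rightarrow> (nat \<Rightarrow> 'a \<Rightarrow> 'b) \<Rightarrow> (nat \<Rightarrow> 'a \<Rightarrow> 'b) \<Rightarrow> bool" where
  "homotopic K L f g \<longleftrightarrow>
     (\<exists>H. simplicial_map (sset_prod K (std_simplex 1)) L H \<and>
        (\<forall>n. \<forall>x\<in>cells K n. H n (x, replicate (Suc n) 0) = f n x \<and>
                            H n (x, replicate (Suc n) 1) = g n x))"

text \<open>This is only used between Kan complexes, where it is the correct notion of equivalence.\<close>

definition equivalence :: "'a sset \<Rightarrow> 'b sset \<Rightarrow> (nat \<Rightarrow> 'a \<Rightarrow> 'b) \<Rightarrow> bool" where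
  "equivalence K L f \<longleftrightarrow>
     simplicial_map K L f \<and>
     (\<exists>g. simplicial_map L K g \<and>
        homotopic K K (\<lambda>n. g n \<circ> f n) (\<lambda>n. id) \<and>
        homotopic L L (\<lambda>n. f n \<circ> g n) (\<lambda>n. id))"

definition contractible_sset :: "'a sset \<Rightarrow> bool" where
  "contractible_sset K \<longleftrightarrow> equivalence K (std_simplex 0) to_point"

definition empty_sset :: "'a sset \<Rightarrow> bool" where
  "empty_sset K \<longleftrightarrow> (\<forall>n. cells K n = {})"

section \<open>Homotopy pullbacks and homotopy fibres\<close>

type_synonym 'a path = "nat \<Rightarrow> nat list \<times> nat list \<Rightarrow> 'a"

definition path_space :: "'a sset \<Rightarrow> 'a path sset" where
  "path_space C = sset_exp (std_simplex 1) C"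

text \<open>
  For \<open>\<epsilon> \<in> {0, 1}\<close>, the evaluation \<open>C\<^bsup>\<Delta>[1]\<^esup> \<rightarrow> C\<close> at the vertex \<open>\<epsilon>\<close>, and the inclusion of constant
  paths.
\<close>

definition path_end :: "nat \<Rightarrow> nat \<Rightarrow> 'a path \<Rightarrow> 'a" where
  "path_end \<epsilon> n \<gamma> = \<gamma> n ([0..<Suc n], replicate (Suc n) \<epsilon>)"

definition const_path :: "'a sset \<Rightarrow> nat \<Rightarrow> 'a \<Rightarrow> 'a path" where
  "const_path C n c =
     (\<lambda>q. restrict (\<lambda>(s, e). act C q n (\<lambda>i. s ! i) c)
            (cells (sset_prod (std_simplex n) (std_simplex 1)) q))"

definition hpullback ::
  "'a sset \<Rightarrow> 'b sset \<Rightarrow> 'c sset \<Rightarrow> (nat \<Rightarrow> 'a \<Rightarrow> 'c) \<Rightarrow> (nat \<Rightarrow> 'b \<Rightarrow> 'c) \<Rightarrow>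
     ('a \<times> 'c path \<times> 'b) sset" where
  "hpullback A B C f g =
     \<lparr>cells = (\<lambda>n. {(a, \<gamma>, b). a \<in> cells A n \<and> \<gamma> \<in> cells (path_space C) n \<and> b \<in> cells B n \<and>
                               path_end 0 n \<gamma> = f n a \<and> path_end 1 n \<gamma> = g n b}),
      act = (\<lambda>m n \<theta> (a, \<gamma>, b). (act A m n \<theta> a, act (path_space C) m n \<theta> \<gamma>, act B m n \<theta> b))\<rparr>"

text \<open>
  The strictly commutative square with \<open>u : P \<rightarrow> A\<close>, \<open>v : P \<rightarrow> B\<close>, \<open>f : A \<rightarrow> C\<close>, \<open>g : B \<rightarrow> C\<close> is a
  pullback of \<infinity>-groupoids.
\<close>

definition pullback_square ::
  "'p sset \<Rightarrow> 'a sset \<Rightarrow> 'b sset \<Rightarrow> 'c sset \<Rightarrow> (nat \<Rightarrow> 'p \<Rightarrow> 'a) \<Rightarrow> (nat \<Rightarrow> 'p \<Rightarrow> 'b) \<Rightarrow>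
     (nat \<Rightarrow> 'a \<Rightarrow> 'c) \<Rightarrow> (nat \<Rightarrow> 'b \<Rightarrow> 'c) \<Rightarrow> bool" where
  "pullback_square P A B C u v f g \<longleftrightarrow>
     equivalence P (hpullback A B C f g) (\<lambda>n x. (u n x, const_path C n (f n (u n x)), v n x))"

text \<open>The constant map \<open>\<Delta>[0] \<rightarrow> B\<close> at the vertex \<open>b\<close>, and the homotopy fibre over \<open>b\<close>.\<close>

definition point_map :: "'b sset \<Rightarrow> 'b \<Rightarrow> nat \<Rightarrow> nat list \<Rightarrow> 'b" where
  "point_map B b n s = act B n 0 (\<lambda>_. 0) b"

definition hofibre ::
  "'a sset \<Rightarrow> 'b sset \<Rightarrow> (nat \<Rightarrow> 'a \<Rightarrow> 'b) \<Rightarrow> 'b \<Rightarrow> ('a \<times> 'b path \<times> nat list) sset" where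
  "hofibre A B f b = hpullback A (std_simplex 0) B f (point_map B b)"

definition monomorphism :: "'a sset \<Rightarrow> 'b sset \<Rightarrow> (nat \<Rightarrow> 'a \<Rightarrow> 'b) \<Rightarrow> bool" where
  "monomorphism A B f \<longleftrightarrow>
     simplicial_map A B f \<and>
     (\<forall>b\<in>cells B 0. empty_sset (hofibre A B f b) \<or> contractible_sset (hofibre A B f b))"

section \<open>Simplicial \<infinity>-groupoids\<close>

text \<open>
  \<open>level X n\<close> is the \<infinity>-groupoid \<open>X\<^sub>n\<close>, and \<open>hact X m n \<theta> : X\<^sub>n \<rightarrow> X\<^sub>m\<close> is the map induced by
  \<open>\<theta> : [m] \<rightarrow> [n]\<close>; \<open>row X p\<close> is the simplicial set of \<open>p\<close>-simplices of the \<open>X\<^sub>n\<close>.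
\<close>

record 'a sspace =
  level :: "nat \<Rightarrow> 'a sset"
  hact :: "nat \<Rightarrow> nat \<Rightarrow> (nat \<Rightarrow> nat) \<Rightarrow> nat \<Rightarrow> 'a \<Rightarrow> 'a"

definition row :: "'a sspace \<Rightarrow> nat \<Rightarrow> 'a sset" where
  "row X p = \<lparr>cells = (\<lambda>n. cells (level X n) p), act = (\<lambda>m n \<theta>. hact X m n \<theta> p)\<rparr>"

text \<open>
  The mapping space \<open>Map(K, X)\<close> from a simplicial set \<open>K\<close>, regarded as a discrete simplicial
  space.  Its \<open>p\<close>-simplices are the maps \<open>K \<times> \<Delta>[p] \<rightarrow> X\<close> of bisimplicial sets, which by the Yoneda
  lemma are the maps from \<open>K\<close> to the simplicial set of \<open>p\<close>-simplices of \<open>X\<close>.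
\<close>

definition map_space :: "'k sset \<Rightarrow> 'a sspace \<Rightarrow> (nat \<Rightarrow> 'k \<Rightarrow> 'a) sset" where
  "map_space K X =
     \<lparr>cells = (\<lambda>p. sset_hom K (row X p)),
      act = (\<lambda>p q \<theta> \<phi> n. restrict (\<lambda>k. act (level X n) p q \<theta> (\<phi> n k)) (cells K n))\<rparr>"

text \<open>The map \<open>Map(L, X) \<rightarrow> Map(K, X)\<close> given by precomposition with \<open>u : K \<rightarrow> L\<close>.\<close>

definition precompose ::
  "'k sset \<Rightarrow> (nat \<Rightarrow> 'k \<Rightarrow> 'l) \<Rightarrow> nat \<Rightarrow> (nat \<Rightarrow> 'l \<Rightarrow> 'a) \<Rightarrow> (nat \<Rightarrow> 'k \<Rightarrow> 'a)" where
  "precompose K u p \<phi> = (\<lambda>n. restrict (\<lambda>k. \<phi> n (u n k)) (cells K n))"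

text \<open>The map from \<open>X\<^sub>n\<close> to the matching object \<open>M\<^sub>n X = Map(\<partial>\<Delta>[n], X)\<close>.\<close>

definition matching_map ::
  "'a sspace \<Rightarrow> nat \<Rightarrow> nat \<Rightarrow> 'a \<Rightarrow> (nat \<Rightarrow> nat list \<Rightarrow> 'a)" where
  "matching_map X n p x =
     (\<lambda>m. restrict (\<lambda>s. hact X m n (\<lambda>i. s ! i) p x) (cells (simplex_boundary n) m))"

definition simplicial_space :: "'a sspace \<Rightarrow> bool" where
  "simplicial_space X \<longleftrightarrow>
     (\<forall>n. kan_complex (level X n)) \<and>
     (\<forall>m n \<theta>. delta_map m n \<theta> \<longrightarrow> simplicial_map (level X n) (level X m) (hact X m n \<theta>)) \<and>
     (\<forall>p. simplicial_set (row X p)) \<and>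
     (\<forall>n. kan_fibration (level X n) (map_space (simplex_boundary n) X) (matching_map X n))"

section \<open>Decomposition spaces\<close>

definition decomposition_space :: "'a sspace \<Rightarrow> bool" where
  "decomposition_space X \<longleftrightarrow>
     simplicial_space X \<and>
     (\<forall>m n k l g f g' f'. generic_map m n g \<and> free_map m k f \<and>
        delta_pushout m n k l g f g' f' \<longrightarrow>
        pullback_square (level X l) (level X n) (level X k) (level X m)
          (hact X n l g') (hact X k l f') (hact X m n g) (hact X m k f))"

definition complete_decomposition_space :: "'a sspace \<Rightarrow> bool" where
  "complete_decomposition_space X \<longleftrightarrow>
     decomposition_space X \<and> monomorphism (level X 0) (level X 1) (hact X 1 0 (\<lambda>_. 0))"

text \<open>
  The subgroupoid \<open>s\<^sub>0(X\<^sub>0)\<close> of \<open>X\<^sub>1\<close> is the essential image, so its objects are the vertices of \<open>X\<^sub>1\<close>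
  in the same path component as some \<open>s\<^sub>0 x\<close>.
\<close>

definition nondegenerate_edge :: "'a sspace \<Rightarrow> 'a \<Rightarrow> bool" where
  "nondegenerate_edge X a \<longleftrightarrow>
     a \<in> cells (level X 1) 0 \<and>
     \<not> (\<exists>x\<in>cells (level X 0) 0. \<exists>e\<in>cells (level X 1) 1.
          face (level X 1) 1 1 e = hact X 1 0 (\<lambda>_. 0) 0 x \<and> face (level X 1) 1 0 e = a)"

text \<open>\<open>principal i : [1] \<rightarrow> [r]\<close> picks out the edge from \<open>i\<close> to \<open>i + 1\<close>.\<close>

definition principal :: "nat \<Rightarrow> nat \<Rightarrow> nat" where
  "principal i j = i + j"

definition nondegenerate_simplices :: "'a sspace \<Rightarrow> nat \<Rightarrow> 'a sset" where
  "nondegenerate_simplices X r =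
     full_sub (level X r)
       {x \<in> cells (level X r) 0. \<forall>i<r. nondegenerate_edge X (hact X 1 r (principal i) 0 x)}"

definition long_edge :: "nat \<Rightarrow> nat \<Rightarrow> nat" where
  "long_edge r j = (if j = 0 then 0 else r)"

definition tight_decomposition_space :: "'a sspace \<Rightarrow> bool" where
  "tight_decomposition_space X \<longleftrightarrow>
     complete_decomposition_space X \<and>
     (\<forall>a\<in>cells (level X 1) 0. \<exists>N. \<forall>r\<ge>N.
        empty_sset (hofibre (nondegenerate_simplices X r) (level X 1) (hact X 1 r (long_edge r)) a))"

section \<open>Segal spaces and Rezk completeness\<close>

text \<open>
  The \<open>r\<close>-fold homotopy fibre product \<open>X\<^sub>1 \<times>\<^bsub>X\<^sub>0\<^esub> \<cdots> \<times>\<^bsub>X\<^sub>0\<^esub> X\<^sub>1\<close>, for \<open>r \<ge> 1\<close>: lists of \<open>r\<close> edges together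
  with \<open>r - 1\<close> paths in \<open>X\<^sub>0\<close> from the target of each edge to the source of the next.
\<close>

definition segal_product :: "'a sspace \<Rightarrow> nat \<Rightarrow> ('a list \<times> 'a path list) sset" where
  "segal_product X r =
     \<lparr>cells = (\<lambda>n. {(xs, gs). length xs = r \<and> set xs \<subseteq> cells (level X 1) n \<and>
                   length gs = r - 1 \<and> set gs \<subseteq> cells (path_space (level X 0)) n \<and>
                   (\<forall>i<r - 1. path_end 0 n (gs ! i) = hact X 0 1 (\<lambda>_. 1) n (xs ! i) \<and>
                              path_end 1 n (gs ! i) = hact X 0 1 (\<lambda>_. 0) n (xs ! Suc i))}),
      act = (\<lambda>m n \<theta> (xs, gs). (map (act (level X 1) m n \<theta>) xs,
                               map (act (path_space (level X 0)) m n \<theta>) gs))\<rparr>"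

definition segal_map :: "'a sspace \<Rightarrow> nat \<Rightarrow> nat \<Rightarrow> 'a \<Rightarrow> 'a list \<times> 'a path list" where
  "segal_map X r n x =
     (map (\<lambda>i. hact X 1 r (principal i) n x) [0..<r],
      map (\<lambda>i. const_path (level X 0) n (hact X 0 r (\<lambda>_. i) n x)) [1..<r])"

definition segal_space :: "'a sspace \<Rightarrow> bool" where
  "segal_space X \<longleftrightarrow>
     simplicial_space X \<and>
     (\<forall>r\<ge>1. equivalence (level X r) (segal_product X r) (segal_map X r))"

definition rezk_complete :: "'a sspace \<Rightarrow> bool" where
  "rezk_complete X \<longleftrightarrow>
     equivalence (map_space (std_simplex 0) X) (map_space walking_iso X)
       (precompose walking_iso to_point)"

end

theory Submission
  imports Defs
begin

text \<open>
  Let \<open>Y \<subseteq> X\<close> be the part of \<open>X\<close> all of whose edges are degenerate.  For a map \<open>J \<rightarrow> X\<close>, the images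
  of the alternating simplices \<open>0101\<dots>0\<close> have arbitrarily many principal edges over one fixed long
  edge, so tightness makes one of the two generating edges degenerate; the decomposition axiom for
  \<open>[1] \<rightarrow> [0]\<close> along \<open>[1] \<rightarrow> [n]\<close>, which strips off a degenerate first edge, makes the other one
  degenerate as well.  Hence \<open>Map(J, X) = Map(J, Y)\<close>.  Stripping off edges also shows that
  \<open>Y\<^sub>n \<rightarrow> Y\<^sub>0 = X\<^sub>0\<close> is a trivial fibration for all \<open>n\<close>, using that \<open>s\<^sub>0\<close> is a monomorphism.  By Reedy
  fibrancy \<open>Y\<close> then extends along all horns \<open>\<Lambda>\<^sup>0[k] \<rightarrow> \<Delta>[k]\<close>, and \<open>J\<close> is obtained from its vertex \<open>0\<close>
  by attaching one such horn in each dimension, so \<open>Map(J, Y) \<rightarrow> Y\<^sub>0\<close> is a trivial fibration with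
  section \<open>X\<^sub>0 \<rightarrow> Map(J, X)\<close>.
\<close>

section \<open>Simplicial sets and their subobjects\<close>

text \<open>The hypotheses are homotopical: equivalences, homotopy fibres, path components. Building
  a map cell by cell over \<open>walking_iso\<close> needs strict extensions. Hence every fact is
  recast as a strict lifting property against an inclusion of simplicial sets, and homotopical input
  is made strict by homotopy lifting, which rests on filling prisms by horns.

  A second obstacle is the presence of two simplicial directions. Stripping an edge and contracting
  a fibre happen inside a single space \<open>X\<^sub>n\<close>; attaching cells to
  \<open>walking_iso\<close> happens in the other direction. \<open>blifts\<close> states lifting
  problems in both directions at once and can be read in either.

  The horns at vertex 0 appear because among the faces of 0101... only the one opposite that vertex,
  1010..., is new. Extension from the vertex 0 to the simplex is known, extension from the vertex 0
  to the horn follows by induction on dimension, and the fibration property allows the latter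
  inclusion to be cancelled from the former.\<close>

lemma delta_map_comp:
  assumes "delta_map l m \<phi>" "delta_map m n \<theta>"
  shows "delta_map l n (\<theta> \<circ> \<phi>)"
  using assms unfolding delta_map_def mono_on_def by (auto simp: Pi_iff)

lemma delta_map_id: "delta_map n n id"
  by (auto simp: delta_map_def mono_on_def)

lemma delta_map_const: "i \<le> n \<Longrightarrow> delta_map m n (\<lambda>_. i)"
  by (auto simp: delta_map_def mono_on_def)

lemma delta_map_le: "delta_map m n \<theta> \<Longrightarrow> i \<le> m \<Longrightarrow> \<theta> i \<le> n"
  by (auto simp: delta_map_def)

lemma delta_map_mono: "delta_map m n \<theta> \<Longrightarrow> i \<le> j \<Longrightarrow> j \<le> m \<Longrightarrow> \<theta> i \<le> \<theta> j"
  by (auto simp: delta_map_def mono_on_def)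

lemma delta_mapI:
  "(\<And>i. i \<le> m \<Longrightarrow> \<theta> i \<le> n) \<Longrightarrow> (\<And>i j. i \<le> j \<Longrightarrow> j \<le> m \<Longrightarrow> \<theta> i \<le> \<theta> j) \<Longrightarrow> delta_map m n \<theta>"
  by (auto simp: delta_map_def mono_on_def)

lemma delta_map_cong:
  assumes "delta_map m n \<theta>" "\<And>i. i \<le> m \<Longrightarrow> \<theta> i = \<phi> i"
  shows "delta_map m n \<phi>"
proof (rule delta_mapI)
  fix i assume "i \<le> m"
  then show "\<phi> i \<le> n" using assms(2)[of i] delta_map_le[OF assms(1), of i] by simp
next
  fix i j :: nat assume "i \<le> j" "j \<le> m"
  then show "\<phi> i \<le> \<phi> j"
    using assms(2)[of i] assms(2)[of j] delta_map_mono[OF assms(1), of i j] by simp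
qed

lemma ss_closed:
  "simplicial_set K \<Longrightarrow> delta_map m n \<theta> \<Longrightarrow> x \<in> cells K n \<Longrightarrow> act K m n \<theta> x \<in> cells K m"
  unfolding simplicial_set_def by blast

lemma ss_eq:
  "simplicial_set K \<Longrightarrow> delta_map m n \<theta> \<Longrightarrow> x \<in> cells K n \<Longrightarrow> (\<And>i. i \<le> m \<Longrightarrow> \<theta> i = \<phi> i) \<Longrightarrow>
    act K m n \<theta> x = act K m n \<phi> x"
proof -
  assume a: "simplicial_set K" "delta_map m n \<theta>" "x \<in> cells K n" "\<And>i. i \<le> m \<Longrightarrow> \<theta> i = \<phi> i"
  have "delta_map m n \<phi>" by (rule delta_map_cong[OF a(2,4)])
  with a show ?thesis unfolding simplicial_set_def delta_eq_def by blast
qed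

lemma ss_id:
  "simplicial_set K \<Longrightarrow> x \<in> cells K n \<Longrightarrow> (\<And>i. i \<le> n \<Longrightarrow> \<theta> i = i) \<Longrightarrow> act K n n \<theta> x = x"
proof -
  assume a: "simplicial_set K" "x \<in> cells K n" "\<And>i. i \<le> n \<Longrightarrow> \<theta> i = i"
  have "act K n n id x = act K n n \<theta> x"
    using a by (intro ss_eq) (auto simp: delta_map_id)
  moreover have "act K n n id x = x" using a unfolding simplicial_set_def by blast
  ultimately show ?thesis by simp
qed

lemma ss_comp:
  "simplicial_set K \<Longrightarrow> delta_map l m \<phi> \<Longrightarrow> delta_map m n \<theta> \<Longrightarrow> x \<in> cells K n \<Longrightarrow>
    act K l m \<phi> (act K m n \<theta> x) = act K l n (\<theta> \<circ> \<phi>) x"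
  unfolding simplicial_set_def by auto

lemma ss_comp':
  "simplicial_set K \<Longrightarrow> delta_map l m \<phi> \<Longrightarrow> delta_map m n \<theta> \<Longrightarrow> x \<in> cells K n \<Longrightarrow>
    (\<And>i. i \<le> l \<Longrightarrow> \<theta> (\<phi> i) = \<psi> i) \<Longrightarrow>
    act K l m \<phi> (act K m n \<theta> x) = act K l n \<psi> x"
  by (simp add: ss_comp) (rule ss_eq, auto intro: delta_map_comp)

lemma sm_closed: "simplicial_map K L f \<Longrightarrow> x \<in> cells K n \<Longrightarrow> f n x \<in> cells L n"
  unfolding simplicial_map_def by blast

lemma sm_nat:
  "simplicial_map K L f \<Longrightarrow> x \<in> cells K n \<Longrightarrow> delta_map m n \<theta> \<Longrightarrow>
    f m (act K m n \<theta> x) = act L m n \<theta> (f n x)"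
  unfolding simplicial_map_def by blast

lemma smI:
  "(\<And>n x. x \<in> cells K n \<Longrightarrow> f n x \<in> cells L n) \<Longrightarrow>
   (\<And>m n \<theta> x. x \<in> cells K n \<Longrightarrow> delta_map m n \<theta> \<Longrightarrow> f m (act K m n \<theta> x) = act L m n \<theta> (f n x)) \<Longrightarrow>
   simplicial_map K L f"
  unfolding simplicial_map_def by blast

lemma sm_comp:
  "simplicial_map K L f \<Longrightarrow> simplicial_map L M g \<Longrightarrow> simplicial_map K M (\<lambda>n x. g n (f n x))"
  by (rule smI) (auto simp: sm_nat sm_closed)

lemma sm_cong:
  assumes "simplicial_set K" "simplicial_map K L f" "\<And>n x. x \<in> cells K n \<Longrightarrow> f n x = g n x"
  shows "simplicial_map K L g"
  using assms by (intro smI) (metis sm_closed, metis sm_nat ss_closed)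

text \<open>Subobjects are families of sets of cells inside one ambient simplicial set, so
  restrictions, unions and chains of subobjects need no inclusion maps.\<close>

definition subsset :: "'a sset \<Rightarrow> (nat \<Rightarrow> 'a set) \<Rightarrow> bool" where
  "subsset K M \<longleftrightarrow> (\<forall>n. M n \<subseteq> cells K n) \<and>
     (\<forall>m n \<theta> x. delta_map m n \<theta> \<longrightarrow> x \<in> M n \<longrightarrow> act K m n \<theta> x \<in> M m)"

lemma subssetI:
  "(\<And>n x. x \<in> M n \<Longrightarrow> x \<in> cells K n) \<Longrightarrow>
   (\<And>m n \<theta> x. delta_map m n \<theta> \<Longrightarrow> x \<in> M n \<Longrightarrow> act K m n \<theta> x \<in> M m) \<Longrightarrow> subsset K M"
  unfolding subsset_def by blast

lemma subsset_in: "subsset K M \<Longrightarrow> x \<in> M n \<Longrightarrow> x \<in> cells K n"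
  unfolding subsset_def by blast

lemma subsset_act: "subsset K M \<Longrightarrow> delta_map m n \<theta> \<Longrightarrow> x \<in> M n \<Longrightarrow> act K m n \<theta> x \<in> M m"
  unfolding subsset_def by blast

abbreviation restr :: "'a sset \<Rightarrow> (nat \<Rightarrow> 'a set) \<Rightarrow> 'a sset" where
  "restr K M \<equiv> K\<lparr>cells := M\<rparr>"

lemma ss_sub:
  assumes "simplicial_set K" "subsset K M"
  shows "simplicial_set (restr K M)"
  unfolding simplicial_set_def
proof (intro conjI allI ballI impI, goal_cases)
  case (1 m n \<theta>)
  then show ?case using subsset_act[OF assms(2)] by auto
next
  case (2 m n \<theta> \<phi> x)
  then show ?case using subsset_in[OF assms(2)] by (auto simp: delta_eq_def intro!: ss_eq[OF assms(1)])
next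
  case (3 n x)
  then show ?case using subsset_in[OF assms(2)] by (auto intro!: ss_id[OF assms(1)])
next
  case (4 l m n \<theta> \<phi> x)
  then show ?case using subsset_in[OF assms(2)] by (auto simp: ss_comp[OF assms(1)])
qed

lemma sm_sub: "simplicial_map K L f \<Longrightarrow> subsset K M \<Longrightarrow> simplicial_map (restr K M) L f"
  by (rule smI) (auto simp: sm_nat sm_closed subsset_in)

section \<open>Standard simplices\<close>

lemma cells_nerve: "xs \<in> cells (nerve A R) n \<longleftrightarrow> length xs = Suc n \<and> set xs \<subseteq> A \<and> sorted_wrt R xs"
  by (simp add: nerve_def)

lemma act_nerve: "act (nerve A R) m n \<theta> xs = map (\<lambda>i. xs ! \<theta> i) [0..<Suc m]"
  by (simp add: nerve_def)

lemma simplicial_set_nerve: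
  assumes "\<And>x. x \<in> A \<Longrightarrow> R x x"
  shows "simplicial_set (nerve A R)"
proof -
  have cl: "act (nerve A R) m n \<theta> xs \<in> cells (nerve A R) m"
    if "xs \<in> cells (nerve A R) n" "delta_map m n \<theta>" for m n \<theta> xs
  proof -
    have "xs ! \<theta> i \<in> A" if "i \<le> m" for i
      using that \<open>xs \<in> _\<close> delta_map_le[OF \<open>delta_map m n \<theta>\<close>, of i] by (auto simp: cells_nerve subset_iff)
    moreover have "R (xs ! \<theta> i) (xs ! \<theta> j)" if "i < j" "j \<le> m" for i j
    proof (cases "\<theta> i = \<theta> j")
      case True then show ?thesis using assms calculation[of j] that by simp
    next
      case False
      then have "\<theta> i < \<theta> j" "\<theta> j \<le> n"
        using delta_map_le[OF \<open>delta_map m n \<theta>\<close>, of j] delta_map_mono[OF \<open>delta_map m n \<theta>\<close>, of i j] that by auto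
      then show ?thesis using \<open>xs \<in> _\<close> by (auto simp: cells_nerve sorted_wrt_iff_nth_less)
    qed
    ultimately show ?thesis
      by (auto simp: cells_nerve act_nerve sorted_wrt_iff_nth_less less_Suc_eq_le simp del: upt_Suc)
  qed
  show ?thesis unfolding simplicial_set_def
  proof (intro conjI allI ballI impI)
    fix m n \<theta> assume "delta_map m n \<theta>"
    then show "act (nerve A R) m n \<theta> \<in> cells (nerve A R) n \<rightarrow> cells (nerve A R) m" using cl by blast
  next
    fix m n \<theta> \<phi> x assume "x \<in> cells (nerve A R) n" "delta_map m n \<theta> \<and> delta_map m n \<phi> \<and> delta_eq m \<theta> \<phi>"
    then show "act (nerve A R) m n \<theta> x = act (nerve A R) m n \<phi> x"
      by (auto simp: act_nerve delta_eq_def)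
  next
    fix n x assume "x \<in> cells (nerve A R) n"
    then show "act (nerve A R) n n id x = x"
      by (auto simp: act_nerve cells_nerve intro!: nth_equalityI simp del: upt_Suc)
  next
    fix l m n \<theta> \<phi> x assume a: "x \<in> cells (nerve A R) n" "delta_map l m \<phi> \<and> delta_map m n \<theta>"
    then show "act (nerve A R) l n (\<theta> \<circ> \<phi>) x = act (nerve A R) l m \<phi> (act (nerve A R) m n \<theta> x)"
      using delta_map_le[of l m \<phi>]
      by (auto simp: act_nerve less_Suc_eq_le nth_append intro!: nth_equalityI simp del: upt_Suc)
  qed
qed

lemma simplicial_set_std: "simplicial_set (std_simplex n)"
  unfolding std_simplex_def by (rule simplicial_set_nerve) simp

lemma cells_std: "s \<in> cells (std_simplex n) m \<longleftrightarrow> length s = Suc m \<and> (\<forall>i\<le>m. s ! i \<le> n) \<and>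
    (\<forall>i j. i \<le> j \<longrightarrow> j \<le> m \<longrightarrow> s ! i \<le> s ! j)"
proof -
  have "sorted_wrt (\<le>) s \<longleftrightarrow> (\<forall>i j. i \<le> j \<longrightarrow> j \<le> m \<longrightarrow> s ! i \<le> s ! j)" if "length s = Suc m"
    using that by (auto simp: sorted_iff_nth_mono less_Suc_eq_le)
  moreover have "set s \<subseteq> {..n} \<longleftrightarrow> (\<forall>i\<le>m. s ! i \<le> n)" if "length s = Suc m"
    using that by (auto simp: set_conv_nth less_Suc_eq_le)
  ultimately show ?thesis unfolding std_simplex_def cells_nerve by blast
qed

lemma act_std: "act (std_simplex n) l m \<theta> s = map (\<lambda>i. s ! \<theta> i) [0..<Suc l]"
  by (simp add: std_simplex_def act_nerve)

lemma nth_map_upt': "i \<le> m \<Longrightarrow> map \<theta> [0..<Suc m] ! i = \<theta> i"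
  by (simp add: less_Suc_eq_le del: upt_Suc)

lemma nth_act_std: "i \<le> l \<Longrightarrow> act (std_simplex n) l m \<theta> s ! i = s ! \<theta> i"
  by (simp add: act_std nth_map_upt' del: upt_Suc)

lemma delta_map_std: "s \<in> cells (std_simplex n) m \<longleftrightarrow> length s = Suc m \<and> delta_map m n ((!) s)"
  unfolding cells_std by (auto intro: delta_mapI dest: delta_map_le delta_map_mono)

lemma std_deltaD: "s \<in> cells (std_simplex n) m \<Longrightarrow> delta_map m n ((!) s)"
  by (simp add: delta_map_std)

lemma std_of_delta: "delta_map m n \<theta> \<Longrightarrow> map \<theta> [0..<Suc m] \<in> cells (std_simplex n) m"
  unfolding cells_std
  by (auto simp: nth_map_upt' simp del: upt_Suc intro: delta_map_le delta_map_mono order_trans)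

lemma std_id: "[0..<Suc n] \<in> cells (std_simplex n) n"
  using std_of_delta[OF delta_map_id, of n] by simp

lemma std_set: "s \<in> cells (std_simplex n) m \<Longrightarrow> set s = (!) s ` {..m}"
  by (auto simp: cells_std set_conv_nth less_Suc_eq_le)

lemma std_eqI:
  "s \<in> cells (std_simplex n) m \<Longrightarrow> length t = Suc m \<Longrightarrow> (\<And>i. i \<le> m \<Longrightarrow> s ! i = t ! i) \<Longrightarrow> s = t"
  by (auto simp: cells_std intro: nth_equalityI)

lemma std_act_id:
  "s \<in> cells (std_simplex n) m \<Longrightarrow> act (std_simplex n) m n ((!) s) [0..<Suc n] = s"
  by (rule nth_equalityI) (auto simp: act_std cells_std less_Suc_eq_le nth_append simp del: upt_Suc)

lemma length_act_std [simp]: "length (act (std_simplex n) l m \<theta> s) = Suc l"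
  by (simp add: act_std)

lemma act_act_std:
  assumes "simplicial_set K" "x \<in> cells K n" "s \<in> cells (std_simplex n) m" "delta_map l m \<theta>"
  shows "act K l m \<theta> (act K m n ((!) s) x) = act K l n ((!) (act (std_simplex n) l m \<theta> s)) x"
  using assms by (intro ss_comp') (auto simp: nth_act_std delta_map_std)

lemma yoneda_map:
  assumes "simplicial_set K" "x \<in> cells K n"
  shows "simplicial_map (std_simplex n) K (\<lambda>m s. act K m n ((!) s) x)"
  using assms by (intro smI) (auto simp: act_act_std intro: ss_closed std_deltaD)

lemma yoneda_eq:
  assumes "simplicial_map (std_simplex n) K f" "s \<in> cells (std_simplex n) m"
  shows "f m s = act K m n ((!) s) (f n [0..<Suc n])"
  using sm_nat[OF assms(1) std_id std_deltaD[OF assms(2)]] std_act_id[OF assms(2)] by simp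

section \<open>Lifting properties\<close>

text \<open>The right lifting property of \<open>q\<close> against the inclusion of \<open>M\<close>
  in \<open>L\<close>. Maps are plain functions compared on cells only, so their values elsewhere
  are irrelevant.\<close>

definition lifts ::
  "'e sset \<Rightarrow> 'b sset \<Rightarrow> (nat \<Rightarrow> 'e \<Rightarrow> 'b) \<Rightarrow> 'l sset \<Rightarrow> (nat \<Rightarrow> 'l set) \<Rightarrow> bool" where
  "lifts E B q L M \<longleftrightarrow>
     (\<forall>f b. simplicial_map (restr L M) E f \<and> simplicial_map L B b \<and> (\<forall>n. \<forall>x\<in>M n. q n (f n x) = b n x) \<longrightarrow>
       (\<exists>h. simplicial_map L E h \<and> (\<forall>n. \<forall>x\<in>M n. h n x = f n x) \<and> (\<forall>n. \<forall>x\<in>cells L n. q n (h n x) = b n x)))"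

lemma liftsD:
  assumes "lifts E B q L M" "simplicial_map (restr L M) E f" "simplicial_map L B b"
    "\<And>n x. x \<in> M n \<Longrightarrow> q n (f n x) = b n x"
  obtains h where "simplicial_map L E h" "\<And>n x. x \<in> M n \<Longrightarrow> h n x = f n x"
    "\<And>n x. x \<in> cells L n \<Longrightarrow> q n (h n x) = b n x"
  using assms unfolding lifts_def by metis

lemma liftsI:
  assumes "\<And>f b. simplicial_map (restr L M) E f \<Longrightarrow> simplicial_map L B b \<Longrightarrow>
    (\<And>n x. x \<in> M n \<Longrightarrow> q n (f n x) = b n x) \<Longrightarrow>
    \<exists>h. simplicial_map L E h \<and> (\<forall>n. \<forall>x\<in>M n. h n x = f n x) \<and> (\<forall>n. \<forall>x\<in>cells L n. q n (h n x) = b n x)"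
  shows "lifts E B q L M"
  using assms unfolding lifts_def by blast

lemma lifts_trans:
  assumes "lifts E B q (restr L N) M" "lifts E B q L N" "subsset L N" "\<And>n. M n \<subseteq> N n"
  shows "lifts E B q L M"
proof (rule liftsI)
  fix f b assume f: "simplicial_map (restr L M) E f" and b: "simplicial_map L B b"
    and c: "\<And>n x. x \<in> M n \<Longrightarrow> q n (f n x) = b n x"
  have "simplicial_map (restr (restr L N) M) E f" using f by simp
  then obtain h where h: "simplicial_map (restr L N) E h" "\<And>n x. x \<in> M n \<Longrightarrow> h n x = f n x"
    "\<And>n x. x \<in> cells (restr L N) n \<Longrightarrow> q n (h n x) = b n x"
    using liftsD[OF assms(1) _ sm_sub[OF b assms(3)] c] by metis
  obtain h' where h': "simplicial_map L E h'" "\<And>n x. x \<in> N n \<Longrightarrow> h' n x = h n x"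
    "\<And>n x. x \<in> cells L n \<Longrightarrow> q n (h' n x) = b n x"
    using liftsD[OF assms(2) h(1) b] h(3) by auto
  have "\<forall>n. \<forall>x\<in>M n. h' n x = f n x" using h(2) h'(2) assms(4) by (metis subsetD)
  with h' show "\<exists>h. simplicial_map L E h \<and> (\<forall>n. \<forall>x\<in>M n. h n x = f n x) \<and> (\<forall>n. \<forall>x\<in>cells L n. q n (h n x) = b n x)"
    by blast
qed

definition generated :: "'a sset \<Rightarrow> nat \<Rightarrow> 'a \<Rightarrow> nat \<Rightarrow> 'a set" where
  "generated L k x m = (\<lambda>s. act L m k ((!) s) x) ` cells (std_simplex k) m"

lemma subsset_generated:
  assumes "simplicial_set L" "x \<in> cells L k"
  shows "subsset L (generated L k x)"
proof (rule subssetI)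
  show "\<And>n y. y \<in> generated L k x n \<Longrightarrow> y \<in> cells L n"
    using assms by (auto simp: generated_def intro: ss_closed std_deltaD)
next
  fix m n \<theta> y assume d: "delta_map m n \<theta>" and "y \<in> generated L k x n"
  then obtain s where s: "s \<in> cells (std_simplex k) n" "y = act L n k ((!) s) x"
    by (auto simp: generated_def)
  then have "act L m n \<theta> y = act L m k ((!) (act (std_simplex k) m n \<theta> s)) x"
    using act_act_std[OF assms s(1) d] by simp
  moreover have "act (std_simplex k) m n \<theta> s \<in> cells (std_simplex k) m"
    using ss_closed[OF simplicial_set_std d s(1)] .
  ultimately show "act L m n \<theta> y \<in> generated L k x m"
    by (auto simp: generated_def)
qed

lemma subsset_Un: "subsset L M \<Longrightarrow> subsset L N \<Longrightarrow> subsset L (\<lambda>n. M n \<union> N n)"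
  unfolding subsset_def by blast

text \<open>Lifting properties are stable under cobase change. The hypotheses \<open>inM\<close> and
  \<open>uniq\<close> express that \<open>M\<close> together with the faces of \<open>x\<close> is a
  pushout: the characteristic map of \<open>x\<close> pulls \<open>M\<close> back to
  \<open>S\<close> and is injective outside \<open>S\<close>.\<close>

lemma attach:
  assumes L: "simplicial_set L" and M: "subsset L M" and x: "x \<in> cells L k"
    and inM: "\<And>m s. s \<in> cells (std_simplex k) m \<Longrightarrow> act L m k ((!) s) x \<in> M m \<longleftrightarrow> s \<in> S m"
    and S: "subsset (std_simplex k) S"
    and uniq: "\<And>m s s'. s \<in> cells (std_simplex k) m \<Longrightarrow> s' \<in> cells (std_simplex k) m \<Longrightarrow> s \<notin> S m \<Longrightarrow>
      s' \<notin> S m \<Longrightarrow> act L m k ((!) s) x = act L m k ((!) s') x \<Longrightarrow> s = s'"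
    and lift: "lifts E B q (std_simplex k) S"
  shows "lifts E B q (restr L (\<lambda>m. M m \<union> generated L k x m)) M"
proof (rule liftsI)
  let ?N = "\<lambda>m. M m \<union> generated L k x m"
  let ?x = "\<lambda>m s. act L m k ((!) s) x"
  fix f b
  assume "simplicial_map (restr (restr L ?N) M) E f" and b: "simplicial_map (restr L ?N) B b"
    and c: "\<And>n x. x \<in> M n \<Longrightarrow> q n (f n x) = b n x"
  then have f: "simplicial_map (restr L M) E f" by simp
  have N: "subsset L ?N" by (rule subsset_Un[OF M subsset_generated[OF L x]])
  have nat_x: "act L l m \<theta> (?x m s) = ?x l (act (std_simplex k) l m \<theta> s)"
    if "s \<in> cells (std_simplex k) m" "delta_map l m \<theta>" for l m \<theta> s
    using act_act_std[OF L x that] .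
  have Sc: "s \<in> S m \<Longrightarrow> s \<in> cells (std_simplex k) m" for s m using S by (rule subsset_in)
  have fS: "simplicial_map (restr (std_simplex k) S) E (\<lambda>m s. f m (?x m s))"
  proof (rule smI)
    fix m s assume "s \<in> cells (restr (std_simplex k) S) m"
    then show "f m (?x m s) \<in> cells E m" using inM Sc sm_closed[OF f] by auto
  next
    fix l m \<theta> s assume "s \<in> cells (restr (std_simplex k) S) m" and d: "delta_map l m \<theta>"
    then have s: "s \<in> S m" "s \<in> cells (std_simplex k) m" using Sc by auto
    then have "?x m s \<in> M m" using inM by auto
    then have "f l (act L l m \<theta> (?x m s)) = act E l m \<theta> (f m (?x m s))"
      using sm_nat[OF f _ d, of "?x m s"] by auto
    then show "f l (?x l (act (restr (std_simplex k) S) l m \<theta> s)) = act E l m \<theta> (f m (?x m s))"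
      using nat_x[OF s(2) d] by simp
  qed
  have xN: "?x m s \<in> ?N m" if "s \<in> cells (std_simplex k) m" for m s
    using that by (auto simp: generated_def)
  have bS: "simplicial_map (std_simplex k) B (\<lambda>m s. b m (?x m s))"
  proof (rule smI)
    fix m s assume "s \<in> cells (std_simplex k) m"
    then show "b m (?x m s) \<in> cells B m" using xN sm_closed[OF b] by auto
  next
    fix l m \<theta> s assume s: "s \<in> cells (std_simplex k) m" and d: "delta_map l m \<theta>"
    then have "b l (act L l m \<theta> (?x m s)) = act B l m \<theta> (b m (?x m s))"
      using sm_nat[OF b _ d, of "?x m s"] xN[OF s] by auto
    then show "b l (?x l (act (std_simplex k) l m \<theta> s)) = act B l m \<theta> (b m (?x m s))"
      using nat_x[OF s d] by simp
  qed
  obtain h where h: "simplicial_map (std_simplex k) E h" "\<And>m s. s \<in> S m \<Longrightarrow> h m s = f m (?x m s)"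
    "\<And>m s. s \<in> cells (std_simplex k) m \<Longrightarrow> q m (h m s) = b m (?x m s)"
  proof (rule liftsD[OF lift fS bS])
    fix m s assume "s \<in> S m"
    then show "q m (f m (?x m s)) = b m (?x m s)" using c inM Sc by auto
  qed blast
  \<comment> \<open>Outside \<open>M\<close> a cell has a unique representative by
    \<open>uniq\<close>, so the choice operator merely names it; \<open>Fx\<close> below also
    settles the cells coming from \<open>S\<close>, where \<open>h\<close> and \<open>f\<close>
    agree.\<close>
  define F where "F m y = (if y \<in> M m then f m y
    else h m (SOME s. s \<in> cells (std_simplex k) m \<and> y = ?x m s))" for m y
  have Fx: "F m (?x m s) = h m s" if s: "s \<in> cells (std_simplex k) m" for m s
  proof (cases "s \<in> S m")
    case True
    then show ?thesis using inM[OF s] h(2) by (simp add: F_def)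
  next
    case False
    define t where "t = (SOME t. t \<in> cells (std_simplex k) m \<and> ?x m s = ?x m t)"
    have t: "t \<in> cells (std_simplex k) m \<and> ?x m s = ?x m t"
      unfolding t_def by (rule someI[of _ s]) (use s in simp)
    then have "t \<notin> S m" using inM[OF s] inM[of t m] False by simp
    then have "t = s" using uniq[of t m s] t s False by simp
    then show ?thesis using inM[OF s] False by (simp add: F_def t_def[symmetric])
  qed
  have FM: "F m y = f m y" if "y \<in> M m" for m y using that by (simp add: F_def)
  have cases: "\<And>P. y \<in> ?N m \<Longrightarrow> (y \<in> M m \<Longrightarrow> P) \<Longrightarrow>
      (\<And>s. s \<in> cells (std_simplex k) m \<Longrightarrow> y = ?x m s \<Longrightarrow> P) \<Longrightarrow> P" for m y
    by (auto simp: generated_def)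
  have "simplicial_map (restr L ?N) E F"
  proof (rule smI)
    fix m y assume "y \<in> cells (restr L ?N) m"
    then have "y \<in> ?N m" by simp
    then show "F m y \<in> cells E m"
      using FM Fx sm_closed[OF f] sm_closed[OF h(1)] by (elim cases) auto
  next
    fix l m \<theta> y assume "y \<in> cells (restr L ?N) m" and d: "delta_map l m \<theta>"
    then have "y \<in> ?N m" by simp
    then show "F l (act (restr L ?N) l m \<theta> y) = act E l m \<theta> (F m y)"
    proof (rule cases)
      assume y: "y \<in> M m"
      then have "act L l m \<theta> y \<in> M l" using subsset_act[OF M d] by simp
      then show ?thesis using y FM sm_nat[OF f _ d, of y] by simp
    next
      fix s assume s: "s \<in> cells (std_simplex k) m" and y: "y = ?x m s"
      have "act (std_simplex k) l m \<theta> s \<in> cells (std_simplex k) l"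
        by (rule ss_closed[OF simplicial_set_std d s])
      then have "F l (act L l m \<theta> y) = h l (act (std_simplex k) l m \<theta> s)"
        using Fx y nat_x[OF s d] by simp
      then show ?thesis using sm_nat[OF h(1) s d] Fx[OF s] y by simp
    qed
  qed
  moreover have "q m (F m y) = b m y" if "y \<in> ?N m" for m y
    using that FM Fx c h(3) by (elim cases) auto
  ultimately show "\<exists>h. simplicial_map (restr L ?N) E h \<and> (\<forall>n. \<forall>x\<in>M n. h n x = f n x) \<and>
      (\<forall>n. \<forall>x\<in>cells (restr L ?N) n. q n (h n x) = b n x)"
    using FM by (intro exI[of _ F]) auto
qed

section \<open>Boundaries, horns and monomorphisms\<close>

definition boundary :: "nat \<Rightarrow> nat \<Rightarrow> nat list set" where
  "boundary k m = {s \<in> cells (std_simplex k) m. set s \<noteq> {..k}}"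

definition horn_cells :: "nat \<Rightarrow> nat \<Rightarrow> nat \<Rightarrow> nat list set" where
  "horn_cells k j m = {s \<in> cells (std_simplex k) m. \<not> {..k} - {j} \<subseteq> set s}"

lemma act_std_set: "s \<in> cells (std_simplex k) m \<Longrightarrow> delta_map l m \<theta> \<Longrightarrow>
    set (act (std_simplex k) l m \<theta> s) \<subseteq> set s"
  by (auto simp: act_std cells_std delta_map_def Pi_iff less_Suc_eq_le intro!: nth_mem simp del: upt_Suc)

lemma std_set_le: "s \<in> cells (std_simplex k) m \<Longrightarrow> set s \<subseteq> {..k}"
  by (auto simp: std_simplex_def cells_nerve)

lemma subsset_boundary: "subsset (std_simplex k) (boundary k)"
proof (rule subssetI)
  fix m n \<theta> x assume d: "delta_map m n \<theta>" and x: "x \<in> boundary k n"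
  then have x': "x \<in> cells (std_simplex k) n" by (simp add: boundary_def)
  show "act (std_simplex k) m n \<theta> x \<in> boundary k m"
    using ss_closed[OF simplicial_set_std d x'] act_std_set[OF x' d] std_set_le[OF x'] x
    by (auto simp: boundary_def)
qed (simp add: boundary_def)

lemma subsset_horn_cells: "subsset (std_simplex k) (horn_cells k j)"
proof (rule subssetI)
  fix m n \<theta> x assume d: "delta_map m n \<theta>" and x: "x \<in> horn_cells k j n"
  then have x': "x \<in> cells (std_simplex k) n" by (simp add: horn_cells_def)
  show "act (std_simplex k) m n \<theta> x \<in> horn_cells k j m"
    using ss_closed[OF simplicial_set_std d x'] act_std_set[OF x' d] x
    by (auto simp: horn_cells_def)
qed (simp add: horn_cells_def)

lemma simplex_boundary_eq: "simplex_boundary n = restr (std_simplex n) (boundary n)"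
  by (simp add: simplex_boundary_def boundary_def[abs_def])

lemma delta_map_coface: "i \<le> Suc n \<Longrightarrow> delta_map n (Suc n) (coface i)"
  by (rule delta_mapI) (auto simp: coface_def)

lemma coface_neq: "coface i j \<noteq> i" by (auto simp: coface_def)

definition codeg :: "nat \<Rightarrow> nat \<Rightarrow> nat" where
  "codeg i j = (if j \<le> i then j else j - 1)"

lemma coface_codeg: "j \<noteq> i \<Longrightarrow> coface i (if j < i then j else j - 1) = j"
  by (auto simp: coface_def)

lemma miss_factor:
  assumes s: "s \<in> cells (std_simplex (Suc k)) m" and i: "i \<notin> set s" "i \<le> Suc k"
  obtains \<psi> where "delta_map m k \<psi>" "\<And>j. j \<le> m \<Longrightarrow> coface i (\<psi> j) = s ! j"
proof
  let ?\<psi> = "\<lambda>j. if s ! j < i then s ! j else s ! j - 1"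
  have ne: "s ! j \<noteq> i" if "j \<le> m" for j using s i that by (auto simp: std_set)
  show "delta_map m k ?\<psi>"
  proof (rule delta_mapI)
    fix j assume "j \<le> m"
    then show "?\<psi> j \<le> k" using ne[of j] s i by (auto simp: cells_std le_Suc_eq)
  next
    fix j l assume "j \<le> l" "l \<le> m"
    then have "s ! j \<le> s ! l" using s by (auto simp: cells_std)
    then show "?\<psi> j \<le> ?\<psi> l" using ne[of j] ne[of l] \<open>j \<le> l\<close> \<open>l \<le> m\<close> by auto
  qed
  show "coface i (?\<psi> j) = s ! j" if "j \<le> m" for j
    using coface_codeg[OF ne[OF that]] .
qed

lemma act_via_face:
  assumes "simplicial_set K" "x \<in> cells K (Suc k)" "i \<le> Suc k" "delta_map m k \<psi>"
    "\<And>j. j \<le> m \<Longrightarrow> coface i (\<psi> j) = \<theta> j"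
  shows "act K m (Suc k) \<theta> x = act K m k \<psi> (face K (Suc k) i x)"
  using assms by (simp add: face_def ss_comp' delta_map_coface)

text \<open>Any choice of preimages is automatically monotone, so the section can be made to pass
  through a prescribed point \<open>j\<close>. This freedom is what separates two surjections in the
  uniqueness part of \<open>lifts_mono\<close>.\<close>

lemma surj_mono_section:
  assumes s: "s \<in> cells (std_simplex k) m" and surj: "set s = {..k}" and j: "j \<le> m"
  obtains \<delta> where "delta_map k m \<delta>" "\<And>i. i \<le> k \<Longrightarrow> s ! \<delta> i = i" "\<delta> (s ! j) = j"
proof -
  define \<delta> where "\<delta> i = (if i = s ! j then j else (LEAST l. l \<le> m \<and> s ! l = i))" for i
  have ex: "\<exists>l\<le>m. s ! l = i" if "i \<le> k" for i
  proof -
    have "i \<in> set s" using surj that by auto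
    then show ?thesis using std_set[OF s] by auto
  qed
  have 1: "\<delta> i \<le> m \<and> s ! \<delta> i = i" if "i \<le> k" for i
    using LeastI_ex[OF ex[OF that]] j by (auto simp: \<delta>_def)
  have 2: "\<delta> i \<le> \<delta> i'" if "i \<le> i'" "i' \<le> k" for i i'
  proof (rule ccontr)
    assume n: "\<not> \<delta> i \<le> \<delta> i'"
    have "s ! \<delta> i' \<le> s ! \<delta> i"
      by (rule delta_map_mono[OF std_deltaD[OF s]]) (use n 1[of i] that in auto)
    then have "i = i'" using 1[of i] 1[of i'] that by auto
    then show False using n by simp
  qed
  show thesis
    by (rule that[of \<delta>]) (use 1 2 in \<open>auto intro: delta_mapI simp: \<delta>_def\<close>)
qed

lemma surj_delta_id:
  assumes d: "delta_map k k \<theta>" and surj: "{..k} \<subseteq> \<theta> ` {..k}" and i: "i \<le> k"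
  shows "\<theta> i = i"
proof -
  have im: "\<theta> ` {..k} = {..k}" using d surj by (auto simp: delta_map_def)
  have inj: "inj_on \<theta> {..k}" by (rule eq_card_imp_inj_on) (auto simp: im)
  have st: "\<theta> a < \<theta> b" if "a < b" "b \<le> k" for a b
    using delta_map_mono[OF d, of a b] inj that by (metis atMost_iff inj_onD le_neq_implies_less less_imp_le order.trans less_irrefl)
  have ge: "a \<le> k \<Longrightarrow> a \<le> \<theta> a" for a
  proof (induction a)
    case (Suc a) then show ?case using st[of a "Suc a"] by simp
  qed simp
  have le: "a \<le> k \<Longrightarrow> \<theta> (k - a) \<le> k - a" for a
  proof (induction a)
    case 0 then show ?case using delta_map_le[OF d, of k] by simp
  next
    case (Suc a)
    then have "k - Suc a < k - a" by simp
    with Suc show ?case using st[of "k - Suc a" "k - a"] by simp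
  qed
  show ?thesis using ge[OF i] le[of "k - i"] i by simp
qed

text \<open>Every inclusion is generated by boundary inclusions. Zorn's lemma gives a maximal
  partial lift; a simplex of least dimension outside its domain can be attached along its whole
  boundary, which contradicts maximality.\<close>

lemma lifts_mono:
  assumes lb: "\<And>k. lifts E B q (std_simplex k) (boundary k)"
    and L: "simplicial_set L" and M: "subsset L M" and E: "simplicial_set E"
  shows "lifts E B q L M"
proof (rule liftsI)
  fix f b
  assume f: "simplicial_map (restr L M) E f" and b: "simplicial_map L B b"
    and c: "\<And>n x. x \<in> M n \<Longrightarrow> q n (f n x) = b n x"
  \<comment> \<open>Partial lifts are represented by their graphs, so that extension of lifts is
    inclusion of sets and a chain is bounded by its union.\<close>
  define pl where "pl G \<longleftrightarrow> (\<forall>n x y. (n,x,y) \<in> G \<longrightarrow> x \<in> cells L n \<and> y \<in> cells E n \<and> q n y = b n x) \<and>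
    (\<forall>n x y y'. (n,x,y) \<in> G \<longrightarrow> (n,x,y') \<in> G \<longrightarrow> y = y') \<and>
    (\<forall>m n \<theta> x y. (n,x,y) \<in> G \<longrightarrow> delta_map m n \<theta> \<longrightarrow> (m, act L m n \<theta> x, act E m n \<theta> y) \<in> G)"
    for G :: "(nat \<times> _ \<times> _) set"
  define G0 where "G0 = {(n,x,y). x \<in> M n \<and> y = f n x}"
  define A where "A = {G. G0 \<subseteq> G \<and> pl G}"
  have "G0 \<in> A"
    unfolding A_def pl_def G0_def
    using subsset_in[OF M] sm_closed[OF f] c subsset_act[OF M] sm_nat[OF f] by auto
  moreover have "\<Union>C \<in> A" if "C \<noteq> {}" "subset.chain A C" for C
  proof -
    have ch: "\<And>G H. G \<in> C \<Longrightarrow> H \<in> C \<Longrightarrow> G \<subseteq> H \<or> H \<subseteq> G" and CA: "C \<subseteq> A"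
      using that(2) by (auto simp: subset_chain_def)
    have "pl (\<Union>C)" unfolding pl_def
    proof (intro conjI allI impI; (elim UnionE)?)
      fix n x y y' G G' assume "(n,x,y) \<in> G" "G \<in> C" "(n,x,y') \<in> G'" "G' \<in> C"
      then obtain H where "H \<in> C" "(n,x,y) \<in> H" "(n,x,y') \<in> H" using ch[of G G'] by blast
      then show "y = y'" using CA unfolding A_def pl_def by blast
    qed (use CA in \<open>unfold A_def pl_def, blast+\<close>)
    then show ?thesis using CA that(1) unfolding A_def by blast
  qed
  ultimately obtain G where G: "G \<in> A" and max: "\<And>H. H \<in> A \<Longrightarrow> G \<subseteq> H \<Longrightarrow> H = G"
    using subset_Zorn_nonempty[of A] by blast
  have G1: "(n,x,y) \<in> G \<Longrightarrow> x \<in> cells L n \<and> y \<in> cells E n \<and> q n y = b n x" for n x y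
    using G unfolding A_def pl_def by blast
  have G2: "(n,x,y) \<in> G \<Longrightarrow> (n,x,y') \<in> G \<Longrightarrow> y = y'" for n x y y'
    using G unfolding A_def pl_def by blast
  have G3: "(n,x,y) \<in> G \<Longrightarrow> delta_map m n \<theta> \<Longrightarrow> (m, act L m n \<theta> x, act E m n \<theta> y) \<in> G" for m n x y \<theta>
    using G unfolding A_def pl_def by blast
  define N where "N n = {x. \<exists>y. (n,x,y) \<in> G}" for n
  define g where "g n x = (THE y. (n,x,y) \<in> G)" for n x
  have gG: "(n,x,g n x) \<in> G" if "x \<in> N n" for n x
    using that theI'[of "\<lambda>y. (n,x,y) \<in> G"] G2 unfolding N_def g_def by blast
  have gG': "(n,x,y) \<in> G \<Longrightarrow> x \<in> N n \<and> g n x = y" for n x y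
    using gG[of x n] G2 unfolding N_def by blast
  have N: "subsset L N"
    by (rule subssetI) (use gG gG' G1 G3 in blast)+
  have g: "simplicial_map (restr L N) E g"
    by (rule smI) (use gG gG' G1 G3 in \<open>fastforce\<close>)+
  have gq: "q n (g n x) = b n x" if "x \<in> N n" for n x using gG[OF that] G1 by blast
  have MN: "x \<in> N n \<and> g n x = f n x" if "x \<in> M n" for n x
    using that G gG' unfolding A_def G0_def by blast
  have "cells L n \<subseteq> N n" for n
  proof (rule ccontr)
    assume "\<not> cells L n \<subseteq> N n"
    then have "\<exists>n. \<not> cells L n \<subseteq> N n" by blast
    then obtain k where k: "\<not> cells L k \<subseteq> N k" and min: "\<And>l. l < k \<Longrightarrow> cells L l \<subseteq> N l"
      using exists_least_iff[of "\<lambda>n. \<not> cells L n \<subseteq> N n"] by blast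
    from k obtain x where x: "x \<in> cells L k" "x \<notin> N k" by blast
    let ?x = "\<lambda>m s. act L m k ((!) s) x"
    \<comment> \<open>A non-surjective operator factors through a proper face of \<open>x\<close>,
      and that face lies in \<open>N\<close> by minimality of \<open>k\<close>.\<close>
    have nonsurj: "?x m s \<in> N m" if s: "s \<in> cells (std_simplex k) m" and ns: "set s \<noteq> {..k}" for m s
    proof -
      obtain i where i: "i \<le> k" "i \<notin> set s" using ns std_set_le[OF s] by auto
      have "k \<noteq> 0"
      proof
        assume "k = 0"
        then have "s ! 0 = 0" "0 \<in> set s \<or> s ! 0 \<noteq> 0" using s by (auto simp: cells_std in_set_conv_nth)
        then show False using i \<open>k = 0\<close> by auto
      qed
      then obtain k' where k': "k = Suc k'" by (cases k) auto
      obtain \<psi> where \<psi>: "delta_map m k' \<psi>" "\<And>j. j \<le> m \<Longrightarrow> coface i (\<psi> j) = s ! j"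
        using miss_factor[of s k' m i] s i k' by metis
      have "?x m s = act L m k' \<psi> (face L k i x)"
        unfolding k' by (rule act_via_face[OF L]) (use x i k' \<psi> in auto)
      moreover have "face L k i x \<in> N k'"
        using min[of k'] x i ss_closed[OF L delta_map_coface, of i k' x] unfolding k' face_def by auto
      ultimately show ?thesis using subsset_act[OF N \<psi>(1)] by simp
    qed
    \<comment> \<open>A section of the surjection would recover \<open>x\<close> itself inside
      \<open>N\<close>.\<close>
    have surj: "?x m s \<notin> N m" if s: "s \<in> cells (std_simplex k) m" and ns: "set s = {..k}" for m s
    proof
      assume a: "?x m s \<in> N m"
      obtain \<delta> where \<delta>: "delta_map k m \<delta>" "\<And>i. i \<le> k \<Longrightarrow> s ! \<delta> i = i"
        using surj_mono_section[OF s ns, of 0] by auto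
      have "act L k m \<delta> (?x m s) = act L k k (\<lambda>i. i) x"
        by (rule ss_comp'[OF L \<delta>(1) std_deltaD[OF s] x(1)]) (rule \<delta>(2))
      also have "\<dots> = x" by (rule ss_id[OF L x(1)]) simp
      finally show False using subsset_act[OF N \<delta>(1) a] x by simp
    qed
    have at: "lifts E B q (restr L (\<lambda>m. N m \<union> generated L k x m)) N"
    proof (rule attach[OF L N x(1) _ subsset_boundary _ lb])
      fix m s assume s: "s \<in> cells (std_simplex k) m"
      then show "?x m s \<in> N m \<longleftrightarrow> s \<in> boundary k m" using surj[OF s] nonsurj[OF s] by (auto simp: boundary_def)
    next
      fix m s s' assume s: "s \<in> cells (std_simplex k) m" and s': "s' \<in> cells (std_simplex k) m"
        and ns: "s \<notin> boundary k m" "s' \<notin> boundary k m" and eq: "?x m s = ?x m s'"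
      \<comment> \<open>Composing \<open>s'\<close> with a section of \<open>s\<close> through
        \<open>j\<close> gives an operator on \<open>[k]\<close> that fixes \<open>x\<close>. If it
        were not surjective, \<open>x\<close> would lie in \<open>N\<close>; being surjective and
        monotone it is the identity, and its value at \<open>s ! j\<close> is
        \<open>s' ! j\<close>.\<close>
      show "s = s'"
      proof (rule std_eqI[OF s])
        show "length s' = Suc m" using s' by (simp add: cells_std)
        fix j assume j: "j \<le> m"
        obtain \<delta> where \<delta>: "delta_map k m \<delta>" "\<And>i. i \<le> k \<Longrightarrow> s ! \<delta> i = i" "\<delta> (s ! j) = j"
          using surj_mono_section[OF s _ j] ns s by (auto simp: boundary_def)
        have "act L k m \<delta> (?x m s) = act L k k (\<lambda>i. i) x"
          by (rule ss_comp'[OF L \<delta>(1) std_deltaD[OF s] x(1)]) (rule \<delta>(2))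
        also have "\<dots> = x" by (rule ss_id[OF L x(1)]) simp
        finally have xx: "x = ?x k (act (std_simplex k) k m \<delta> s')"
          using act_act_std[OF L x(1) s' \<delta>(1)] eq by simp
        let ?t = "act (std_simplex k) k m \<delta> s'"
        have t: "?t \<in> cells (std_simplex k) k" by (rule ss_closed[OF simplicial_set_std \<delta>(1) s'])
        have "set ?t = {..k}" using nonsurj[OF t] x(2) xx by metis
        then have "?t ! i = i" if "i \<le> k" for i
          using surj_delta_id[OF std_deltaD[OF t] _ that] std_set[OF t] by simp
        moreover have "s ! j \<le> k" using s j by (simp add: cells_std)
        ultimately have "?t ! (s ! j) = s ! j" by blast
        then show "s ! j = s' ! j" using \<delta>(3) \<open>s ! j \<le> k\<close> by (simp add: nth_act_std)
      qed
    qed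
    have sb: "subsset L (\<lambda>m. N m \<union> generated L k x m)"
      by (rule subsset_Un[OF N subsset_generated[OF L x(1)]])
    obtain h where h: "simplicial_map (restr L (\<lambda>m. N m \<union> generated L k x m)) E h"
      "\<And>n x. x \<in> N n \<Longrightarrow> h n x = g n x"
      "\<And>n y. y \<in> cells (restr L (\<lambda>m. N m \<union> generated L k x m)) n \<Longrightarrow> q n (h n y) = b n y"
    proof (rule liftsD[OF at _ sm_sub[OF b sb]])
      show "simplicial_map (restr (restr L (\<lambda>m. N m \<union> generated L k x m)) N) E g" using g by simp
    qed (use gq in auto)
    define H where "H = {(n,y,z). y \<in> N n \<union> generated L k x n \<and> z = h n y}"
    have "pl H" unfolding pl_def H_def
      using subsset_in[OF sb] sm_closed[OF h(1)] h(3) subsset_act[OF sb] sm_nat[OF h(1)] by auto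
    moreover have "G \<subseteq> H" unfolding H_def using gG' h(2) by auto
    ultimately have "H = G" using G max unfolding A_def by blast
    moreover have "x \<in> generated L k x k"
    proof -
      have "act L k k ((!) [0..<Suc k]) x = x"
        by (rule ss_id[OF L x(1)]) (simp add: less_Suc_eq_le del: upt_Suc)
      then show ?thesis unfolding generated_def using std_id by (metis imageI)
    qed
    ultimately have "(k,x,h k x) \<in> G" unfolding H_def by auto
    then show False using gG' x(2) by blast
  qed
  then have NL: "N n = cells L n" for n using subsset_in[OF N] by blast
  then have "simplicial_map L E g" using g unfolding simplicial_map_def by auto
  then show "\<exists>h. simplicial_map L E h \<and> (\<forall>n. \<forall>x\<in>M n. h n x = f n x) \<and> (\<forall>n. \<forall>x\<in>cells L n. q n (h n x) = b n x)"
    using MN gq NL by blast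
qed

section \<open>From compatible families of faces to maps on horn subcomplexes\<close>

lemma face_delta_list:
  assumes "x \<in> cells E (Suc n)" "simplicial_set E" "i \<le> Suc n"
  shows "act E n (Suc n) ((!) (map (coface i) [0..<Suc n])) x = face E (Suc n) i x"
  using assms
  by (auto simp: face_def nth_map_upt' simp del: upt_Suc intro!: ss_eq[OF _ _ _ nth_map_upt'] std_deltaD std_of_delta delta_map_coface)

text \<open>Every cell of the horn factors through one of its faces. Hence a filler of the family of
  faces agrees with the given map on the whole horn subcomplex, not only on the faces.\<close>

lemma kan_lifts:
  assumes kan_level: "kan_fibration E B q" and E: "simplicial_set E" and B: "simplicial_set B" and j: "j \<le> Suc n"
  shows "lifts E B q (std_simplex (Suc n)) (horn_cells (Suc n) j)"
proof (rule liftsI)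
  let ?D = "std_simplex (Suc n)"
  fix f b
  assume f: "simplicial_map (restr ?D (horn_cells (Suc n) j)) E f" and b: "simplicial_map ?D B b"
    and c: "\<And>m x. x \<in> horn_cells (Suc n) j m \<Longrightarrow> q m (f m x) = b m x"
  have q: "simplicial_map E B q" using kan_level by (simp add: kan_fibration_def)
  let ?d = "\<lambda>i. map (coface i) [0..<Suc n]"
  have dc: "?d i \<in> cells ?D n" if "i \<le> Suc n" for i
    by (rule std_of_delta[OF delta_map_coface[OF that]])
  have dh: "?d i \<in> horn_cells (Suc n) j n" if "i \<le> Suc n" "i \<noteq> j" for i
  proof -
    have "i \<notin> set (?d i)" using coface_neq[of i] by (auto simp: image_iff simp del: upt_Suc) metis
    then show ?thesis using dc[OF that(1)] that unfolding horn_cells_def by blast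
  qed
  let ?x = "\<lambda>i. f n (?d i)"
  let ?b = "b (Suc n) [0..<Suc (Suc n)]"
  have "horn E n j ?x" unfolding horn_def
  proof (intro conjI allI impI)
    fix i assume "i \<le> Suc n" "i \<noteq> j"
    then show "?x i \<in> cells E n" using sm_closed[OF f, of "?d i" n] dh by simp
  next
    fix i l assume a: "i < l \<and> l \<le> Suc n \<and> i \<noteq> j \<and> l \<noteq> j"
    then obtain n' where n': "n = Suc n'" using j by (cases n) auto
    have i': "i \<le> Suc n'" "l - 1 \<le> Suc n'" using a n' by auto
    have e: "face E n i' (?x l') = f n' (act ?D n' n (coface i') (?d l'))"
      if "i' \<le> Suc n'" "l' \<le> Suc n" "l' \<noteq> j" for i' l'
      using sm_nat[OF f _ delta_map_coface[OF that(1)], of "?d l'"] dh[OF that(2,3)] that n'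
      unfolding face_def by simp
    have "act ?D n' n (coface i) (?d l) = act ?D n' n (coface (l - 1)) (?d i)"
      unfolding act_std
    proof (rule map_cong[OF refl])
      fix r assume "r \<in> set [0..<Suc n']"
      then have "r \<le> n'" by auto
      then have le: "coface i r \<le> n" "coface (l - 1) r \<le> n" using n' by (auto simp: coface_def)
      show "?d l ! coface i r = ?d i ! coface (l - 1) r"
        unfolding nth_map_upt'[OF le(1)] nth_map_upt'[OF le(2)] using a by (auto simp: coface_def)
    qed
    then show "face E n i (?x l) = face E n (l - 1) (?x i)" using e[of i l] e[of "l - 1" i] a i' by simp
  qed
  moreover have bc: "?b \<in> cells B (Suc n)" using sm_closed[OF b std_id] .
  moreover have "face B (Suc n) i ?b = q n (?x i)" if "i \<le> Suc n" "i \<noteq> j" for i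
    using c[OF dh[OF that]] yoneda_eq[OF b dc[OF that(1)]] face_delta_list[OF bc B that(1)] by simp
  ultimately have pre: "j \<le> Suc n \<and> horn E n j ?x \<and> ?b \<in> cells B (Suc n) \<and>
      (\<forall>i\<le>Suc n. i \<noteq> j \<longrightarrow> face B (Suc n) i ?b = q n (?x i))"
    using j by blast
  have "\<exists>y\<in>cells E (Suc n). q (Suc n) y = ?b \<and> (\<forall>i\<le>Suc n. i \<noteq> j \<longrightarrow> face E (Suc n) i y = ?x i)"
    using kan_level[unfolded kan_fibration_def, THEN conjunct2, rule_format, OF pre] .
  then obtain y where y: "y \<in> cells E (Suc n)" "q (Suc n) y = ?b"
    "\<And>i. i \<le> Suc n \<Longrightarrow> i \<noteq> j \<Longrightarrow> face E (Suc n) i y = ?x i" by blast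
  let ?h = "\<lambda>m s. act E m (Suc n) ((!) s) y"
  have "?h m s = f m s" if s: "s \<in> horn_cells (Suc n) j m" for m s
  proof -
    have s': "s \<in> cells ?D m" using s by (simp add: horn_cells_def)
    obtain i where i: "i \<le> Suc n" "i \<noteq> j" "i \<notin> set s" using s by (auto simp: horn_cells_def)
    obtain \<psi> where \<psi>: "delta_map m n \<psi>" "\<And>l. l \<le> m \<Longrightarrow> coface i (\<psi> l) = s ! l"
      using miss_factor[OF s' i(3,1)] by metis
    have "?h m s = act E m n \<psi> (?x i)"
      using act_via_face[OF E y(1) i(1) \<psi>(1), of "(!) s"] \<psi>(2) y(3)[OF i(1,2)] by simp
    also have "\<dots> = f m (act ?D m n \<psi> (?d i))"
      using sm_nat[OF f _ \<psi>(1), of "?d i"] dh[OF i(1,2)] by simp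
    also have "act ?D m n \<psi> (?d i) = s"
    proof (rule std_eqI[symmetric, OF s'])
      fix l assume l: "l \<le> m"
      then show "s ! l = act ?D m n \<psi> (?d i) ! l"
        using nth_map_upt'[OF delta_map_le[OF \<psi>(1) l], of "coface i"] \<psi>(2)[OF l] by (simp add: nth_act_std)
    qed simp
    finally show ?thesis .
  qed
  moreover have "q m (?h m s) = b m s" if s: "s \<in> cells ?D m" for m s
    using sm_nat[OF q y(1) std_deltaD[OF s]] y(2) yoneda_eq[OF b s] by simp
  ultimately show "\<exists>h. simplicial_map ?D E h \<and> (\<forall>m. \<forall>x\<in>horn_cells (Suc n) j m. h m x = f m x) \<and>
      (\<forall>m. \<forall>x\<in>cells ?D m. q m (h m x) = b m x)"
    using yoneda_map[OF E y(1)] by blast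
qed

section \<open>Cylinders\<close>

declare One_nat_def [simp del]

lemma cells_prod [simp]: "cells (sset_prod K L) n = cells K n \<times> cells L n"
  by (simp add: sset_prod_def)

lemma act_prod [simp]: "act (sset_prod K L) m n \<theta> (x, y) = (act K m n \<theta> x, act L m n \<theta> y)"
  by (simp add: sset_prod_def)

lemma simplicial_set_prod:
  assumes K: "simplicial_set K" and L: "simplicial_set L"
  shows "simplicial_set (sset_prod K L)"
  unfolding simplicial_set_def
proof (intro conjI allI ballI impI, goal_cases)
  case (1 m n \<theta>)
  then show ?case by (auto intro: ss_closed[OF K] ss_closed[OF L])
next
  case (2 m n \<theta> \<phi> x)
  then show ?case by (auto simp: delta_eq_def intro!: ss_eq[OF K] ss_eq[OF L])
next
  case (3 n x)
  then show ?case by (auto intro!: ss_id[OF K] ss_id[OF L])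
next
  case (4 l m n \<theta> \<phi> x)
  then show ?case by (auto simp: ss_comp[OF K] ss_comp[OF L])
qed

lemma sm_pair:
  "simplicial_map K L f \<Longrightarrow> simplicial_map K M g \<Longrightarrow> simplicial_map K (sset_prod L M) (\<lambda>n x. (f n x, g n x))"
  by (rule smI) (auto simp: sm_nat sm_closed)

lemma sm_fst: "simplicial_map (sset_prod K L) K (\<lambda>n. fst)"
  by (rule smI) auto

lemma sm_snd: "simplicial_map (sset_prod K L) L (\<lambda>n. snd)"
  by (rule smI) auto

abbreviation interval :: "nat list sset" where "interval \<equiv> std_simplex 1"

abbreviation const_cell :: "nat \<Rightarrow> nat \<Rightarrow> nat list" where "const_cell \<epsilon> n \<equiv> replicate (Suc n) \<epsilon>"

lemma const_cell_cells: "\<epsilon> \<le> k \<Longrightarrow> const_cell \<epsilon> n \<in> cells (std_simplex k) n"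
  by (auto simp: cells_std simp del: replicate_Suc)

lemma act_const_cell: "delta_map m n \<theta> \<Longrightarrow> act (std_simplex k) m n \<theta> (const_cell \<epsilon> n) = const_cell \<epsilon> m"
  by (rule nth_equalityI) (auto simp: act_std less_Suc_eq_le delta_map_le nth_map_upt' simp del: replicate_Suc upt_Suc)

lemma const_cell_iff: "s \<in> cells (std_simplex k) m \<Longrightarrow> s = const_cell \<epsilon> m \<longleftrightarrow> (\<forall>j\<le>m. s ! j = \<epsilon>)"
  by (auto simp: cells_std list_eq_iff_nth_eq less_Suc_eq_le simp del: replicate_Suc)

lemma I1_cases: "t \<in> cells interval n \<Longrightarrow> j \<le> n \<Longrightarrow> t ! j = 0 \<or> t ! j = 1"
  by (auto simp: cells_std le_Suc_eq)

text \<open>Homotopy extension and lifting: \<open>q\<close> lifts against the inclusion of the open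
  cylinder, the union of \<open>K\<close> times the interval with \<open>L\<close> times the end
  \<epsilon>, in the full cylinder. The map on the open cylinder is given in two pieces,
  \<open>f0\<close> on the end and \<open>h\<close> on the wall.\<close>

definition homotopy_lifts :: "nat \<Rightarrow> 'e sset \<Rightarrow> 'b sset \<Rightarrow> (nat \<Rightarrow> 'e \<Rightarrow> 'b) \<Rightarrow> 'l sset \<Rightarrow> (nat \<Rightarrow> 'l set) \<Rightarrow> bool" where
  "homotopy_lifts \<epsilon> E B q L K \<longleftrightarrow> (\<forall>f0 h \<beta>. simplicial_map L E f0 \<and> simplicial_map (sset_prod (restr L K) interval) E h \<and>
     simplicial_map (sset_prod L interval) B \<beta> \<and>
     (\<forall>n. \<forall>l\<in>K n. h n (l, const_cell \<epsilon> n) = f0 n l) \<and>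
     (\<forall>n. \<forall>l\<in>cells L n. q n (f0 n l) = \<beta> n (l, const_cell \<epsilon> n)) \<and>
     (\<forall>n. \<forall>l\<in>K n. \<forall>t\<in>cells interval n. q n (h n (l, t)) = \<beta> n (l, t)) \<longrightarrow>
     (\<exists>H. simplicial_map (sset_prod L interval) E H \<and>
       (\<forall>n. \<forall>l\<in>cells L n. H n (l, const_cell \<epsilon> n) = f0 n l) \<and>
       (\<forall>n. \<forall>l\<in>K n. \<forall>t\<in>cells interval n. H n (l, t) = h n (l, t)) \<and>
       (\<forall>n. \<forall>l\<in>cells L n. \<forall>t\<in>cells interval n. q n (H n (l, t)) = \<beta> n (l, t))))"

lemma homotopy_liftsI:
  assumes "\<And>f0 h \<beta>. simplicial_map L E f0 \<Longrightarrow> simplicial_map (sset_prod (restr L K) interval) E h \<Longrightarrow>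
     simplicial_map (sset_prod L interval) B \<beta> \<Longrightarrow>
     (\<And>n l. l\<in>K n \<Longrightarrow> h n (l, const_cell \<epsilon> n) = f0 n l) \<Longrightarrow>
     (\<And>n l. l\<in>cells L n \<Longrightarrow> q n (f0 n l) = \<beta> n (l, const_cell \<epsilon> n)) \<Longrightarrow>
     (\<And>n l t. l\<in>K n \<Longrightarrow> t\<in>cells interval n \<Longrightarrow> q n (h n (l, t)) = \<beta> n (l, t)) \<Longrightarrow>
     \<exists>H. simplicial_map (sset_prod L interval) E H \<and>
       (\<forall>n. \<forall>l\<in>cells L n. H n (l, const_cell \<epsilon> n) = f0 n l) \<and>
       (\<forall>n. \<forall>l\<in>K n. \<forall>t\<in>cells interval n. H n (l, t) = h n (l, t)) \<and>
       (\<forall>n. \<forall>l\<in>cells L n. \<forall>t\<in>cells interval n. q n (H n (l, t)) = \<beta> n (l, t))"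
  shows "homotopy_lifts \<epsilon> E B q L K"
  using assms unfolding homotopy_lifts_def by blast

lemma homotopy_liftsD:
  assumes "homotopy_lifts \<epsilon> E B q L K" "simplicial_map L E f0" "simplicial_map (sset_prod (restr L K) interval) E h"
     "simplicial_map (sset_prod L interval) B \<beta>"
     "\<And>n l. l\<in>K n \<Longrightarrow> h n (l, const_cell \<epsilon> n) = f0 n l"
     "\<And>n l. l\<in>cells L n \<Longrightarrow> q n (f0 n l) = \<beta> n (l, const_cell \<epsilon> n)"
     "\<And>n l t. l\<in>K n \<Longrightarrow> t\<in>cells interval n \<Longrightarrow> q n (h n (l, t)) = \<beta> n (l, t)"
   obtains H where "simplicial_map (sset_prod L interval) E H"
       "\<And>n l. l\<in>cells L n \<Longrightarrow> H n (l, const_cell \<epsilon> n) = f0 n l"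
       "\<And>n l t. l\<in>K n \<Longrightarrow> t\<in>cells interval n \<Longrightarrow> H n (l, t) = h n (l, t)"
       "\<And>n l t. l\<in>cells L n \<Longrightarrow> t\<in>cells interval n \<Longrightarrow> q n (H n (l, t)) = \<beta> n (l, t)"
proof -
  have "simplicial_map L E f0 \<and> simplicial_map (sset_prod (restr L K) interval) E h \<and>
     simplicial_map (sset_prod L interval) B \<beta> \<and>
     (\<forall>n. \<forall>l\<in>K n. h n (l, const_cell \<epsilon> n) = f0 n l) \<and>
     (\<forall>n. \<forall>l\<in>cells L n. q n (f0 n l) = \<beta> n (l, const_cell \<epsilon> n)) \<and>
     (\<forall>n. \<forall>l\<in>K n. \<forall>t\<in>cells interval n. q n (h n (l, t)) = \<beta> n (l, t))"
    using assms(2-7) by blast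
  from assms(1)[unfolded homotopy_lifts_def, rule_format, OF this] show thesis using that by blast
qed

definition open_cyl :: "nat \<Rightarrow> 'l sset \<Rightarrow> (nat \<Rightarrow> 'l set) \<Rightarrow> nat \<Rightarrow> ('l \<times> nat list) set" where
  "open_cyl \<epsilon> L K n = {(l, t). l \<in> cells L n \<and> t \<in> cells interval n \<and> (l \<in> K n \<or> t = const_cell \<epsilon> n)}"

lemma homotopy_lifts_of_lifts:
  assumes l: "lifts E B q (sset_prod L interval) (open_cyl \<epsilon> L K)"
    and L: "simplicial_set L" and K: "subsset L K" and e: "\<epsilon> \<le> 1"
  shows "homotopy_lifts \<epsilon> E B q L K"
proof (rule homotopy_liftsI)
  fix f0 h \<beta>
  assume f0: "simplicial_map L E f0" and h: "simplicial_map (sset_prod (restr L K) interval) E h"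
    and \<beta>: "simplicial_map (sset_prod L interval) B \<beta>"
    and c1: "\<And>n l. l\<in>K n \<Longrightarrow> h n (l, const_cell \<epsilon> n) = f0 n l"
    and c2: "\<And>n l. l\<in>cells L n \<Longrightarrow> q n (f0 n l) = \<beta> n (l, const_cell \<epsilon> n)"
    and c3: "\<And>n l t. l\<in>K n \<Longrightarrow> t\<in>cells interval n \<Longrightarrow> q n (h n (l, t)) = \<beta> n (l, t)"
  define g where "g = (\<lambda>n (l, t). if t = const_cell \<epsilon> n then f0 n l else h n (l, t))"
  have gK: "g n (l, t) = h n (l, t)" if "l \<in> K n" "t \<in> cells interval n" for n l t
    using c1 that by (auto simp: g_def)
  have g0: "g n (l, const_cell \<epsilon> n) = f0 n l" for n l by (simp add: g_def)
  have "simplicial_map (restr (sset_prod L interval) (open_cyl \<epsilon> L K)) E g"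
  proof (rule smI)
    fix n x assume "x \<in> cells (restr (sset_prod L interval) (open_cyl \<epsilon> L K)) n"
    then obtain l t where x: "x = (l, t)" "l \<in> cells L n" "t \<in> cells interval n" "l \<in> K n \<or> t = const_cell \<epsilon> n"
      by (auto simp: open_cyl_def)
    then show "g n x \<in> cells E n"
      using sm_closed[OF f0, of l n] sm_closed[OF h, of "(l, t)" n] gK[of l n t] g0[of n l]
      by (auto simp del: replicate_Suc)
  next
    fix m n \<theta> x assume "x \<in> cells (restr (sset_prod L interval) (open_cyl \<epsilon> L K)) n" and d: "delta_map m n \<theta>"
    then obtain l t where x: "x = (l, t)" "l \<in> cells L n" "t \<in> cells interval n" "l \<in> K n \<or> t = const_cell \<epsilon> n"
      by (auto simp: open_cyl_def)
    have t': "act interval m n \<theta> t \<in> cells interval m" by (rule ss_closed[OF simplicial_set_std d x(3)])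
    show "g m (act (restr (sset_prod L interval) (open_cyl \<epsilon> L K)) m n \<theta> x) = act E m n \<theta> (g n x)"
      using x(4)
    proof
      assume l: "l \<in> K n"
      then have "act L m n \<theta> l \<in> K m" by (rule subsset_act[OF K d])
      then show ?thesis using sm_nat[OF h _ d, of "(l, t)"] l x gK t' by simp
    next
      assume "t = const_cell \<epsilon> n"
      then show ?thesis using x g0 act_const_cell[OF d] sm_nat[OF f0 x(2) d] by (simp del: replicate_Suc)
    qed
  qed
  moreover have "q n (g n x) = \<beta> n x" if "x \<in> open_cyl \<epsilon> L K n" for n x
    using that c2 c3 g0 gK by (auto simp: open_cyl_def simp del: replicate_Suc)
  ultimately obtain H where H: "simplicial_map (sset_prod L interval) E H"
    "\<And>n x. x \<in> open_cyl \<epsilon> L K n \<Longrightarrow> H n x = g n x"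
    "\<And>n x. x \<in> cells (sset_prod L interval) n \<Longrightarrow> q n (H n x) = \<beta> n x"
    using liftsD[OF l _ \<beta>] by metis
  show "\<exists>H. simplicial_map (sset_prod L interval) E H \<and>
       (\<forall>n. \<forall>l\<in>cells L n. H n (l, const_cell \<epsilon> n) = f0 n l) \<and>
       (\<forall>n. \<forall>l\<in>K n. \<forall>t\<in>cells interval n. H n (l, t) = h n (l, t)) \<and>
       (\<forall>n. \<forall>l\<in>cells L n. \<forall>t\<in>cells interval n. q n (H n (l, t)) = \<beta> n (l, t))"
    using H g0 gK const_cell_cells[OF e] subsset_in[OF K]
    by (intro exI[of _ H]) (auto simp: open_cyl_def simp del: replicate_Suc)
qed

lemma lifts_refl: "lifts E B q L (cells L)"
  by (rule liftsI) auto

section \<open>Filling a cylinder over a simplex by shuffles\<close>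

definition hornlift :: "'e sset \<Rightarrow> 'b sset \<Rightarrow> (nat \<Rightarrow> 'e \<Rightarrow> 'b) \<Rightarrow> bool" where
  "hornlift E B q \<longleftrightarrow> (\<forall>n j. j \<le> Suc n \<longrightarrow> lifts E B q (std_simplex (Suc n)) (horn_cells (Suc n) j))"

text \<open>The shuffle running through the vertices (0,0), ..., (i,0), (i,1), ..., (k,1). These are
  the nondegenerate top simplices of the cylinder.\<close>

definition prism :: "nat \<Rightarrow> nat \<Rightarrow> nat list \<times> nat list" where
  "prism k i = (map (codeg i) [0..<Suc (Suc k)], map (\<lambda>r. if r \<le> i then 0 else 1) [0..<Suc (Suc k)])"

lemma prism_cells: "i \<le> k \<Longrightarrow> prism k i \<in> cells (sset_prod (std_simplex k) interval) (Suc k)"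
  unfolding prism_def cells_prod by (auto intro!: std_of_delta delta_mapI simp: codeg_def simp del: upt_Suc)

abbreviation prism_face :: "nat \<Rightarrow> nat \<Rightarrow> nat \<Rightarrow> nat list \<Rightarrow> nat list \<times> nat list" where
  "prism_face k i m s \<equiv> act (sset_prod (std_simplex k) interval) m (Suc k) ((!) s) (prism k i)"

lemma prism_face_eq:
  assumes "s \<in> cells (std_simplex (Suc k)) m"
  shows "prism_face k i m s = (map (\<lambda>r. codeg i (s ! r)) [0..<Suc m], map (\<lambda>r. if s ! r \<le> i then 0 else 1) [0..<Suc m])"
proof -
  have "r \<le> m \<Longrightarrow> s ! r \<le> Suc k" for r using assms by (simp add: cells_std)
  then show ?thesis
    unfolding prism_def act_prod act_std
    by (auto simp: less_Suc_eq_le nth_map_upt' simp del: upt_Suc)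
qed

lemma prism_face_inj:
  assumes s: "s \<in> cells (std_simplex (Suc k)) m" "s' \<in> cells (std_simplex (Suc k)) m"
    and e: "prism_face k i m s = prism_face k i m s'"
  shows "s = s'"
proof (rule std_eqI[OF s(1)])
  fix j assume j: "j \<le> m"
  have "codeg i (s ! j) = codeg i (s' ! j)" "(s ! j \<le> i) = (s' ! j \<le> i)"
    using e j unfolding prism_face_eq[OF s(1)] prism_face_eq[OF s(2)]
    by (auto simp: less_Suc_eq_le simp del: upt_Suc split: if_splits)
  then show "s ! j = s' ! j" by (auto simp: codeg_def split: if_splits)
qed (use s in \<open>simp add: cells_std\<close>)

lemma boundary_iff: "s \<in> cells (std_simplex k) m \<Longrightarrow> s \<in> boundary k m \<longleftrightarrow> (\<exists>u\<le>k. \<forall>r\<le>m. s ! r \<noteq> u)"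
proof -
  assume s: "s \<in> cells (std_simplex k) m"
  have "set s \<noteq> {..k} \<longleftrightarrow> (\<exists>u\<le>k. u \<notin> set s)" using std_set_le[OF s] by auto
  moreover have "u \<notin> set s \<longleftrightarrow> (\<forall>r\<le>m. s ! r \<noteq> u)" for u by (auto simp: std_set[OF s])
  ultimately show ?thesis using s by (simp add: boundary_def)
qed

lemma horn_cells_iff: "s \<in> cells (std_simplex k) m \<Longrightarrow> s \<in> horn_cells k j m \<longleftrightarrow> (\<exists>u\<le>k. u \<noteq> j \<and> (\<forall>r\<le>m. s ! r \<noteq> u))"
proof -
  assume s: "s \<in> cells (std_simplex k) m"
  have "\<not> {..k} - {j} \<subseteq> set s \<longleftrightarrow> (\<exists>u\<le>k. u \<noteq> j \<and> u \<notin> set s)" by auto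
  moreover have "u \<notin> set s \<longleftrightarrow> (\<forall>r\<le>m. s ! r \<noteq> u)" for u by (auto simp: std_set[OF s])
  ultimately show ?thesis using s by (simp add: horn_cells_def)
qed

lemma fst_pri_cells:
  assumes "s \<in> cells (std_simplex (Suc k)) m" "i \<le> k"
  shows "map (\<lambda>r. codeg i (s ! r)) [0..<Suc m] \<in> cells (std_simplex k) m"
    "map (\<lambda>r. if s ! r \<le> i then 0 else (1::nat)) [0..<Suc m] \<in> cells interval m"
  using ss_closed[OF simplicial_set_prod[OF simplicial_set_std simplicial_set_std] std_deltaD[OF assms(1)] prism_cells[OF assms(2)]]
  unfolding prism_face_eq[OF assms(1)] by auto

text \<open>\<open>codeg i\<close> identifies exactly \<open>i\<close> and \<open>Suc i\<close>. The
  projection to \<open>std_simplex k\<close> therefore misses \<open>i\<close> iff both are missed,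
  and misses any other vertex iff its single preimage is missed.\<close>

lemma prism_face_boundary:
  assumes s: "s \<in> cells (std_simplex (Suc k)) m" and i: "i \<le> k"
  shows "map (\<lambda>r. codeg i (s ! r)) [0..<Suc m] \<in> boundary k m \<longleftrightarrow>
    (\<exists>u\<le>Suc k. u \<noteq> i \<and> u \<noteq> Suc i \<and> (\<forall>r\<le>m. s ! r \<noteq> u)) \<or> ((\<forall>r\<le>m. s ! r \<noteq> i) \<and> (\<forall>r\<le>m. s ! r \<noteq> Suc i))"
proof -
  have "(\<exists>u\<le>k. \<forall>r\<le>m. codeg i (s ! r) \<noteq> u) \<longleftrightarrow>
    (\<exists>u\<le>Suc k. u \<noteq> i \<and> u \<noteq> Suc i \<and> (\<forall>r\<le>m. s ! r \<noteq> u)) \<or> ((\<forall>r\<le>m. s ! r \<noteq> i) \<and> (\<forall>r\<le>m. s ! r \<noteq> Suc i))"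
    (is "?l \<longleftrightarrow> ?r1 \<or> ?r2")
  proof
    assume ?l
    then obtain u where u: "u \<le> k" "\<And>r. r \<le> m \<Longrightarrow> codeg i (s ! r) \<noteq> u" by blast
    show "?r1 \<or> ?r2"
    proof (cases "u = i")
      case True
      then have ?r2 using u(2) by (force simp: codeg_def)
      then show ?thesis ..
    next
      case False
      let ?v = "if u < i then u else Suc u"
      have "?v \<le> Suc k" "?v \<noteq> i" "?v \<noteq> Suc i" "\<forall>r\<le>m. s ! r \<noteq> ?v"
        using u False by (auto simp: codeg_def) force+
      then show ?thesis by blast
    qed
  next
    assume "?r1 \<or> ?r2"
    then show ?l
    proof
      assume ?r1
      then obtain u where u: "u \<le> Suc k" "u \<noteq> i" "u \<noteq> Suc i" "\<And>r. r \<le> m \<Longrightarrow> s ! r \<noteq> u" by blast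
      show ?l
      proof (intro exI[of _ "codeg i u"] conjI allI impI)
        show "codeg i u \<le> k" using u i by (auto simp: codeg_def)
        fix r assume "r \<le> m"
        then have "s ! r \<noteq> u" by (rule u(4))
        then show "codeg i (s ! r) \<noteq> codeg i u" using u by (auto simp: codeg_def)
      qed
    next
      assume r: ?r2
      show ?l
      proof (intro exI[of _ i] conjI allI impI i)
        fix l assume "l \<le> m"
        then have "s ! l \<noteq> i \<and> s ! l \<noteq> Suc i" using r by blast
        then show "codeg i (s ! l) \<noteq> i" by (auto simp: codeg_def)
      qed
    qed
  qed
  then show ?thesis
    using boundary_iff[OF fst_pri_cells(1)[OF s i]] by (simp add: nth_map_upt' del: upt_Suc)
qed

text \<open>Here \<open>P u\<close> is to be read as "the face misses \<open>u\<close>". The faces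
  lying over the boundary, together with those missing \<open>j\<close>, form exactly the horn at
  vertex \<open>i\<close>.\<close>

lemma ex_merge:
  fixes i j k :: nat
  assumes "i \<le> k" "j \<le> k" "i \<noteq> j"
  shows "((\<exists>u\<le>k. u \<noteq> i \<and> u \<noteq> j \<and> P u) \<or> P i \<and> P j) \<or> P j \<longleftrightarrow> (\<exists>u\<le>k. u \<noteq> i \<and> P u)" (is "?l \<longleftrightarrow> ?r")
proof
  assume ?l
  then show ?r
    by (elim disjE exE conjE) (use assms in \<open>(blast intro: exI[of _ j])+\<close>)
next
  assume ?r
  then obtain u where "u \<le> k" "u \<noteq> i" "P u" by blast
  then show ?l by (cases "u = j") auto
qed

lemma ex_merge':
  fixes i j k :: nat
  assumes "i \<le> k" "j \<le> k" "i \<noteq> j"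
  shows "((\<exists>u\<le>k. u \<noteq> i \<and> u \<noteq> j \<and> P u) \<or> P i \<and> P j) \<or> P i \<longleftrightarrow> (\<exists>u\<le>k. u \<noteq> j \<and> P u)"
  using ex_merge[of j k i P] assms by blast

text \<open>On the shuffle, the vertex of \<open>[k+1]\<close> lying over a pair of coordinates is
  their sum; adding \<open>s\<close> and \<open>e\<close> thus recovers the operator that cuts out
  \<open>(s, e)\<close>.\<close>

lemma prism_face_surj:
  assumes s: "s \<in> cells (std_simplex k) m" and e: "e \<in> cells interval m" and i: "i \<le> k"
    and 0: "\<And>r. r \<le> m \<Longrightarrow> e ! r = 0 \<Longrightarrow> s ! r \<le> i" and 1: "\<And>r. r \<le> m \<Longrightarrow> e ! r = 1 \<Longrightarrow> i \<le> s ! r"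
  shows "(s, e) \<in> generated (sset_prod (std_simplex k) interval) (Suc k) (prism k i) m"
proof -
  let ?t = "map (\<lambda>r. s ! r + e ! r) [0..<Suc m]"
  have t: "?t \<in> cells (std_simplex (Suc k)) m"
  proof (rule std_of_delta, rule delta_mapI)
    fix r assume "r \<le> m"
    then show "s ! r + e ! r \<le> Suc k" using s e by (force simp: cells_std)
  next
    fix r r' :: nat assume "r \<le> r'" "r' \<le> m"
    then show "s ! r + e ! r \<le> s ! r' + e ! r'" using s e by (auto simp: cells_std intro!: add_mono)
  qed
  have "prism_face k i m ?t = (s, e)"
    unfolding prism_face_eq[OF t] prod.inject
  proof (intro conjI; rule sym)
    show "s = map (\<lambda>r. codeg i (?t ! r)) [0..<Suc m]"
    proof (rule std_eqI[OF s])
      fix j assume "j \<le> m"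
      then show "s ! j = map (\<lambda>r. codeg i (?t ! r)) [0..<Suc m] ! j"
        using I1_cases[OF e, of j] 0[of j] 1[of j] by (auto simp: nth_map_upt' codeg_def simp del: upt_Suc)
    qed simp
    show "e = map (\<lambda>r. if ?t ! r \<le> i then 0 else 1) [0..<Suc m]"
    proof (rule std_eqI[OF e])
      fix j assume "j \<le> m"
      then show "e ! j = map (\<lambda>r. if ?t ! r \<le> i then 0 else 1) [0..<Suc m] ! j"
        using I1_cases[OF e, of j] 0[of j] 1[of j] by (auto simp: nth_map_upt' simp del: upt_Suc)
    qed simp
  qed
  then show ?thesis unfolding generated_def by (intro image_eqI[OF _ t]) (rule sym)
qed

text \<open>
  The prism \<open>\<Delta>[k] \<times> \<Delta>[1]\<close> is filled one top simplex \<open>prism k i\<close> at a time: upwards (\<open>i\<close> decreasing)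
  starting from the end \<open>0\<close>, downwards from the end \<open>1\<close>.
\<close>

lemma prism_lifts0:
  assumes h: "hornlift E B q"
  shows "lifts E B q (sset_prod (std_simplex k) interval) (open_cyl 0 (std_simplex k) (boundary k))"
proof -
  let ?P = "sset_prod (std_simplex k) interval"
  \<comment> \<open>\<open>N 0\<close> is the whole cylinder and \<open>N (Suc k)\<close> the open
    one, since first coordinates never exceed \<open>k\<close>. Passing from
    \<open>N (Suc i)\<close> to \<open>N i\<close> attaches \<open>prism k i\<close> along its horn
    at vertex \<open>i\<close>.\<close>
  define N where "N i m = {(s, e). s \<in> cells (std_simplex k) m \<and> e \<in> cells interval m \<and>
    (s \<in> boundary k m \<or> (\<forall>j\<le>m. e ! j = 1 \<longrightarrow> i \<le> s ! j))}" for i m :: nat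
  have P: "simplicial_set ?P" by (intro simplicial_set_prod simplicial_set_std)
  have N: "subsset ?P (N i)" for i
  proof (rule subssetI)
    fix m n \<theta> x assume d: "delta_map m n \<theta>" and "x \<in> N i n"
    then obtain s e where x: "x = (s, e)" "s \<in> cells (std_simplex k) n" "e \<in> cells interval n"
      "s \<in> boundary k n \<or> (\<forall>j\<le>n. e ! j = 1 \<longrightarrow> i \<le> s ! j)" by (auto simp: N_def)
    then show "act ?P m n \<theta> x \<in> N i m"
      using ss_closed[OF simplicial_set_std d x(2)] ss_closed[OF simplicial_set_std d x(3)]
        subsset_act[OF subsset_boundary d, of s k] delta_map_le[OF d]
      by (auto simp: N_def nth_act_std)
  qed (auto simp: N_def)
  have "lifts E B q ?P (N i)" if "i \<le> Suc k" for i
    using that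
  proof (induction i)
    case 0
    have "N 0 = cells ?P" by (auto simp: N_def)
    then show ?case using lifts_refl by metis
  next
    case (Suc i)
    then have i: "i \<le> k" by simp
    have un: "(\<lambda>m. N (Suc i) m \<union> generated ?P (Suc k) (prism k i) m) = N i"
    proof (intro ext set_eqI iffI)
      fix m x assume "x \<in> N (Suc i) m \<union> generated ?P (Suc k) (prism k i) m"
      then show "x \<in> N i m"
      proof
        assume "x \<in> generated ?P (Suc k) (prism k i) m"
        then obtain s where s: "s \<in> cells (std_simplex (Suc k)) m" "x = prism_face k i m s"
          by (auto simp: generated_def)
        then show ?thesis
          unfolding prism_face_eq[OF s(1)] using fst_pri_cells[OF s(1) i]
          by (auto simp: N_def nth_map_upt' codeg_def simp del: upt_Suc split: if_splits)
      qed (auto simp: N_def)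
    next
      fix m x assume x: "x \<in> N i m"
      show "x \<in> N (Suc i) m \<union> generated ?P (Suc k) (prism k i) m"
      proof (cases "x \<in> N (Suc i) m")
        case False
        obtain s e where se: "x = (s, e)" "s \<in> cells (std_simplex k) m" "e \<in> cells interval m"
          using x by (auto simp: N_def)
        then obtain j where j: "j \<le> m" "e ! j = 1" "s ! j < Suc i" using False by (auto simp: N_def)
        have ge: "e ! r = 1 \<Longrightarrow> i \<le> s ! r" if "r \<le> m" for r
          using x False se that by (auto simp: N_def)
        have "s ! j = i" using ge[OF j(1,2)] j(3) by simp
        have le: "s ! r \<le> i" if "r \<le> m" "e ! r = 0" for r
        proof -
          have "r \<le> j" using that j delta_map_mono[OF std_deltaD[OF se(3)], of j r] by (cases "r \<le> j") auto
          then show ?thesis using delta_map_mono[OF std_deltaD[OF se(2)], of r j] j(1) \<open>s ! j = i\<close> by simp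
        qed
        show ?thesis unfolding se(1) by (rule UnI2, rule prism_face_surj[OF se(2,3) i le ge])
      qed simp
    qed
    have "lifts E B q (restr ?P (\<lambda>m. N (Suc i) m \<union> generated ?P (Suc k) (prism k i) m)) (N (Suc i))"
    proof (rule attach[OF P N prism_cells[OF i] _ subsset_horn_cells, of _ i])
      fix m s assume s: "s \<in> cells (std_simplex (Suc k)) m"
      have key: "(\<not> a \<le> i \<longrightarrow> Suc i \<le> codeg i a) \<longleftrightarrow> a \<noteq> Suc i" for a
        by (auto simp: codeg_def)
      let ?s = "map (\<lambda>r. codeg i (s ! r)) [0..<Suc m]"
      let ?e = "map (\<lambda>r. if s ! r \<le> i then 0 else (1::nat)) [0..<Suc m]"
      have "(\<forall>j\<le>m. ?e ! j = 1 \<longrightarrow> Suc i \<le> ?s ! j) \<longleftrightarrow> (\<forall>r\<le>m. s ! r \<noteq> Suc i)"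
        using key by (intro all_cong) (auto simp: nth_map_upt' codeg_def simp del: upt_Suc)
      moreover have "prism_face k i m s \<in> N (Suc i) m \<longleftrightarrow> ?s \<in> boundary k m \<or> (\<forall>j\<le>m. ?e ! j = 1 \<longrightarrow> Suc i \<le> ?s ! j)"
        unfolding prism_face_eq[OF s] N_def using fst_pri_cells[OF s i] by blast
      ultimately show "prism_face k i m s \<in> N (Suc i) m \<longleftrightarrow> s \<in> horn_cells (Suc k) i m"
        unfolding prism_face_boundary[OF s i] horn_cells_iff[OF s] using ex_merge[of i "Suc k" "Suc i"] i by simp
    next
      show "lifts E B q (std_simplex (Suc k)) (horn_cells (Suc k) i)" using h i by (simp add: hornlift_def)
    qed (rule prism_face_inj)
    then have "lifts E B q (restr ?P (N i)) (N (Suc i))" using un by simp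
    moreover have "N (Suc i) m \<subseteq> N i m" for m unfolding N_def using Suc_leD by blast
    ultimately show ?case using Suc.IH i lifts_trans[OF _ _ N[of i], of E B q "N (Suc i)"] by simp
  qed
  then have "lifts E B q ?P (N (Suc k))" by simp
  also have "N (Suc k) = open_cyl 0 (std_simplex k) (boundary k)"
  proof (intro ext set_eqI)
    fix m and x :: "nat list \<times> nat list"
    obtain s e where x: "x = (s, e)" by fastforce
    have "(\<forall>j\<le>m. e ! j = 1 \<longrightarrow> Suc k \<le> s ! j) \<longleftrightarrow> e = const_cell 0 m"
      if "s \<in> cells (std_simplex k) m" "e \<in> cells interval m"
      unfolding const_cell_iff[OF that(2)] using that(1) I1_cases[OF that(2)] by (fastforce simp: cells_std)
    then show "x \<in> N (Suc k) m \<longleftrightarrow> x \<in> open_cyl 0 (std_simplex k) (boundary k) m"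
      unfolding N_def open_cyl_def x by (auto simp del: replicate_Suc)
  qed
  finally show ?thesis .
qed

lemma prism_lifts1:
  assumes h: "hornlift E B q"
  shows "lifts E B q (sset_prod (std_simplex k) interval) (open_cyl 1 (std_simplex k) (boundary k))"
proof -
  let ?P = "sset_prod (std_simplex k) interval"
  \<comment> \<open>The mirror image: here \<open>N 0\<close> is the open cylinder and
    \<open>N (Suc k)\<close> the whole one, and \<open>prism k i\<close> is attached to
    \<open>N i\<close> along its horn at vertex \<open>Suc i\<close>. The induction below therefore
    counts down from \<open>Suc k\<close>.\<close>
  define N where "N i m = {(s, e). s \<in> cells (std_simplex k) m \<and> e \<in> cells interval m \<and>
    (s \<in> boundary k m \<or> (\<forall>j\<le>m. e ! j = 0 \<longrightarrow> s ! j < i))}" for i m :: nat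
  have P: "simplicial_set ?P" by (intro simplicial_set_prod simplicial_set_std)
  have N: "subsset ?P (N i)" for i
  proof (rule subssetI)
    fix m n \<theta> x assume d: "delta_map m n \<theta>" and "x \<in> N i n"
    then obtain s e where x: "x = (s, e)" "s \<in> cells (std_simplex k) n" "e \<in> cells interval n"
      "s \<in> boundary k n \<or> (\<forall>j\<le>n. e ! j = 0 \<longrightarrow> s ! j < i)" by (auto simp: N_def)
    then show "act ?P m n \<theta> x \<in> N i m"
      using ss_closed[OF simplicial_set_std d x(2)] ss_closed[OF simplicial_set_std d x(3)]
        subsset_act[OF subsset_boundary d, of s k] delta_map_le[OF d]
      by (auto simp: N_def nth_act_std)
  qed (auto simp: N_def)
  have "lifts E B q ?P (N (Suc k - i))" if "i \<le> Suc k" for i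
    using that
  proof (induction i)
    case 0
    have "N (Suc k) = cells ?P" by (auto simp: N_def cells_std less_Suc_eq_le)
    then show ?case using lifts_refl by (metis minus_nat.diff_0)
  next
    case (Suc i')
    define i where "i = k - i'"
    have i: "i \<le> k" and si: "Suc k - i' = Suc i" "Suc k - Suc i' = i" using Suc.prems by (auto simp: i_def)
    have un: "(\<lambda>m. N i m \<union> generated ?P (Suc k) (prism k i) m) = N (Suc i)"
    proof (intro ext set_eqI iffI)
      fix m x assume "x \<in> N i m \<union> generated ?P (Suc k) (prism k i) m"
      then show "x \<in> N (Suc i) m"
      proof
        assume "x \<in> generated ?P (Suc k) (prism k i) m"
        then obtain s where s: "s \<in> cells (std_simplex (Suc k)) m" "x = prism_face k i m s"
          by (auto simp: generated_def)
        then show ?thesis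
          unfolding prism_face_eq[OF s(1)] using fst_pri_cells[OF s(1) i]
          by (auto simp: N_def nth_map_upt' codeg_def simp del: upt_Suc split: if_splits)
      next
        assume "x \<in> N i m" then show ?thesis unfolding N_def using less_SucI by blast
      qed
    next
      fix m x assume x: "x \<in> N (Suc i) m"
      show "x \<in> N i m \<union> generated ?P (Suc k) (prism k i) m"
      proof (cases "x \<in> N i m")
        case False
        obtain s e where se: "x = (s, e)" "s \<in> cells (std_simplex k) m" "e \<in> cells interval m"
          using x by (auto simp: N_def)
        then obtain j where j: "j \<le> m" "e ! j = 0" "\<not> s ! j < i" using False by (auto simp: N_def)
        have ge: "e ! r = 0 \<Longrightarrow> s ! r \<le> i" if "r \<le> m" for r
          using x False se that by (auto simp: N_def less_Suc_eq_le)
        have "s ! j = i" using ge[OF j(1,2)] j(3) by simp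
        have le: "i \<le> s ! r" if "r \<le> m" "e ! r = 1" for r
        proof -
          have "j \<le> r" using that j delta_map_mono[OF std_deltaD[OF se(3)], of r j] by (cases "j \<le> r") auto
          then show ?thesis using delta_map_mono[OF std_deltaD[OF se(2)], of j r] that(1) \<open>s ! j = i\<close> by simp
        qed
        show ?thesis unfolding se(1) by (rule UnI2, rule prism_face_surj[OF se(2,3) i ge le])
      qed simp
    qed
    have "lifts E B q (restr ?P (\<lambda>m. N i m \<union> generated ?P (Suc k) (prism k i) m)) (N i)"
    proof (rule attach[OF P N prism_cells[OF i] _ subsset_horn_cells, of _ "Suc i"])
      fix m s assume s: "s \<in> cells (std_simplex (Suc k)) m"
      have key: "(a \<le> i \<longrightarrow> codeg i a < i) \<longleftrightarrow> a \<noteq> i" for a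
        by (auto simp: codeg_def)
      let ?s = "map (\<lambda>r. codeg i (s ! r)) [0..<Suc m]"
      let ?e = "map (\<lambda>r. if s ! r \<le> i then 0 else (1::nat)) [0..<Suc m]"
      have "(\<forall>j\<le>m. ?e ! j = 0 \<longrightarrow> ?s ! j < i) \<longleftrightarrow> (\<forall>r\<le>m. s ! r \<noteq> i)"
        using key by (intro all_cong) (auto simp: nth_map_upt' codeg_def simp del: upt_Suc)
      moreover have "prism_face k i m s \<in> N i m \<longleftrightarrow> ?s \<in> boundary k m \<or> (\<forall>j\<le>m. ?e ! j = 0 \<longrightarrow> ?s ! j < i)"
        unfolding prism_face_eq[OF s] N_def using fst_pri_cells[OF s i] by blast
      ultimately show "prism_face k i m s \<in> N i m \<longleftrightarrow> s \<in> horn_cells (Suc k) (Suc i) m"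
        unfolding prism_face_boundary[OF s i] horn_cells_iff[OF s] using ex_merge'[of i "Suc k" "Suc i"] i by simp
    next
      show "lifts E B q (std_simplex (Suc k)) (horn_cells (Suc k) (Suc i))" using h i by (simp add: hornlift_def)
    qed (rule prism_face_inj)
    then have "lifts E B q (restr ?P (N (Suc i))) (N i)" using un by simp
    moreover have "N i m \<subseteq> N (Suc i) m" for m unfolding N_def using less_SucI by blast
    ultimately show ?case using Suc.IH Suc.prems lifts_trans[OF _ _ N[of "Suc i"], of E B q "N i"] unfolding si by simp
  qed
  from this[of "Suc k"] have "lifts E B q ?P (N 0)" by simp
  also have "N 0 = open_cyl 1 (std_simplex k) (boundary k)"
  proof (intro ext set_eqI)
    fix m and x :: "nat list \<times> nat list"
    obtain s e where x: "x = (s, e)" by fastforce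
    have "(\<forall>j\<le>m. e ! j = 0 \<longrightarrow> s ! j < 0) \<longleftrightarrow> e = const_cell 1 m"
      if "e \<in> cells interval m"
      unfolding const_cell_iff[OF that] using I1_cases[OF that] by (fastforce simp: cells_std)
    then show "x \<in> N 0 m \<longleftrightarrow> x \<in> open_cyl 1 (std_simplex k) (boundary k) m"
      unfolding N_def open_cyl_def x by (auto simp del: replicate_Suc)
  qed
  finally show ?thesis .
qed

lemma homotopy_lifts_simplex:
  assumes "hornlift E B q" "\<epsilon> \<le> 1"
  shows "homotopy_lifts \<epsilon> E B q (std_simplex k) (boundary k)"
  using homotopy_lifts_of_lifts[OF prism_lifts0[OF assms(1)] simplicial_set_std subsset_boundary]
    homotopy_lifts_of_lifts[OF prism_lifts1[OF assms(1)] simplicial_set_std subsset_boundary] assms(2)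
  by (cases "\<epsilon> = 0") (auto simp: One_nat_def le_Suc_eq)

section \<open>Path spaces\<close>

lemma cells_path: "\<gamma> \<in> cells (path_space C) n \<longleftrightarrow> simplicial_map (sset_prod (std_simplex n) interval) C \<gamma> \<and>
    (\<forall>q. \<gamma> q \<in> extensional (cells (sset_prod (std_simplex n) interval) q))"
  by (simp add: path_space_def sset_exp_def sset_hom_def)

lemma act_path: "act (path_space C) m n \<theta> \<gamma> =
    (\<lambda>q. restrict (\<lambda>(s, t). \<gamma> q (map \<theta> s, t)) (cells (sset_prod (std_simplex m) interval) q))"
  by (simp add: path_space_def sset_exp_def)

lemma map_std: "delta_map m n \<theta> \<Longrightarrow> s \<in> cells (std_simplex m) q \<Longrightarrow> map \<theta> s \<in> cells (std_simplex n) q"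
  by (auto simp: cells_std delta_map_le delta_map_mono)

lemma map_act_std: "s \<in> cells (std_simplex m) q \<Longrightarrow> delta_map r q \<phi> \<Longrightarrow>
    map \<theta> (act (std_simplex m) r q \<phi> s) = act (std_simplex n) r q \<phi> (map \<theta> s)"
  by (auto simp: act_std cells_std less_Suc_eq_le delta_map_le simp del: upt_Suc)

lemma path_act_at: "s \<in> cells (std_simplex m) q \<Longrightarrow> t \<in> cells interval q \<Longrightarrow>
    act (path_space C) m n \<theta> \<gamma> q (s, t) = \<gamma> q (map \<theta> s, t)"
  by (simp add: act_path)

lemma path_eqI:
  assumes "\<gamma> \<in> cells (path_space C) n" "\<gamma>' \<in> cells (path_space C) n"
    "\<And>q s t. s \<in> cells (std_simplex n) q \<Longrightarrow> t \<in> cells interval q \<Longrightarrow> \<gamma> q (s, t) = \<gamma>' q (s, t)"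
  shows "\<gamma> = \<gamma>'"
proof (intro ext)
  fix q x
  show "\<gamma> q x = \<gamma>' q x"
    by (rule extensionalityI[of _ "cells (sset_prod (std_simplex n) interval) q", THEN fun_cong])
      (use assms in \<open>auto simp: cells_path\<close>)
qed

lemma simplicial_set_path:
  assumes C: "simplicial_set C"
  shows "simplicial_set (path_space C)"
proof -
  have cl: "act (path_space C) m n \<theta> \<gamma> \<in> cells (path_space C) m"
    if d: "delta_map m n \<theta>" and g: "\<gamma> \<in> cells (path_space C) n" for m n \<theta> \<gamma>
    unfolding cells_path
  proof (intro conjI allI)
    have g': "simplicial_map (sset_prod (std_simplex n) interval) C \<gamma>" using g by (simp add: cells_path)
    show "simplicial_map (sset_prod (std_simplex m) interval) C (act (path_space C) m n \<theta> \<gamma>)"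
    proof (rule smI)
      fix q x assume "x \<in> cells (sset_prod (std_simplex m) interval) q"
      then show "act (path_space C) m n \<theta> \<gamma> q x \<in> cells C q"
        using sm_closed[OF g'] map_std[OF d] by (auto simp: path_act_at)
    next
      fix r q \<phi> x assume "x \<in> cells (sset_prod (std_simplex m) interval) q" and dp: "delta_map r q \<phi>"
      then obtain s t where x: "x = (s, t)" "s \<in> cells (std_simplex m) q" "t \<in> cells interval q" by auto
      then show "act (path_space C) m n \<theta> \<gamma> r (act (sset_prod (std_simplex m) interval) r q \<phi> x) =
           act C r q \<phi> (act (path_space C) m n \<theta> \<gamma> q x)"
        using sm_nat[OF g' _ dp, of "(map \<theta> s, t)"] map_std[OF d x(2)]
          ss_closed[OF simplicial_set_std dp x(2)] ss_closed[OF simplicial_set_std dp x(3)]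
        by (simp add: path_act_at map_act_std[OF x(2) dp, where n = n])
    qed
  qed (simp add: act_path)
  show ?thesis unfolding simplicial_set_def
  proof (intro conjI allI ballI impI)
    fix m n \<theta> assume "delta_map m n \<theta>"
    then show "act (path_space C) m n \<theta> \<in> cells (path_space C) n \<rightarrow> cells (path_space C) m" using cl by blast
  next
    fix m n \<theta> \<phi> x assume x: "x \<in> cells (path_space C) n"
      and d: "delta_map m n \<theta> \<and> delta_map m n \<phi> \<and> delta_eq m \<theta> \<phi>"
    show "act (path_space C) m n \<theta> x = act (path_space C) m n \<phi> x"
    proof (rule path_eqI[of _ C m])
      fix q s t assume st: "s \<in> cells (std_simplex m) q" "t \<in> cells interval q"
      have "map \<theta> s = map \<phi> s" using d std_set_le[OF st(1)] by (auto simp: delta_eq_def)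
      then show "act (path_space C) m n \<theta> x q (s, t) = act (path_space C) m n \<phi> x q (s, t)"
        unfolding path_act_at[OF st] by metis
    qed (use cl x d in blast)+
  next
    fix n x assume x: "x \<in> cells (path_space C) n"
    show "act (path_space C) n n id x = x"
      by (rule path_eqI[of _ C n]) (use cl x delta_map_id in \<open>auto simp: path_act_at\<close>)
  next
    fix l m n \<theta> \<phi> x assume x: "x \<in> cells (path_space C) n" and d: "delta_map l m \<phi> \<and> delta_map m n \<theta>"
    then have d': "delta_map l m \<phi>" "delta_map m n \<theta>" "delta_map l n (\<theta> \<circ> \<phi>)" by (auto intro: delta_map_comp)
    show "act (path_space C) l n (\<theta> \<circ> \<phi>) x = act (path_space C) l m \<phi> (act (path_space C) m n \<theta> x)"
      by (rule path_eqI[of _ C l]) (use cl x d' map_std in \<open>auto simp: path_act_at\<close>)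
  qed
qed

text \<open>Evaluation over the top simplex of \<open>std_simplex n\<close>. By naturality these
  values, taken over all simplicial operators applied to \<gamma>, determine \<gamma>; see
  \<open>path_at\<close>. So maps into path spaces can be compared through \<open>path_ev\<close>
  alone.\<close>

definition path_ev :: "nat \<Rightarrow> 'a path \<Rightarrow> nat list \<Rightarrow> 'a" where
  "path_ev n \<gamma> t = \<gamma> n ([0..<Suc n], t)"

lemma path_end_path_ev: "path_end \<epsilon> n \<gamma> = path_ev n \<gamma> (const_cell \<epsilon> n)"
  by (simp only: path_end_def path_ev_def)

lemma path_ev_act:
  assumes "\<gamma> \<in> cells (path_space C) n" "delta_map m n \<theta>" "t \<in> cells interval n"
  shows "path_ev m (act (path_space C) m n \<theta> \<gamma>) (act interval m n \<theta> t) = act C m n \<theta> (path_ev n \<gamma> t)"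
proof -
  have "act (std_simplex n) m n \<theta> [0..<Suc n] = map \<theta> [0..<Suc m]"
    using delta_map_le[OF assms(2)] by (auto simp: act_std less_Suc_eq_le simp del: upt_Suc)
  then show ?thesis
    using sm_nat[of "sset_prod (std_simplex n) interval" C \<gamma> "([0..<Suc n], t)" n m \<theta>] assms std_id[of n] std_id[of m]
      ss_closed[OF simplicial_set_std assms(2,3)]
    by (simp add: cells_path path_ev_def path_act_at del: upt_Suc)
qed

lemma path_at:
  assumes "s \<in> cells (std_simplex n) q" "t \<in> cells interval q"
  shows "\<gamma> q (s, t) = path_ev q (act (path_space C) q n ((!) s) \<gamma>) t"
proof -
  have "map ((!) s) [0..<Suc q] = s" using assms(1) by (metis cells_std map_nth)
  then show ?thesis using assms(2) std_id[of q] by (simp add: path_ev_def path_act_at del: upt_Suc)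
qed

lemma path_ev_closed: "\<gamma> \<in> cells (path_space C) n \<Longrightarrow> t \<in> cells interval n \<Longrightarrow> path_ev n \<gamma> t \<in> cells C n"
  using std_id[of n] sm_closed[of "sset_prod (std_simplex n) interval" C \<gamma> "([0..<Suc n], t)" n]
  by (simp add: path_ev_def cells_path del: upt_Suc)

lemma transpose:
  assumes f: "simplicial_map K (path_space C) f"
  shows "simplicial_map (sset_prod K interval) C (\<lambda>n (x, t). path_ev n (f n x) t)"
proof (rule smI)
  fix n x assume "x \<in> cells (sset_prod K interval) n"
  then show "(case x of (x, t) \<Rightarrow> path_ev n (f n x) t) \<in> cells C n"
    using sm_closed[OF f] by (auto intro: path_ev_closed)
next
  fix m n \<theta> x assume "x \<in> cells (sset_prod K interval) n" "delta_map m n \<theta>"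
  then show "(case act (sset_prod K interval) m n \<theta> x of (x, t) \<Rightarrow> path_ev m (f m x) t) =
       act C m n \<theta> (case x of (x, t) \<Rightarrow> path_ev n (f n x) t)"
    using sm_closed[OF f] by (auto simp: sm_nat[OF f] path_ev_act)
qed

definition untranspose :: "'k sset \<Rightarrow> (nat \<Rightarrow> 'k \<times> nat list \<Rightarrow> 'c) \<Rightarrow> nat \<Rightarrow> 'k \<Rightarrow> 'c path" where
  "untranspose K F n x = (\<lambda>q. restrict (\<lambda>(s, t). F q (act K q n ((!) s) x, t)) (cells (sset_prod (std_simplex n) interval) q))"

lemma untranspose_at: "s \<in> cells (std_simplex n) q \<Longrightarrow> t \<in> cells interval q \<Longrightarrow> untranspose K F n x q (s, t) = F q (act K q n ((!) s) x, t)"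
  by (simp add: untranspose_def)

lemma untranspose_map:
  assumes F: "simplicial_map (sset_prod K interval) C F" and K: "simplicial_set K" and C: "simplicial_set C"
  shows "simplicial_map K (path_space C) (untranspose K F)"
proof (rule smI)
  fix n x assume x: "x \<in> cells K n"
  show "untranspose K F n x \<in> cells (path_space C) n" unfolding cells_path
  proof (intro conjI allI)
    have "simplicial_map (sset_prod (std_simplex n) interval) (sset_prod K interval) (\<lambda>q z. (act K q n ((!) (fst z)) x, snd z))"
      using sm_pair[OF sm_comp[OF sm_fst yoneda_map[OF K x]] sm_snd] .
    then have "simplicial_map (sset_prod (std_simplex n) interval) C (\<lambda>q z. F q (act K q n ((!) (fst z)) x, snd z))"
      by (rule sm_comp[OF _ F])
    then show "simplicial_map (sset_prod (std_simplex n) interval) C (untranspose K F n x)"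
      by (rule sm_cong[OF simplicial_set_prod[OF simplicial_set_std simplicial_set_std]]) (auto simp: untranspose_at)
  qed (simp add: untranspose_def)
next
  fix m n \<theta> x assume x: "x \<in> cells K n" and d: "delta_map m n \<theta>"
  show "untranspose K F m (act K m n \<theta> x) = act (path_space C) m n \<theta> (untranspose K F n x)"
  proof (intro ext)
    fix q z
    show "untranspose K F m (act K m n \<theta> x) q z = act (path_space C) m n \<theta> (untranspose K F n x) q z"
    proof (cases "z \<in> cells (sset_prod (std_simplex m) interval) q")
      case True
      then obtain s t where z: "z = (s, t)" "s \<in> cells (std_simplex m) q" "t \<in> cells interval q" by auto
      have "act K q m ((!) s) (act K m n \<theta> x) = act K q n ((!) (map \<theta> s)) x"
        by (rule ss_comp'[OF K std_deltaD[OF z(2)] d x]) (use z(2) in \<open>auto simp: cells_std\<close>)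
      then show ?thesis using z map_std[OF d z(2)] by (simp add: untranspose_at path_act_at)
    qed (auto simp: untranspose_def act_path)
  qed
qed

lemma path_ev_untranspose:
  assumes "simplicial_set K" "x \<in> cells K n" "t \<in> cells interval n"
  shows "path_ev n (untranspose K F n x) t = F n (x, t)"
proof -
  have "act K n n ((!) [0..<Suc n]) x = x"
    by (rule ss_id[OF assms(1,2)]) (simp add: less_Suc_eq_le del: upt_Suc)
  then show ?thesis using assms std_id[of n] by (simp add: path_ev_def untranspose_at del: upt_Suc)
qed

lemma path_map_eqI:
  assumes f: "simplicial_map K (path_space C) f" and g: "simplicial_map K (path_space C) g"
    and K: "simplicial_set K"
    and eq: "\<And>n x t. x \<in> cells K n \<Longrightarrow> t \<in> cells interval n \<Longrightarrow> path_ev n (f n x) t = path_ev n (g n x) t"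
    and x: "x \<in> cells K n"
  shows "f n x = g n x"
proof (rule path_eqI[OF sm_closed[OF f x] sm_closed[OF g x]])
  fix q s t assume s: "s \<in> cells (std_simplex n) q" "t \<in> cells interval q"
  have "f n x q (s, t) = path_ev q (f q (act K q n ((!) s) x)) t"
    using path_at[OF s] sm_nat[OF f x std_deltaD[OF s(1)]] by metis
  also have "\<dots> = path_ev q (g q (act K q n ((!) s) x)) t"
    by (rule eq[OF ss_closed[OF K std_deltaD[OF s(1)] x] s(2)])
  also have "\<dots> = g n x q (s, t)"
    using path_at[OF s] sm_nat[OF g x std_deltaD[OF s(1)]] by metis
  finally show "f n x q (s, t) = g n x q (s, t)" .
qed

section \<open>The homotopy lifting property\<close>

lemma homotopy_lifts_hornlift:
  assumes hl: "hornlift E B q" and q: "simplicial_map E B q" and E: "simplicial_set E" and B: "simplicial_set B"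
    and L: "simplicial_set L" and K: "subsset L K" and e: "\<epsilon> \<le> 1"
  shows "homotopy_lifts \<epsilon> E B q L K"
proof -
  text \<open>The map \<open>E\<^sup>I \<rightarrow> E \<times>\<^sub>B B\<^sup>I\<close> lifts against boundaries, hence against all monomorphisms.\<close>
  define PB where "PB = \<lparr>cells = (\<lambda>n. {(y, \<beta>). y \<in> cells E n \<and> \<beta> \<in> cells (path_space B) n \<and> path_end \<epsilon> n \<beta> = q n y}),
    act = (\<lambda>m n \<theta>. map_prod (act E m n \<theta>) (act (path_space B) m n \<theta>))\<rparr>"
  define qE where "qE n \<gamma> = (\<lambda>r. restrict (\<lambda>z. q r (\<gamma> r z)) (cells (sset_prod (std_simplex n) interval) r))"
    for n and \<gamma> :: "'a path"
  define q' where "q' n \<gamma> = (path_end \<epsilon> n \<gamma>, qE n \<gamma>)" for n \<gamma>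
  have ceps: "const_cell \<epsilon> n \<in> cells interval n" for n by (rule const_cell_cells[OF e])
  have PBfst: "simplicial_map L' E (\<lambda>n x. fst (b n x))" if "simplicial_map L' PB b" for L' :: "'l sset" and b
    by (rule smI) (use sm_closed[OF that] sm_nat[OF that] in \<open>fastforce simp: PB_def split_beta\<close>)+
  have PBsnd: "simplicial_map L' (path_space B) (\<lambda>n x. snd (b n x))" if "simplicial_map L' PB b" for L' :: "'l sset" and b
    by (rule smI) (use sm_closed[OF that] sm_nat[OF that] in \<open>fastforce simp: PB_def split_beta\<close>)+
  have PBfst': "simplicial_map L' E (\<lambda>n x. fst (b n x))" if "simplicial_map L' PB b" for L' :: "nat list sset" and b
    by (rule smI) (use sm_closed[OF that] sm_nat[OF that] in \<open>fastforce simp: PB_def split_beta\<close>)+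
  have PBsnd': "simplicial_map L' (path_space B) (\<lambda>n x. snd (b n x))" if "simplicial_map L' PB b" for L' :: "nat list sset" and b
    by (rule smI) (use sm_closed[OF that] sm_nat[OF that] in \<open>fastforce simp: PB_def split_beta\<close>)+
  have ev_qE: "path_ev n (qE n \<gamma>) t = q n (path_ev n \<gamma> t)" if "t \<in> cells interval n" for n \<gamma> t
    using that std_id[of n] by (simp add: path_ev_def qE_def del: upt_Suc)
  have qE_map: "simplicial_map (path_space E) (path_space B) qE"
  proof (rule smI)
    fix n \<gamma> assume g: "\<gamma> \<in> cells (path_space E) n"
    have "simplicial_map (sset_prod (std_simplex n) interval) B (\<lambda>r z. q r (\<gamma> r z))"
      using g by (intro sm_comp[OF _ q]) (simp add: cells_path)
    then have "simplicial_map (sset_prod (std_simplex n) interval) B (qE n \<gamma>)"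
      by (rule sm_cong[OF simplicial_set_prod[OF simplicial_set_std simplicial_set_std]]) (auto simp: qE_def)
    then show "qE n \<gamma> \<in> cells (path_space B) n" by (simp add: cells_path qE_def)
  next
    fix m n \<theta> and \<gamma> :: "'a path" assume d: "delta_map m n \<theta>"
    show "qE m (act (path_space E) m n \<theta> \<gamma>) = act (path_space B) m n \<theta> (qE n \<gamma>)"
      by (intro ext) (auto simp: qE_def act_path map_std[OF d] restrict_def)
  qed
  \<comment> \<open>Transposed, a lift against a boundary is a homotopy lift on the simplex relative
    to its boundary, which the shuffles provide.\<close>
  have lb: "lifts (path_space E) PB q' (std_simplex k) (boundary k)" for k
  proof (rule liftsI)
    fix f b
    assume f: "simplicial_map (restr (std_simplex k) (boundary k)) (path_space E) f"
      and b: "simplicial_map (std_simplex k) PB b" and c: "\<And>n x. x \<in> boundary k n \<Longrightarrow> q' n (f n x) = b n x"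
    note b1 = PBfst'[OF b] and b2 = PBsnd'[OF b]
    have bdc: "x \<in> boundary k n \<Longrightarrow> x \<in> cells (std_simplex k) n" for x n by (simp add: boundary_def)
    obtain H where H: "simplicial_map (sset_prod (std_simplex k) interval) E H"
       "\<And>n l. l\<in>cells (std_simplex k) n \<Longrightarrow> H n (l, const_cell \<epsilon> n) = fst (b n l)"
       "\<And>n l t. l\<in>boundary k n \<Longrightarrow> t\<in>cells interval n \<Longrightarrow> H n (l, t) = path_ev n (f n l) t"
       "\<And>n l t. l\<in>cells (std_simplex k) n \<Longrightarrow> t\<in>cells interval n \<Longrightarrow> q n (H n (l, t)) = path_ev n (snd (b n l)) t"
    proof (rule homotopy_liftsD[OF homotopy_lifts_simplex[OF hl e] b1 transpose[OF f] transpose[OF b2]])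
      fix n l assume l: "l \<in> boundary k n"
      then show "(case (l, const_cell \<epsilon> n) of (x, t) \<Rightarrow> path_ev n (f n x) t) = fst (b n l)"
        using c[OF l] by (metis case_prod_conv fst_conv path_end_path_ev q'_def)
    next
      fix n l assume l: "l \<in> cells (std_simplex k) n"
      show "q n (fst (b n l)) = (case (l, const_cell \<epsilon> n) of (x, t) \<Rightarrow> path_ev n (snd (b n x)) t)"
        using sm_closed[OF b l] by (auto simp: PB_def path_end_path_ev simp del: replicate_Suc)
    next
      fix n l t assume l: "l \<in> boundary k n" "t \<in> cells interval n"
      then show "q n (case (l, t) of (x, t) \<Rightarrow> path_ev n (f n x) t) = (case (l, t) of (x, t) \<Rightarrow> path_ev n (snd (b n x)) t)"
        using c[OF l(1)] ev_qE[OF l(2)] by (metis case_prod_conv snd_conv q'_def)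
    qed simp
    let ?h = "untranspose (std_simplex k) H"
    have h: "simplicial_map (std_simplex k) (path_space E) ?h"
      by (rule untranspose_map[OF H(1) simplicial_set_std E])
    have "?h n x = f n x" if x: "x \<in> boundary k n" for n x
      by (rule path_map_eqI[OF sm_sub[OF h subsset_boundary] f ss_sub[OF simplicial_set_std subsset_boundary]])
        (use x H(3) bdc in \<open>auto simp: path_ev_untranspose[OF simplicial_set_std]\<close>)
    moreover have "q' n (?h n x) = b n x" if x: "x \<in> cells (std_simplex k) n" for n x
    proof (rule prod_eqI)
      show "fst (q' n (?h n x)) = fst (b n x)"
        unfolding q'_def fst_conv path_end_path_ev path_ev_untranspose[OF simplicial_set_std x ceps] using H(2)[OF x] by simp
      have "qE n (?h n x) = snd (b n x)"
        by (rule path_map_eqI[OF sm_comp[OF h qE_map] b2 simplicial_set_std _ x])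
          (simp add: ev_qE path_ev_untranspose[OF simplicial_set_std] H(4))
      then show "snd (q' n (?h n x)) = snd (b n x)" by (simp add: q'_def)
    qed
    ultimately show "\<exists>h. simplicial_map (std_simplex k) (path_space E) h \<and> (\<forall>n. \<forall>x\<in>boundary k n. h n x = f n x) \<and>
       (\<forall>n. \<forall>x\<in>cells (std_simplex k) n. q' n (h n x) = b n x)"
      using h by blast
  qed
  have lL: "lifts (path_space E) PB q' L K"
    by (rule lifts_mono[OF lb L K simplicial_set_path[OF E]])
  show ?thesis
  proof (rule homotopy_liftsI)
    fix f0 h \<beta>
    assume f0: "simplicial_map L E f0" and h: "simplicial_map (sset_prod (restr L K) interval) E h"
      and \<beta>: "simplicial_map (sset_prod L interval) B \<beta>"
      and c1: "\<And>n l. l\<in>K n \<Longrightarrow> h n (l, const_cell \<epsilon> n) = f0 n l"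
      and c2: "\<And>n l. l\<in>cells L n \<Longrightarrow> q n (f0 n l) = \<beta> n (l, const_cell \<epsilon> n)"
      and c3: "\<And>n l t. l\<in>K n \<Longrightarrow> t\<in>cells interval n \<Longrightarrow> q n (h n (l, t)) = \<beta> n (l, t)"
    note Ks = ss_sub[OF L K]
    let ?f = "untranspose (restr L K) h" and ?b = "untranspose L \<beta>"
    have f: "simplicial_map (restr L K) (path_space E) ?f" by (rule untranspose_map[OF h Ks E])
    have b: "simplicial_map L (path_space B) ?b" by (rule untranspose_map[OF \<beta> L B])
    have bb: "simplicial_map L PB (\<lambda>n l. (f0 n l, ?b n l))"
      by (rule smI) (use sm_closed[OF f0] sm_closed[OF b] sm_nat[OF f0] sm_nat[OF b] c2 in
        \<open>auto simp: PB_def path_end_path_ev path_ev_untranspose[OF L _ ceps] simp del: replicate_Suc\<close>)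
    have comp: "q' n (?f n x) = (f0 n x, ?b n x)" if x: "x \<in> K n" for n x
    proof -
      have "path_ev n (?f n x) (const_cell \<epsilon> n) = f0 n x"
        using path_ev_untranspose[OF Ks _ ceps, of x n h] c1[OF x] x by (simp del: replicate_Suc)
      moreover have "qE n (?f n x) = ?b n x"
      proof (rule path_map_eqI[OF sm_comp[OF f qE_map] sm_sub[OF b K] Ks])
        fix n x t assume "x \<in> cells (restr L K) n" "t \<in> cells interval n"
        then show "path_ev n (qE n (?f n x)) t = path_ev n (?b n x) t"
          using ev_qE[of t n] path_ev_untranspose[OF Ks, of x n t h] path_ev_untranspose[OF L subsset_in[OF K], of x n t \<beta>] c3 by simp
      qed (use x in simp)
      ultimately show ?thesis by (simp only: q'_def path_end_path_ev)
    qed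
    obtain g where g: "simplicial_map L (path_space E) g" "\<And>n x. x \<in> K n \<Longrightarrow> g n x = ?f n x"
      "\<And>n x. x \<in> cells L n \<Longrightarrow> q' n (g n x) = (f0 n x, ?b n x)"
      by (rule liftsD[OF lL f bb]) (use comp in auto)
    let ?H = "\<lambda>n (x, t). path_ev n (g n x) t"
    have "simplicial_map (sset_prod L interval) E ?H" by (rule transpose[OF g(1)])
    moreover have "path_ev n (g n x) (const_cell \<epsilon> n) = f0 n x" if "x \<in> cells L n" for n x
      using g(3)[OF that] by (simp only: q'_def path_end_path_ev prod.inject)
    moreover have "path_ev n (g n x) t = h n (x, t)" if "x \<in> K n" "t \<in> cells interval n" for n x t
      using g(2)[OF that(1)] path_ev_untranspose[OF Ks _ that(2), of x] that by simp
    moreover have "q n (path_ev n (g n x) t) = \<beta> n (x, t)" if "x \<in> cells L n" "t \<in> cells interval n" for n x t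
      using g(3)[OF that(1)] ev_qE[OF that(2), of "g n x"] path_ev_untranspose[OF L that, where F = \<beta>] by (simp add: q'_def)
    ultimately show "\<exists>H. simplicial_map (sset_prod L interval) E H \<and>
       (\<forall>n. \<forall>l\<in>cells L n. H n (l, const_cell \<epsilon> n) = f0 n l) \<and>
       (\<forall>n. \<forall>l\<in>K n. \<forall>t\<in>cells interval n. H n (l, t) = h n (l, t)) \<and>
       (\<forall>n. \<forall>l\<in>cells L n. \<forall>t\<in>cells interval n. q n (H n (l, t)) = \<beta> n (l, t))"
      by (intro exI[of _ ?H]) (simp del: replicate_Suc)
  qed
qed

section \<open>Homotopy extension into Kan complexes\<close>

abbreviation point :: "nat list sset" where "point \<equiv> std_simplex 0"

lemma cells_point: "s \<in> cells point n \<longleftrightarrow> s = const_cell 0 n"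
  using const_cell_iff[of s 0 n 0] const_cell_cells[of 0 0 n] by (auto simp: cells_std simp del: replicate_Suc)

lemma to_point_cst: "to_point n x = const_cell 0 n"
  by (simp add: to_point_def)

lemma sm_to_point: "simplicial_map K point to_point"
  by (rule smI) (auto simp: cells_point to_point_cst act_const_cell simp del: replicate_Suc)

lemma kan_hornlift: "kan_fibration E B q \<Longrightarrow> simplicial_set E \<Longrightarrow> simplicial_set B \<Longrightarrow> hornlift E B q"
  by (simp add: hornlift_def kan_lifts)

lemma kan_complex_hornlift: "kan_complex A \<Longrightarrow> hornlift A point to_point"
  by (rule kan_hornlift) (auto simp: kan_complex_def simplicial_set_std)

text \<open>Over the point all conditions on the base hold automatically, so homotopy lifting
  becomes homotopy extension.\<close>

lemma homotopy_lifts_point: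
  assumes A: "hornlift A point to_point" "simplicial_set A" and L: "simplicial_set L" and K: "subsset L K"
    and e: "\<epsilon> \<le> 1" and f0: "simplicial_map L A f0" and h: "simplicial_map (sset_prod (restr L K) interval) A h"
    and c: "\<And>n l. l\<in>K n \<Longrightarrow> h n (l, const_cell \<epsilon> n) = f0 n l"
  obtains H where "simplicial_map (sset_prod L interval) A H"
       "\<And>n l. l\<in>cells L n \<Longrightarrow> H n (l, const_cell \<epsilon> n) = f0 n l"
       "\<And>n l t. l\<in>K n \<Longrightarrow> t\<in>cells interval n \<Longrightarrow> H n (l, t) = h n (l, t)"
  using homotopy_liftsD[OF homotopy_lifts_hornlift[OF A(1) sm_to_point A(2) simplicial_set_std L K e] f0 h sm_to_point c]
  by (simp add: to_point_cst del: replicate_Suc) blast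

section \<open>Homotopy pullbacks\<close>

lemma cells_hpb: "(a, \<gamma>, b) \<in> cells (hpullback A B C f g) n \<longleftrightarrow>
   a \<in> cells A n \<and> \<gamma> \<in> cells (path_space C) n \<and> b \<in> cells B n \<and>
   path_ev n \<gamma> (const_cell 0 n) = f n a \<and> path_ev n \<gamma> (const_cell 1 n) = g n b"
  unfolding hpullback_def by (simp add: path_end_path_ev del: replicate_Suc)

lemma act_hpb: "act (hpullback A B C f g) m n \<theta> (a, \<gamma>, b) = (act A m n \<theta> a, act (path_space C) m n \<theta> \<gamma>, act B m n \<theta> b)"
  by (simp add: hpullback_def)

lemma sm_hpb1: "simplicial_map (hpullback A B C f g) A (\<lambda>n x. fst x)"
  by (rule smI) (auto simp: cells_hpb act_hpb)

lemma sm_hpb2: "simplicial_map (hpullback A B C f g) (path_space C) (\<lambda>n x. fst (snd x))"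
  by (rule smI) (auto simp: cells_hpb act_hpb)

lemma sm_hpb3: "simplicial_map (hpullback A B C f g) B (\<lambda>n x. snd (snd x))"
  by (rule smI) (auto simp: cells_hpb act_hpb)

lemma hpb_map:
  assumes "simplicial_map L A \<alpha>" "simplicial_map L (path_space C) \<Gamma>" "simplicial_map L B b"
    and "\<And>n l. l \<in> cells L n \<Longrightarrow> path_ev n (\<Gamma> n l) (const_cell 0 n) = f n (\<alpha> n l)"
    and "\<And>n l. l \<in> cells L n \<Longrightarrow> path_ev n (\<Gamma> n l) (const_cell 1 n) = g n (b n l)"
  shows "simplicial_map L (hpullback A B C f g) (\<lambda>n l. (\<alpha> n l, \<Gamma> n l, b n l))"
  by (rule smI) (use assms in \<open>auto simp: cells_hpb act_hpb sm_closed sm_nat simp del: replicate_Suc\<close>)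

lemma simplicial_set_hpb:
  assumes A: "simplicial_set A" and B: "simplicial_set B" and C: "simplicial_set C"
    and f: "simplicial_map A C f" and g: "simplicial_map B C g"
  shows "simplicial_set (hpullback A B C f g)"
proof -
  note P = simplicial_set_path[OF C]
  have ends: "path_ev m (act (path_space C) m n \<theta> \<gamma>) (const_cell \<epsilon> m) = act C m n \<theta> (path_ev n \<gamma> (const_cell \<epsilon> n))"
    if "\<gamma> \<in> cells (path_space C) n" "delta_map m n \<theta>" "\<epsilon> \<le> 1" for m n \<theta> \<gamma> \<epsilon>
    using path_ev_act[OF that(1,2) const_cell_cells[OF that(3)]] act_const_cell[OF that(2)] by metis
  show ?thesis unfolding simplicial_set_def
  proof (intro conjI allI ballI impI, goal_cases)
    case (1 m n \<theta>)
    then show ?case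
      by (auto simp: cells_hpb act_hpb ends sm_nat[OF f] sm_nat[OF g] simp del: replicate_Suc
        intro: ss_closed[OF A] ss_closed[OF B] ss_closed[OF P])
  next
    case (2 m n \<theta> \<phi> x)
    then show ?case
      by (cases x) (auto simp: delta_eq_def cells_hpb act_hpb simp del: replicate_Suc intro!: ss_eq[OF A] ss_eq[OF B] ss_eq[OF P])
  next
    case (3 n x)
    then show ?case by (cases x) (auto simp: cells_hpb act_hpb simp del: replicate_Suc intro!: ss_id[OF A] ss_id[OF B] ss_id[OF P])
  next
    case (4 l m n \<theta> \<phi> x)
    then show ?case by (cases x) (auto simp: cells_hpb act_hpb ss_comp[OF A] ss_comp[OF B] ss_comp[OF P] simp del: replicate_Suc)
  qed
qed

lemma sm_swap: "simplicial_map (sset_prod (sset_prod K L) M) (sset_prod (sset_prod K M) L) (\<lambda>n ((x, y), z). ((x, z), y))"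
  by (rule smI) auto

text \<open>The projection to \<open>B\<close> behaves as a fibration. The component in
  \<open>A\<close> is extended first by horn filling in \<open>A\<close>. The path component then
  becomes a map from \<open>L\<close> times a square to \<open>C\<close>, prescribed on three sides
  of the square and over \<open>K\<close>, and horn filling in \<open>C\<close> extends it.\<close>

lemma homotopy_lifts_hpullback:
  assumes hA: "hornlift A point to_point" and hC: "hornlift C point to_point"
    and A: "simplicial_set A" and B: "simplicial_set B" and C: "simplicial_set C"
    and f: "simplicial_map A C f" and g: "simplicial_map B C g"
    and L: "simplicial_set L" and K: "subsset L K" and e: "\<epsilon> \<le> 1"
  shows "homotopy_lifts \<epsilon> (hpullback A B C f g) B (\<lambda>n x. snd (snd x)) L K"
proof (rule homotopy_liftsI)
  let ?P = "hpullback A B C f g"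
  fix f0 h \<beta>
  assume f0: "simplicial_map L ?P f0" and h: "simplicial_map (sset_prod (restr L K) interval) ?P h"
    and \<beta>: "simplicial_map (sset_prod L interval) B \<beta>"
    and c1: "\<And>n l. l\<in>K n \<Longrightarrow> h n (l, const_cell \<epsilon> n) = f0 n l"
    and c2: "\<And>n l. l\<in>cells L n \<Longrightarrow> snd (snd (f0 n l)) = \<beta> n (l, const_cell \<epsilon> n)"
    and c3: "\<And>n l t. l\<in>K n \<Longrightarrow> t\<in>cells interval n \<Longrightarrow> snd (snd (h n (l, t))) = \<beta> n (l, t)"
  note Ks = ss_sub[OF L K]
  have ce: "const_cell i n \<in> cells interval n" if "i \<le> 1" for i n by (rule const_cell_cells[OF that])
  have neq: "const_cell 0 n \<noteq> const_cell 1 n" for n by simp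
  have hends: "path_ev n (fst (snd x)) (const_cell 0 n) = f n (fst x)" "path_ev n (fst (snd x)) (const_cell 1 n) = g n (snd (snd x))"
    if "x \<in> cells ?P n" for x n
    using that by (cases x, simp add: cells_hpb del: replicate_Suc)+
  obtain \<alpha> where \<alpha>: "simplicial_map (sset_prod L interval) A \<alpha>"
    "\<And>n l. l\<in>cells L n \<Longrightarrow> \<alpha> n (l, const_cell \<epsilon> n) = fst (f0 n l)"
    "\<And>n l t. l\<in>K n \<Longrightarrow> t\<in>cells interval n \<Longrightarrow> \<alpha> n (l, t) = fst (h n (l, t))"
    by (rule homotopy_lifts_point[OF hA A L K e sm_comp[OF f0 sm_hpb1] sm_comp[OF h sm_hpb1]]) (use c1 in simp, blast)
  let ?L' = "sset_prod L interval"
  \<comment> \<open>The path coordinate \<open>t\<close> is counted as part of the source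
    \<open>?L'\<close>, so that the two ends of the path and the part over \<open>K\<close> form one
    subcomplex; the remaining coordinate \<open>s\<close> is the homotopy parameter. The clauses of
    \<open>G\<close> below agree over \<open>K\<close> because \<open>h\<close> takes values in the
    homotopy pullback.\<close>
  define K' where "K' n = {(l, t). l \<in> cells L n \<and> t \<in> cells interval n \<and> (l \<in> K n \<or> t = const_cell 0 n \<or> t = const_cell 1 n)}" for n
  define F where "F = (\<lambda>n (l, t). path_ev n (fst (snd (f0 n l))) t)"
  define G where "G = (\<lambda>n ((l, t), s). if t = const_cell 0 n then f n (\<alpha> n (l, s)) else
    if t = const_cell 1 n then g n (\<beta> n (l, s)) else path_ev n (fst (snd (h n (l, s)))) t)"
  have L': "simplicial_set ?L'" by (rule simplicial_set_prod[OF L simplicial_set_std])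
  have K': "subsset ?L' K'"
  proof (rule subssetI)
    fix m n \<theta> x assume d: "delta_map m n \<theta>" and "x \<in> K' n"
    then show "act ?L' m n \<theta> x \<in> K' m"
      using ss_closed[OF L d] ss_closed[OF simplicial_set_std d, of _ 1] subsset_act[OF K d] act_const_cell[OF d]
        ce[of 0 m] ce[of 1 m]
      by (auto simp: K'_def simp del: replicate_Suc)
  qed (auto simp: K'_def)
  have F: "simplicial_map ?L' C F"
    unfolding F_def by (rule transpose[OF sm_comp[OF f0 sm_hpb2]])
  have hc: "h n (l, s) \<in> cells ?P n" if "l \<in> K n" "s \<in> cells interval n" for n l s
    using sm_closed[OF h, of "(l, s)" n] that by simp
  have G0: "G n ((l, const_cell 0 n), s) = f n (\<alpha> n (l, s))" for n l s by (simp add: G_def)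
  have G1: "G n ((l, const_cell 1 n), s) = g n (\<beta> n (l, s))" for n l s by (simp add: G_def)
  have GK: "G n ((l, t), s) = path_ev n (fst (snd (h n (l, s)))) t" if "l \<in> K n" "s \<in> cells interval n" for n l t s
    using hends[OF hc[OF that]] \<alpha>(3)[OF that] c3[OF that] by (simp add: G_def del: replicate_Suc)
  have G: "simplicial_map (sset_prod (restr ?L' K') interval) C G"
  proof (rule smI)
    fix n x assume "x \<in> cells (sset_prod (restr ?L' K') interval) n"
    then obtain l t s where x: "x = ((l, t), s)" "l \<in> cells L n" "t \<in> cells interval n" "s \<in> cells interval n"
       "l \<in> K n \<or> t = const_cell 0 n \<or> t = const_cell 1 n" by (auto simp: K'_def)
    then show "G n x \<in> cells C n"
      using sm_closed[OF f sm_closed[OF \<alpha>(1), of "(l, s)" n]] sm_closed[OF g sm_closed[OF \<beta>, of "(l, s)" n]]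
        GK[of l n s t] path_ev_closed[OF sm_closed[OF sm_hpb2 hc, of l n s], of t] G0[of n l s] G1[of n l s]
      by (auto simp del: replicate_Suc)
  next
    fix m n \<theta> x assume "x \<in> cells (sset_prod (restr ?L' K') interval) n" and d: "delta_map m n \<theta>"
    then obtain l t s where x: "x = ((l, t), s)" "l \<in> cells L n" "t \<in> cells interval n" "s \<in> cells interval n"
       "l \<in> K n \<or> t = const_cell 0 n \<or> t = const_cell 1 n" by (auto simp: K'_def)
    have s': "act interval m n \<theta> s \<in> cells interval m" by (rule ss_closed[OF simplicial_set_std d x(4)])
    from x(5) show "G m (act (sset_prod (restr ?L' K') interval) m n \<theta> x) = act C m n \<theta> (G n x)"
    proof (elim disjE)
      assume l: "l \<in> K n"
      then have l': "act L m n \<theta> l \<in> K m" by (rule subsset_act[OF K d])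
      have "h m (act L m n \<theta> l, act interval m n \<theta> s) = act ?P m n \<theta> (h n (l, s))"
        using sm_nat[OF h _ d, of "(l, s)"] l x(4) by simp
      then have "fst (snd (h m (act L m n \<theta> l, act interval m n \<theta> s))) = act (path_space C) m n \<theta> (fst (snd (h n (l, s))))"
        using sm_nat[OF sm_hpb2 hc[OF l x(4)] d] by simp
      then show ?thesis
        using path_ev_act[OF sm_closed[OF sm_hpb2 hc[OF l x(4)]] d x(3)] GK[OF l x(4)] GK[OF l' s'] x(1) by simp
    next
      assume "t = const_cell 0 n"
      then show ?thesis using x G0 act_const_cell[OF d] sm_nat[OF sm_comp[OF \<alpha>(1) f] _ d, of "(l, s)"]
        by (simp del: replicate_Suc)
    next
      assume "t = const_cell 1 n"
      then show ?thesis using x G1 act_const_cell[OF d] sm_nat[OF sm_comp[OF \<beta> g] _ d, of "(l, s)"]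
        by (simp del: replicate_Suc)
    qed
  qed
  have comp: "G n (x, const_cell \<epsilon> n) = F n x" if "x \<in> K' n" for n x
  proof -
    obtain l t where x: "x = (l, t)" "l \<in> cells L n" "t \<in> cells interval n" "l \<in> K n \<or> t = const_cell 0 n \<or> t = const_cell 1 n"
      using \<open>x \<in> K' n\<close> by (auto simp: K'_def)
    have fe: "f n (fst (f0 n l)) = path_ev n (fst (snd (f0 n l))) (const_cell 0 n)"
      "g n (snd (snd (f0 n l))) = path_ev n (fst (snd (f0 n l))) (const_cell 1 n)"
      using hends[OF sm_closed[OF f0 x(2)]] by simp_all
    from x(4) show ?thesis
    proof (elim disjE)
      assume l: "l \<in> K n"
      then show ?thesis using GK[OF l ce[OF e]] c1[OF l] x(1) by (simp add: F_def del: replicate_Suc)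
    next
      assume "t = const_cell 0 n"
      then show ?thesis using G0 \<alpha>(2)[OF x(2)] fe x(1) by (simp add: F_def del: replicate_Suc)
    next
      assume "t = const_cell 1 n"
      then show ?thesis using G1 c2[OF x(2)] fe x(1) by (simp add: F_def del: replicate_Suc)
    qed
  qed
  obtain \<Phi> where \<Phi>: "simplicial_map (sset_prod ?L' interval) C \<Phi>"
    "\<And>n x. x\<in>cells ?L' n \<Longrightarrow> \<Phi> n (x, const_cell \<epsilon> n) = F n x"
    "\<And>n x s. x\<in>K' n \<Longrightarrow> s\<in>cells interval n \<Longrightarrow> \<Phi> n (x, s) = G n (x, s)"
    using homotopy_lifts_point[OF hC C L' K' e F G comp] by blast
  \<comment> \<open>The interval coordinates are exchanged so that the path coordinate becomes the
    one that is transposed.\<close>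
  define \<Psi> where "\<Psi> n x = (case x of ((l, s), t) \<Rightarrow> \<Phi> n ((l, t), s))" for n x
  have \<Psi>: "simplicial_map (sset_prod ?L' interval) C \<Psi>"
    by (rule sm_cong[OF _ sm_comp[OF sm_swap \<Phi>(1)]]) (auto simp: \<Psi>_def intro!: simplicial_set_prod L simplicial_set_std)
  let ?u = "untranspose ?L' \<Psi>"
  have u: "simplicial_map ?L' (path_space C) ?u" by (rule untranspose_map[OF \<Psi> L' C])
  have evu: "path_ev n (?u n (l, s)) t = \<Phi> n ((l, t), s)" if "l \<in> cells L n" "s \<in> cells interval n" "t \<in> cells interval n" for n l s t
    using path_ev_untranspose[OF L' _ that(3), of "(l, s)", where F = \<Psi>] that by (simp add: \<Psi>_def)
  let ?H = "\<lambda>n x. (\<alpha> n x, ?u n x, \<beta> n x)"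
  have H: "simplicial_map ?L' ?P ?H"
  proof (rule hpb_map[OF \<alpha>(1) u \<beta>])
    fix n x assume "x \<in> cells ?L' n"
    then obtain l s where x: "x = (l, s)" "l \<in> cells L n" "s \<in> cells interval n" by auto
    show "path_ev n (?u n x) (const_cell 0 n) = f n (\<alpha> n x)"
      using evu[OF x(2,3) ce[of 0]] \<Phi>(3)[of "(l, const_cell 0 n)" n s] x ce[of 0] G0 by (simp add: K'_def del: replicate_Suc)
    show "path_ev n (?u n x) (const_cell 1 n) = g n (\<beta> n x)"
      using evu[OF x(2,3) ce[of 1]] \<Phi>(3)[of "(l, const_cell 1 n)" n s] x ce[of 1] G1 by (simp add: K'_def del: replicate_Suc)
  qed
  have iL: "simplicial_map L ?L' (\<lambda>n l. (l, const_cell \<epsilon> n))"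
    by (rule smI) (use ce[OF e] act_const_cell in \<open>auto simp del: replicate_Suc\<close>)
  have "?H n (l, const_cell \<epsilon> n) = f0 n l" if l: "l \<in> cells L n" for n l
  proof -
    have "?u n (l, const_cell \<epsilon> n) = fst (snd (f0 n l))"
      by (rule path_map_eqI[OF sm_comp[OF iL u] sm_comp[OF f0 sm_hpb2] L _ l])
        (use evu[OF _ ce[OF e]] \<Phi>(2) in \<open>auto simp: F_def simp del: replicate_Suc\<close>)
    then show ?thesis using \<alpha>(2)[OF l] c2[OF l] by (simp add: prod_eq_iff)
  qed
  moreover have "?H n (l, s) = h n (l, s)" if l: "l \<in> K n" "s \<in> cells interval n" for n l s
  proof -
    have KL: "subsset ?L' (\<lambda>n. K n \<times> cells interval n)"
      by (rule subssetI) (use subsset_in[OF K] subsset_act[OF K] ss_closed[OF simplicial_set_std] in auto)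
    have eq: "restr ?L' (\<lambda>n. K n \<times> cells interval n) = sset_prod (restr L K) interval" by (simp add: sset_prod_def)
    have "?u n (l, s) = fst (snd (h n (l, s)))"
    proof (rule path_map_eqI[OF sm_sub[OF u KL] _ ss_sub[OF L' KL]])
      show "simplicial_map (restr ?L' (\<lambda>n. K n \<times> cells interval n)) (path_space C) (\<lambda>n x. fst (snd (h n x)))"
        unfolding eq by (rule sm_comp[OF h sm_hpb2])
      fix n x t assume "x \<in> cells (restr ?L' (\<lambda>n. K n \<times> cells interval n)) n" "t \<in> cells interval n"
      then show "path_ev n (?u n x) t = path_ev n (fst (snd (h n x))) t"
        using evu subsset_in[OF K] \<Phi>(3) GK by (auto simp: K'_def)
    qed (use l in simp)
    then show ?thesis using \<alpha>(3)[OF l] c3[OF l] by (simp add: prod_eq_iff)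
  qed
  ultimately show "\<exists>H. simplicial_map (sset_prod L interval) ?P H \<and>
       (\<forall>n. \<forall>l\<in>cells L n. H n (l, const_cell \<epsilon> n) = f0 n l) \<and>
       (\<forall>n. \<forall>l\<in>K n. \<forall>t\<in>cells interval n. H n (l, t) = h n (l, t)) \<and>
       (\<forall>n. \<forall>l\<in>cells L n. \<forall>t\<in>cells interval n. snd (snd (H n (l, t))) = \<beta> n (l, t))"
    using H by (intro exI[of _ ?H]) simp
qed

section \<open>Monomorphisms of \<infinity>-groupoids\<close>

text \<open>The linear contraction of the simplex to its last vertex: the identity at parameter 0,
  constant at \<open>p\<close> at parameter 1.\<close>

definition collapse :: "nat \<Rightarrow> nat \<Rightarrow> nat list \<times> nat list \<Rightarrow> nat list" where
  "collapse p n = (\<lambda>(s, t). map (\<lambda>i. if t ! i = 0 then s ! i else p) [0..<Suc n])"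

lemma collapse_map: "simplicial_map (sset_prod (std_simplex p) interval) (std_simplex p) (collapse p)"
proof (rule smI)
  fix n x assume "x \<in> cells (sset_prod (std_simplex p) interval) n"
  then obtain s t where x: "x = (s, t)" "s \<in> cells (std_simplex p) n" "t \<in> cells interval n" by auto
  show "collapse p n x \<in> cells (std_simplex p) n"
    unfolding x(1) collapse_def prod.case
  proof (rule std_of_delta, rule delta_mapI)
    fix i assume "i \<le> n" then show "(if t ! i = 0 then s ! i else p) \<le> p" using x by (simp add: cells_std)
  next
    fix i j assume ij: "i \<le> j" "j \<le> n"
    then have "s ! i \<le> s ! j" "t ! i \<le> t ! j" "s ! i \<le> p" using x by (simp_all add: cells_std)
    then show "(if t ! i = 0 then s ! i else p) \<le> (if t ! j = 0 then s ! j else p)" by auto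
  qed
next
  fix m n \<theta> x assume "x \<in> cells (sset_prod (std_simplex p) interval) n" "delta_map m n \<theta>"
  then show "collapse p m (act (sset_prod (std_simplex p) interval) m n \<theta> x) = act (std_simplex p) m n \<theta> (collapse p n x)"
    by (auto simp: collapse_def act_std nth_map_upt' delta_map_le simp del: upt_Suc)
qed

lemma collapse_0: "s \<in> cells (std_simplex p) n \<Longrightarrow> collapse p n (s, const_cell 0 n) = s"
  by (rule nth_equalityI) (auto simp: collapse_def cells_std nth_map_upt' less_Suc_eq_le simp del: upt_Suc replicate_Suc)

lemma collapse_1: "collapse p n (s, const_cell 1 n) = const_cell p n"
  by (rule nth_equalityI) (auto simp: collapse_def nth_map_upt' less_Suc_eq_le simp del: upt_Suc replicate_Suc)

lemma subsset_empty: "subsset L (\<lambda>_. {})"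
  by (simp add: subsset_def)

text \<open>
  A lifting problem over \<open>\<Delta>[p]\<close> is transported along the contraction \<open>collapse\<close> into the homotopy fibre
  over the last vertex, solved there by contractibility, and transported back.
\<close>

lemma mono_lifts:
  assumes kA: "kan_complex A" and kC: "kan_complex C" and m: "monomorphism A C f"
    and D: "subsset C D" and ne: "\<And>c. c \<in> D 0 \<Longrightarrow> \<not> empty_sset (hofibre A C f c)"
  shows "lifts (hpullback A (restr C D) C f (\<lambda>n x. x)) (restr C D) (\<lambda>n x. snd (snd x)) (std_simplex p) (boundary p)"
proof (rule liftsI)
  let ?P = "hpullback A (restr C D) C f (\<lambda>n x. x)" and ?\<Delta> = "std_simplex p"
  fix u b
  assume u: "simplicial_map (restr ?\<Delta> (boundary p)) ?P u" and b: "simplicial_map ?\<Delta> (restr C D) b"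
    and c: "\<And>n x. x \<in> boundary p n \<Longrightarrow> snd (snd (u n x)) = b n x"
  have A: "simplicial_set A" and C: "simplicial_set C" using kA kC by (auto simp: kan_complex_def)
  note hA = kan_complex_hornlift[OF kA] and hC = kan_complex_hornlift[OF kC]
  have f: "simplicial_map A C f" using m by (simp add: monomorphism_def)
  note CD = ss_sub[OF C D]
  have g: "simplicial_map (restr C D) C (\<lambda>n x. x)"
    by (rule sm_sub[OF _ D]) (rule smI, auto)
  note hfP = homotopy_lifts_hpullback[OF hA hC A CD C f g]
  have bdc: "s \<in> boundary p n \<Longrightarrow> s \<in> cells ?\<Delta> n" for s n by (simp add: boundary_def)
  \<comment> \<open>The value of \<open>b\<close> at the last vertex. All data will be moved over
    \<open>v\<close> and its degeneracies \<open>k n\<close>.\<close>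
  define v where "v = b 0 (const_cell p 0)"
  have v: "v \<in> D 0" using sm_closed[OF b const_cell_cells[of p p 0]] by (simp add: v_def)
  define k where "k n = act C n 0 (\<lambda>_. 0) v" for n
  have kD: "k n \<in> D n" for n unfolding k_def using subsset_act[OF D delta_map_const v] by simp
  have kact: "act C m n \<theta> (k n) = k m" if "delta_map m n \<theta>" for m n \<theta>
    unfolding k_def by (rule ss_comp'[OF C that delta_map_const subsset_in[OF D v]]) auto
  have bk: "b n (const_cell p n) = k n" for n
    using sm_nat[OF b const_cell_cells[of p p 0] delta_map_const, of 0 n] act_const_cell[OF delta_map_const[of 0 0 n], of p p]
    by (simp add: v_def k_def del: replicate_Suc)
  let ?F = "hofibre A C f v"
  \<comment> \<open>The fibre over \<open>v\<close> is not empty, hence contractible. The homotopy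
    \<open>H\<close> obtained from this runs from the constant map at \<open>g0\<close> to the
    identity.\<close>
  have "contractible_sset ?F" using m ne[OF v] subsset_in[OF D v] by (auto simp: monomorphism_def)
  then obtain g0 H where g0: "simplicial_map point ?F g0" and H: "simplicial_map (sset_prod ?F interval) ?F H"
    "\<And>n x. x \<in> cells ?F n \<Longrightarrow> H n (x, const_cell 0 n) = g0 n (const_cell 0 n)" "\<And>n x. x \<in> cells ?F n \<Longrightarrow> H n (x, const_cell 1 n) = x"
    unfolding contractible_sset_def equivalence_def homotopic_def
    by (auto simp: to_point_cst simp del: replicate_Suc)
  have Fc: "(a, \<gamma>, z) \<in> cells ?F n \<longleftrightarrow> a \<in> cells A n \<and> \<gamma> \<in> cells (path_space C) n \<and> z = const_cell 0 n \<and>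
     path_ev n \<gamma> (const_cell 0 n) = f n a \<and> path_ev n \<gamma> (const_cell 1 n) = k n" for a \<gamma> z n
    by (auto simp: hofibre_def cells_hpb cells_point point_map_def k_def simp del: replicate_Suc)
  have Pc: "(a, \<gamma>, z) \<in> cells ?P n \<longleftrightarrow> a \<in> cells A n \<and> \<gamma> \<in> cells (path_space C) n \<and> z \<in> D n \<and>
     path_ev n \<gamma> (const_cell 0 n) = f n a \<and> path_ev n \<gamma> (const_cell 1 n) = z" for a \<gamma> z n
    by (simp add: cells_hpb del: replicate_Suc)
  \<comment> \<open>The simplices of \<open>?P\<close> lying over a degeneracy \<open>k n\<close>
    are those of the fibre \<open>?F\<close>; only the last component has to be renamed.\<close>
  define bck where "bck n x = (fst x, fst (snd x), k n)" for n and x :: "'a \<times> 'b path \<times> nat list"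
  define forth where "forth n x = (fst x, fst (snd x), const_cell 0 n)" for n and x :: "'a \<times> 'b path \<times> 'b"
  have bck: "simplicial_map ?F ?P bck"
  proof (rule smI)
    fix n x assume "x \<in> cells ?F n"
    then show "bck n x \<in> cells ?P n" by (cases x) (simp add: bck_def Fc Pc kD del: replicate_Suc)
  next
    fix m n \<theta> x assume d: "delta_map m n \<theta>"
    show "bck m (act ?F m n \<theta> x) = act ?P m n \<theta> (bck n x)"
      by (cases x) (simp add: bck_def hofibre_def act_hpb kact[OF d])
  qed
  have forth: "forth n x \<in> cells ?F n" if "x \<in> cells ?P n" "snd (snd x) = k n" for n x
    using that by (cases x) (simp add: forth_def Fc Pc del: replicate_Suc)
  have bck_forth: "bck n (forth n x) = x" if "snd (snd x) = k n" for n x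
    using that by (cases x) (simp add: bck_def forth_def)
  have forth_act: "forth m (act ?P m n \<theta> x) = act ?F m n \<theta> (forth n x)" if "delta_map m n \<theta>" for m n \<theta> x
    using act_const_cell[OF that] by (cases x) (simp add: forth_def hofibre_def act_hpb del: replicate_Suc)
  have bcol: "simplicial_map (sset_prod ?\<Delta> interval) (restr C D) (\<lambda>n x. b n (collapse p n x))"
    by (rule sm_comp[OF collapse_map b])
  have bds: "subsset (sset_prod ?\<Delta> interval) (\<lambda>n. boundary p n \<times> cells interval n)"
    by (rule subssetI) (use subsset_act[OF subsset_boundary] ss_closed[OF simplicial_set_std] bdc in auto)
  have bde: "restr (sset_prod ?\<Delta> interval) (\<lambda>n. boundary p n \<times> cells interval n) = sset_prod (restr ?\<Delta> (boundary p)) interval"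
    by (simp add: sset_prod_def)
  \<comment> \<open>The boundary data are transported along \<open>collapse\<close>: at parameter 0
    this is \<open>u\<close>, at parameter 1 it lies over \<open>v\<close>.\<close>
  obtain U where U: "simplicial_map (sset_prod (restr ?\<Delta> (boundary p)) interval) ?P U"
    "\<And>n s. s \<in> boundary p n \<Longrightarrow> U n (s, const_cell 0 n) = u n s"
    "\<And>n s t. s \<in> boundary p n \<Longrightarrow> t \<in> cells interval n \<Longrightarrow> snd (snd (U n (s, t))) = b n (collapse p n (s, t))"
  proof (rule homotopy_liftsD[OF hfP[OF ss_sub[OF simplicial_set_std subsset_boundary] subsset_empty, of 0] u _ sm_sub[OF bcol bds, unfolded bde]])
    \<comment> \<open>The extension is relative to the empty subcomplex, so the map on the wall has
      no cells to act on.\<close>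
    show "simplicial_map (sset_prod (restr (restr ?\<Delta> (boundary p)) (\<lambda>_. {})) interval) ?P undefined"
      by (simp add: simplicial_map_def sset_prod_def)
    show "\<And>n l. l \<in> cells (restr ?\<Delta> (boundary p)) n \<Longrightarrow> snd (snd (u n l)) = b n (collapse p n (l, const_cell 0 n))"
      using c collapse_0 bdc by (simp del: replicate_Suc)
  qed (simp_all del: replicate_Suc)
  have I0: "const_cell 0 n \<in> cells interval n" and interval: "const_cell 1 n \<in> cells interval n" for n by (simp_all add: const_cell_cells del: replicate_Suc)
  define w where "w n s = forth n (U n (s, const_cell 1 n))" for n s
  have Uc: "U n (s, t) \<in> cells ?P n" if "s \<in> boundary p n" "t \<in> cells interval n" for n s t
    using sm_closed[OF U(1), of "(s, t)" n] that by simp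
  have U1: "snd (snd (U n (s, const_cell 1 n))) = k n" if "s \<in> boundary p n" for n s
    using U(3)[OF that interval] collapse_1 bk by metis
  have w: "simplicial_map (restr ?\<Delta> (boundary p)) ?F w"
  proof (rule smI)
    fix n s assume "s \<in> cells (restr ?\<Delta> (boundary p)) n"
    then show "w n s \<in> cells ?F n" unfolding w_def using forth[OF Uc[OF _ interval] U1] by simp
  next
    fix m n \<theta> s assume "s \<in> cells (restr ?\<Delta> (boundary p)) n" and d: "delta_map m n \<theta>"
    then show "w m (act (restr ?\<Delta> (boundary p)) m n \<theta> s) = act ?F m n \<theta> (w n s)"
      using sm_nat[OF U(1) _ d, of "(s, const_cell 1 n)"] interval act_const_cell[OF d]
      by (simp add: w_def forth_act[OF d, symmetric] del: replicate_Suc)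
  qed
  have Fsnd: "snd (snd (bck n x)) = k n" for n x by (simp add: bck_def)
  have cpt: "simplicial_map L point (\<lambda>n _. const_cell 0 n)" for L :: "nat list sset"
    using sm_to_point[of L] by (simp add: to_point_cst[abs_def] del: replicate_Suc)
  have wc: "w n s \<in> cells ?F n" if "s \<in> boundary p n" for n s using sm_closed[OF w, of s n] that by simp
  \<comment> \<open>The constant map at \<open>g0\<close> is defined on the entire simplex.
    Following the contraction over the boundary, it is deformed to an extension of \<open>w\<close>,
    reached at parameter 1.\<close>
  obtain W where W: "simplicial_map (sset_prod ?\<Delta> interval) ?P W"
    "\<And>n s t. s \<in> boundary p n \<Longrightarrow> t \<in> cells interval n \<Longrightarrow> W n (s, t) = bck n (H n (w n s, t))"
    "\<And>n s t. s \<in> cells ?\<Delta> n \<Longrightarrow> t \<in> cells interval n \<Longrightarrow> snd (snd (W n (s, t))) = k n"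
  proof (rule homotopy_liftsD[OF hfP[OF simplicial_set_std subsset_boundary, of 0]])
    show "simplicial_map ?\<Delta> ?P (\<lambda>n s. bck n (g0 n (const_cell 0 n)))"
      using sm_comp[OF sm_comp[OF cpt[of ?\<Delta>] g0] bck] .
    have "simplicial_map (sset_prod (restr ?\<Delta> (boundary p)) interval) (sset_prod ?F interval) (\<lambda>n x. (w n (fst x), snd x))"
      by (rule sm_pair[OF sm_comp[OF sm_fst w] sm_snd])
    from sm_comp[OF sm_comp[OF this H(1)] bck]
    show "simplicial_map (sset_prod (restr ?\<Delta> (boundary p)) interval) ?P (\<lambda>n x. bck n (H n (w n (fst x), snd x)))" .
    show "simplicial_map (sset_prod ?\<Delta> interval) (restr C D) (\<lambda>n _. k n)"
      by (rule smI) (simp_all add: kD kact)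
  qed (simp_all add: Fsnd H(2) wc del: replicate_Suc)
  \<comment> \<open>The way back: the extension just found sits at parameter 1 and is moved along
    \<open>U\<close> to parameter 0, where it restricts to \<open>u\<close> and lies over
    \<open>b\<close>.\<close>
  obtain Z where Z: "simplicial_map (sset_prod ?\<Delta> interval) ?P Z"
    "\<And>n s t. s \<in> boundary p n \<Longrightarrow> t \<in> cells interval n \<Longrightarrow> Z n (s, t) = U n (s, t)"
    "\<And>n s t. s \<in> cells ?\<Delta> n \<Longrightarrow> t \<in> cells interval n \<Longrightarrow> snd (snd (Z n (s, t))) = b n (collapse p n (s, t))"
  proof (rule homotopy_liftsD[OF hfP[OF simplicial_set_std subsset_boundary, of 1] _ U(1) bcol])
    have "simplicial_map ?\<Delta> (sset_prod ?\<Delta> interval) (\<lambda>n s. (s, const_cell 1 n))"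
      by (rule smI) (use interval act_const_cell in \<open>auto simp del: replicate_Suc\<close>)
    from sm_comp[OF this W(1)] show "simplicial_map ?\<Delta> ?P (\<lambda>n s. W n (s, const_cell 1 n))" .
    fix n s assume s: "s \<in> boundary p n"
    show "U n (s, const_cell 1 n) = W n (s, const_cell 1 n)"
      unfolding W(2)[OF s interval] H(3)[OF wc[OF s]] using bck_forth[OF U1[OF s]] by (simp only: w_def)
  next
    fix n s assume "s \<in> cells ?\<Delta> n"
    then show "snd (snd (W n (s, const_cell 1 n))) = b n (collapse p n (s, const_cell 1 n))"
      using W(3)[OF _ interval] collapse_1 bk by metis
  qed (simp_all add: U(3) del: replicate_Suc)
  have "simplicial_map ?\<Delta> (sset_prod ?\<Delta> interval) (\<lambda>n s. (s, const_cell 0 n))"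
    by (rule smI) (use I0 act_const_cell in \<open>auto simp del: replicate_Suc\<close>)
  from sm_comp[OF this Z(1)] show "\<exists>h. simplicial_map ?\<Delta> ?P h \<and> (\<forall>n. \<forall>x\<in>boundary p n. h n x = u n x) \<and>
      (\<forall>n. \<forall>x\<in>cells ?\<Delta> n. snd (snd (h n x)) = b n x)"
    using Z(2)[OF _ I0] Z(3)[OF _ I0] U(2) collapse_0
    by (intro exI[of _ "\<lambda>n s. Z n (s, const_cell 0 n)"]) (simp del: replicate_Suc)
qed

section \<open>Degenerate edges\<close>

text \<open>The part of \<open>simplicial_space\<close> without fibrancy conditions; it also holds
  for the transposed object and for the degenerate part.\<close>

definition bisimplicial :: "'a sspace \<Rightarrow> bool" where
  "bisimplicial Z \<longleftrightarrow> (\<forall>n. simplicial_set (level Z n)) \<and> (\<forall>p. simplicial_set (row Z p)) \<and>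
     (\<forall>m n \<theta>. delta_map m n \<theta> \<longrightarrow> simplicial_map (level Z n) (level Z m) (hact Z m n \<theta>))"

lemma cells_row [simp]: "cells (row Z p) n = cells (level Z n) p"
  and act_row [simp]: "act (row Z p) m n \<theta> = hact Z m n \<theta> p"
  by (simp_all add: row_def)

lemma bs_level: "bisimplicial Z \<Longrightarrow> simplicial_set (level Z n)"
  and bs_row: "bisimplicial Z \<Longrightarrow> simplicial_set (row Z p)"
  and bs_hact: "bisimplicial Z \<Longrightarrow> delta_map m n \<theta> \<Longrightarrow> simplicial_map (level Z n) (level Z m) (hact Z m n \<theta>)"
  by (simp_all add: bisimplicial_def)

lemma bs_closed: "bisimplicial Z \<Longrightarrow> delta_map m n \<theta> \<Longrightarrow> x \<in> cells (level Z n) p \<Longrightarrow>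
    hact Z m n \<theta> p x \<in> cells (level Z m) p"
  using sm_closed[OF bs_hact] .

lemma bs_eq: "bisimplicial Z \<Longrightarrow> delta_map m n \<theta> \<Longrightarrow> x \<in> cells (level Z n) p \<Longrightarrow> (\<And>i. i \<le> m \<Longrightarrow> \<theta> i = \<phi> i) \<Longrightarrow>
    hact Z m n \<theta> p x = hact Z m n \<phi> p x"
  using ss_eq[OF bs_row, of Z m n \<theta> x p \<phi>] by simp

lemma bs_id: "bisimplicial Z \<Longrightarrow> x \<in> cells (level Z n) p \<Longrightarrow> (\<And>i. i \<le> n \<Longrightarrow> \<theta> i = i) \<Longrightarrow>
    hact Z n n \<theta> p x = x"
  using ss_id[OF bs_row, of Z x p n \<theta>] by simp

lemma bs_comp: "bisimplicial Z \<Longrightarrow> delta_map l m \<phi> \<Longrightarrow> delta_map m n \<theta> \<Longrightarrow> x \<in> cells (level Z n) p \<Longrightarrow>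
    (\<And>i. i \<le> l \<Longrightarrow> \<theta> (\<phi> i) = \<psi> i) \<Longrightarrow>
    hact Z l m \<phi> p (hact Z m n \<theta> p x) = hact Z l n \<psi> p x"
  using ss_comp'[OF bs_row, of Z l m \<phi> n \<theta> x p \<psi>] by simp

lemma bs_nat: "bisimplicial Z \<Longrightarrow> delta_map m n \<theta> \<Longrightarrow> delta_map q p \<phi> \<Longrightarrow> x \<in> cells (level Z n) p \<Longrightarrow>
    hact Z m n \<theta> q (act (level Z n) q p \<phi> x) = act (level Z m) q p \<phi> (hact Z m n \<theta> p x)"
  using sm_nat[OF bs_hact] .

definition degenerate :: "'a sspace \<Rightarrow> 'a \<Rightarrow> bool" where
  "degenerate X a \<longleftrightarrow> (\<exists>x\<in>cells (level X 0) 0. \<exists>e\<in>cells (level X 1) 1.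
     act (level X 1) 0 1 (\<lambda>_. 0) e = hact X 1 0 (\<lambda>_. 0) 0 x \<and> act (level X 1) 0 1 (\<lambda>_. 1) e = a)"

lemma face_edge:
  assumes "simplicial_set K" "e \<in> cells K 1"
  shows "face K 1 1 e = act K 0 1 (\<lambda>_. 0) e" "face K 1 0 e = act K 0 1 (\<lambda>_. 1) e"
proof -
  have "delta_map 0 1 (coface i)" if "i \<le> 1" for i
    using that by (intro delta_mapI) (auto simp: coface_def One_nat_def)
  with assms show "face K 1 1 e = act K 0 1 (\<lambda>_. 0) e" "face K 1 0 e = act K 0 1 (\<lambda>_. 1) e"
    by (auto simp: face_def coface_def One_nat_def[symmetric] intro!: ss_eq)
qed

lemma nondegenerate_iff:
  assumes "bisimplicial X" "a \<in> cells (level X 1) 0"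
  shows "nondegenerate_edge X a \<longleftrightarrow> \<not> degenerate X a"
  using assms face_edge[OF bs_level[OF assms(1), of 1]] unfolding nondegenerate_edge_def degenerate_def by auto

lemma simplicial_space_bs: "simplicial_space X \<Longrightarrow> bisimplicial X"
  by (auto simp: simplicial_space_def bisimplicial_def kan_complex_def)

text \<open>The inner horn concatenates \<open>e\<close> with \<open>e'\<close>, and the horn at
  vertex 2 concatenates \<open>e\<close> with the reverse of \<open>e'\<close>. Together they make
  \<open>degenerate\<close> invariant along paths in both directions.\<close>

lemma kan_fill2:
  assumes k: "kan_complex K" and e: "e \<in> cells K 1" "e' \<in> cells K 1"
  shows "act K 0 1 (\<lambda>_. 1) e = act K 0 1 (\<lambda>_. 0) e' \<Longrightarrow>
      \<exists>d\<in>cells K 1. act K 0 1 (\<lambda>_. 0) d = act K 0 1 (\<lambda>_. 0) e \<and> act K 0 1 (\<lambda>_. 1) d = act K 0 1 (\<lambda>_. 1) e'"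
    and "act K 0 1 (\<lambda>_. 1) e = act K 0 1 (\<lambda>_. 1) e' \<Longrightarrow>
      \<exists>d\<in>cells K 1. act K 0 1 (\<lambda>_. 0) d = act K 0 1 (\<lambda>_. 0) e \<and> act K 0 1 (\<lambda>_. 1) d = act K 0 1 (\<lambda>_. 0) e'"
proof -
  have K: "simplicial_set K" using k by (simp add: kan_complex_def)
  have kf: "kan_fibration K point to_point" using k by (simp add: kan_complex_def)
  have fill: "\<exists>y\<in>cells K 2. \<forall>i\<le>2. i \<noteq> j \<longrightarrow> face K 2 i y = x i"
    if "j \<le> 2" "horn K 1 j x" for j x
  proof -
    have "face point 2 i (const_cell 0 2) = const_cell 0 1" if "i \<le> 2" for i
      using act_const_cell[OF delta_map_coface[of i 1]] that unfolding face_def by (simp add: numeral_2_eq_2 One_nat_def del: replicate_Suc)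
    then have "j \<le> Suc 1 \<and> horn K 1 j x \<and> const_cell 0 2 \<in> cells point (Suc 1) \<and>
        (\<forall>i\<le>Suc 1. i \<noteq> j \<longrightarrow> face point (Suc 1) i (const_cell 0 2) = to_point 1 (x i))"
      using that const_cell_cells[of 0 0 2] by (simp add: to_point_cst numeral_2_eq_2 One_nat_def del: replicate_Suc)
    from kf[unfolded kan_fibration_def, THEN conjunct2, rule_format, OF this]
    show ?thesis by (auto simp: numeral_2_eq_2 One_nat_def)
  qed
  have dc: "delta_map 1 2 (coface i)" if "i \<le> 2" for i
    using delta_map_coface[of i 1] that by (simp add: numeral_2_eq_2 One_nat_def)
  have vert: "act K 0 1 (\<lambda>_. v) (face K 2 i y) = act K 0 2 (\<lambda>_. coface i v) y"
    if "y \<in> cells K 2" "v \<le> 1" "i \<le> 2" for y v i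
    unfolding face_def diff_Suc_1 numeral_2_eq_2 
    using ss_comp'[OF K delta_map_const[OF that(2)] dc[OF that(3)] that(1)] by (simp add: numeral_2_eq_2 One_nat_def)
  have fc: "face K 2 i y \<in> cells K 1" if "y \<in> cells K 2" "i \<le> 2" for y i
    using ss_closed[OF K dc[OF that(2)] that(1)] by (simp add: face_def numeral_2_eq_2 One_nat_def)
  {
    assume a: "act K 0 1 (\<lambda>_. 1) e = act K 0 1 (\<lambda>_. 0) e'"
    have "horn K 1 1 (\<lambda>i. if i = 0 then e' else e)"
      unfolding horn_def
    proof (intro conjI allI impI)
      fix i j :: nat assume "i < j \<and> j \<le> Suc 1 \<and> i \<noteq> 1 \<and> j \<noteq> 1"
      then have "i = 0" "j = 2" "j - 1 = 1" by (auto simp: One_nat_def)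
      then show "face K 1 i (if j = 0 then e' else e) = face K 1 (j - 1) (if i = 0 then e' else e)"
        using a face_edge[OF K e(1)] face_edge[OF K e(2)] by (simp only: if_True refl) simp
    qed (use e in auto)
    then obtain y where y: "y \<in> cells K 2" "\<And>i. i \<le> 2 \<Longrightarrow> i \<noteq> 1 \<Longrightarrow> face K 2 i y = (if i = 0 then e' else e)"
      using fill[of 1] by force
    show "\<exists>d\<in>cells K 1. act K 0 1 (\<lambda>_. 0) d = act K 0 1 (\<lambda>_. 0) e \<and> act K 0 1 (\<lambda>_. 1) d = act K 0 1 (\<lambda>_. 1) e'"
      using fc[OF y(1), of 1] vert[OF y(1), of _ 0] vert[OF y(1), of _ 1] vert[OF y(1), of _ 2] y(2)[of 0] y(2)[of 2]
      by (intro bexI[of _ "face K 2 1 y"]) (auto simp: coface_def One_nat_def)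
  next
    assume a: "act K 0 1 (\<lambda>_. 1) e = act K 0 1 (\<lambda>_. 1) e'"
    have "horn K 1 2 (\<lambda>i. if i = 0 then e' else e)"
      unfolding horn_def
    proof (intro conjI allI impI)
      fix i j :: nat assume "i < j \<and> j \<le> Suc 1 \<and> i \<noteq> 2 \<and> j \<noteq> 2"
      then have "i = 0" "j = 1" by (auto simp: One_nat_def)
      then show "face K 1 i (if j = 0 then e' else e) = face K 1 (j - 1) (if i = 0 then e' else e)"
        using a face_edge[OF K e(1)] face_edge[OF K e(2)] by simp
    qed (use e in auto)
    then obtain y where y: "y \<in> cells K 2" "\<And>i. i \<le> 2 \<Longrightarrow> i \<noteq> 2 \<Longrightarrow> face K 2 i y = (if i = 0 then e' else e)"
      using fill[of 2] by force
    show "\<exists>d\<in>cells K 1. act K 0 1 (\<lambda>_. 0) d = act K 0 1 (\<lambda>_. 0) e \<and> act K 0 1 (\<lambda>_. 1) d = act K 0 1 (\<lambda>_. 0) e'"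
      using fc[OF y(1), of 2] vert[OF y(1), of _ 0] vert[OF y(1), of _ 1] vert[OF y(1), of _ 2] y(2)[of 0] y(2)[of 1]
      by (intro bexI[of _ "face K 2 2 y"]) (auto simp: coface_def One_nat_def)
  }
qed

lemma degenerate_path:
  assumes k: "kan_complex (level X 1)" and e: "e \<in> cells (level X 1) 1"
  shows "degenerate X (act (level X 1) 0 1 (\<lambda>_. 0) e) \<longleftrightarrow> degenerate X (act (level X 1) 0 1 (\<lambda>_. 1) e)"
  using kan_fill2[OF k _ e] unfolding degenerate_def by metis

lemma degenerate_s0:
  assumes X: "bisimplicial X" and y: "y \<in> cells (level X 0) 0"
  shows "degenerate X (hact X 1 0 (\<lambda>_. 0) 0 y)"
proof -
  let ?a = "hact X 1 0 (\<lambda>_. 0) 0 y"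
  have a: "?a \<in> cells (level X 1) 0" by (rule bs_closed[OF X delta_map_const y]) simp
  have "act (level X 1) 0 1 (\<lambda>_. i) (act (level X 1) 1 0 (\<lambda>_. 0) ?a) = ?a" if "i \<le> 1" for i
  proof -
    have "act (level X 1) 0 1 (\<lambda>_. i) (act (level X 1) 1 0 (\<lambda>_. 0) ?a) = act (level X 1) 0 0 (\<lambda>_. 0) ?a"
      by (rule ss_comp'[OF bs_level[OF X]]) (use a that in \<open>auto intro: delta_map_const\<close>)
    then show ?thesis using ss_id[OF bs_level[OF X] a, of "\<lambda>_. 0"] by simp
  qed
  moreover have "act (level X 1) 1 0 (\<lambda>_. 0) ?a \<in> cells (level X 1) 1"
    by (rule ss_closed[OF bs_level[OF X] delta_map_const a]) simp
  ultimately show ?thesis unfolding degenerate_def using y by (metis le0 order_refl)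
qed

definition full_cells :: "'a sset \<Rightarrow> 'a set \<Rightarrow> nat \<Rightarrow> 'a set" where
  "full_cells K V n = {x \<in> cells K n. \<forall>i\<le>n. act K 0 n (\<lambda>_. i) x \<in> V}"

lemma full_sub_eq: "full_sub K V = restr K (full_cells K V)"
  by (simp add: full_sub_def full_cells_def[abs_def])

lemma subsset_full_cells:
  assumes K: "simplicial_set K"
  shows "subsset K (full_cells K V)"
proof (rule subssetI)
  fix m n \<theta> x assume d: "delta_map m n \<theta>" and x: "x \<in> full_cells K V n"
  then have x': "x \<in> cells K n" by (simp add: full_cells_def)
  have "act K 0 m (\<lambda>_. i) (act K m n \<theta> x) = act K 0 n (\<lambda>_. \<theta> i) x" if "i \<le> m" for i
    by (rule ss_comp'[OF K delta_map_const[OF that] d x']) simp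
  then show "act K m n \<theta> x \<in> full_cells K V m"
    using x ss_closed[OF K d x'] delta_map_le[OF d] by (auto simp: full_cells_def)
qed (simp add: full_cells_def)

lemma sm_full_sub:
  assumes f: "simplicial_map K L f" and K: "simplicial_set K" and V: "\<And>x. x \<in> cells K 0 \<Longrightarrow> f 0 x \<in> V"
  shows "simplicial_map K (full_sub L V) f"
proof (rule smI)
  fix n x assume x: "x \<in> cells K n"
  then show "f n x \<in> cells (full_sub L V) n"
    using sm_closed[OF f x] sm_nat[OF f x delta_map_const] V[OF ss_closed[OF K delta_map_const x]]
    by (auto simp: full_sub_eq full_cells_def)
qed (simp add: full_sub_eq sm_nat[OF f])

section \<open>Splitting off a degenerate first edge\<close>

text \<open>Collapsing the first edge of \<open>[m+1]\<close> yields \<open>[m]\<close>. The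
  quotient map \<open>\<lambda>i. i - 1\<close> sends both 0 and 1 to 0 because subtraction is
  truncated.\<close>

lemma delta_pushout_edge:
  "delta_pushout 1 0 (Suc m) m (\<lambda>_. 0) (\<lambda>i. i) (\<lambda>_. 0) (\<lambda>i. i - 1)"
  unfolding delta_pushout_def
proof (intro conjI allI impI)
  fix t u v assume a: "delta_map 0 t u \<and> delta_map (Suc m) t v \<and> delta_eq 1 (u \<circ> (\<lambda>_. 0)) (v \<circ> (\<lambda>i. i))"
  then have v01: "v 0 = u 0" "v 1 = u 0" by (auto simp: delta_eq_def)
  show "\<exists>w. delta_map m t w \<and> delta_eq 0 (w \<circ> (\<lambda>_. 0)) u \<and> delta_eq (Suc m) (w \<circ> (\<lambda>i. i - 1)) v \<and>
      (\<forall>w'. delta_map m t w' \<and> delta_eq 0 (w' \<circ> (\<lambda>_. 0)) u \<and> delta_eq (Suc m) (w' \<circ> (\<lambda>i. i - 1)) v \<longrightarrow> delta_eq m w' w)"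
  proof (intro exI[of _ "\<lambda>i. v (Suc i)"] conjI allI impI)
    show "delta_map m t (\<lambda>i. v (Suc i))"
    proof (rule delta_mapI)
      have d: "delta_map (Suc m) t v" using a by blast
      show "i \<le> m \<Longrightarrow> v (Suc i) \<le> t" for i using delta_map_le[OF d, of "Suc i"] by simp
      show "i \<le> j \<Longrightarrow> j \<le> m \<Longrightarrow> v (Suc i) \<le> v (Suc j)" for i j using delta_map_mono[OF d, of "Suc i" "Suc j"] by simp
    qed
    show "delta_eq 0 ((\<lambda>i. v (Suc i)) \<circ> (\<lambda>_. 0)) u" using v01 by (simp add: delta_eq_def One_nat_def)
    show "delta_eq (Suc m) ((\<lambda>i. v (Suc i)) \<circ> (\<lambda>i. i - 1)) v"
      unfolding delta_eq_def
    proof (intro allI impI)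
      fix i show "((\<lambda>i. v (Suc i)) \<circ> (\<lambda>i. i - 1)) i = v i" using v01 by (cases i) (auto simp: One_nat_def)
    qed
    fix w' assume "delta_map m t w' \<and> delta_eq 0 (w' \<circ> (\<lambda>_. 0)) u \<and> delta_eq (Suc m) (w' \<circ> (\<lambda>i. i - 1)) v"
    then have "w' (Suc i - 1) = v (Suc i)" if "i \<le> m" for i using that by (auto simp: delta_eq_def)
    then show "delta_eq m w' (\<lambda>i. v (Suc i))" by (simp add: delta_eq_def)
  qed
qed (auto simp: delta_map_def delta_eq_def mono_on_def One_nat_def le_Suc_eq)

text \<open>The decomposition axiom identifies \<open>X\<^sub>m\<close> with the homotopy pullback
  of \<open>X\<^sub>0\<close> and \<open>X\<^sub>m\<^sub>+\<^sub>1\<close> over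
  \<open>X\<^sub>1\<close>. To map \<open>L\<close> into this pullback, the first edges of
  \<open>w\<close> must be joined by paths to edges \<open>s\<^sub>0 x\<close>, coherently over all
  of \<open>L\<close>; this is possible because the relevant fibres of the monomorphism
  \<open>s\<^sub>0\<close> are contractible.\<close>

lemma split_degenerate:
  assumes X: "complete_decomposition_space X" and L: "simplicial_set L"
    and w: "simplicial_map L (level X (Suc m)) w"
    and dgw: "\<And>l. l \<in> cells L 0 \<Longrightarrow> degenerate X (hact X 1 (Suc m) (\<lambda>i. i) 0 (w 0 l))"
  obtains v H where "simplicial_map L (level X m) v" "simplicial_map (sset_prod L interval) (level X (Suc m)) H"
    "\<And>n l. l \<in> cells L n \<Longrightarrow> H n (l, const_cell 0 n) = hact X (Suc m) m (\<lambda>i. i - 1) n (v n l)"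
    "\<And>n l. l \<in> cells L n \<Longrightarrow> H n (l, const_cell 1 n) = w n l"
proof -
  have ds: "decomposition_space X" and mono: "monomorphism (level X 0) (level X 1) (hact X 1 0 (\<lambda>_. 0))"
    using X by (auto simp: complete_decomposition_space_def)
  then have ss: "simplicial_space X" by (simp add: decomposition_space_def)
  note bisimp = simplicial_space_bs[OF ss]
  have kan_level: "kan_complex (level X n)" for n using ss by (simp add: simplicial_space_def)
  let ?s = "hact X 1 0 (\<lambda>_. 0)" and ?e = "hact X 1 (Suc m) (\<lambda>i. i)"
  have de: "delta_map 1 (Suc m) (\<lambda>i. i)" by (auto intro: delta_mapI)
  have s: "simplicial_map (level X 0) (level X 1) ?s" by (rule bs_hact[OF bisimp delta_map_const]) simp
  have e: "simplicial_map (level X (Suc m)) (level X 1) ?e" by (rule bs_hact[OF bisimp de])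
  define V where "V = {a \<in> cells (level X 1) 0. degenerate X a}"
  let ?D = "full_cells (level X 1) V"
  have D: "subsset (level X 1) ?D" by (rule subsset_full_cells[OF bs_level[OF bisimp]])
  have ne: "\<not> empty_sset (hofibre (level X 0) (level X 1) ?s c)" if c: "c \<in> ?D 0" for c
  proof -
    have cc: "c \<in> cells (level X 1) 0" using c by (simp add: full_cells_def)
    have "act (level X 1) 0 0 (\<lambda>_. 0) c = c" by (rule ss_id[OF bs_level[OF bisimp] cc]) simp
    then have "degenerate X c" using c by (simp add: full_cells_def V_def)
    then obtain x d where x: "x \<in> cells (level X 0) 0" and d: "d \<in> cells (level X 1) 1"
      "act (level X 1) 0 1 (\<lambda>_. 0) d = ?s 0 x" "act (level X 1) 0 1 (\<lambda>_. 1) d = c" by (auto simp: degenerate_def)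
    \<comment> \<open>The path witnessing degeneracy of \<open>c\<close>, viewed as a vertex of the
      path space, is a point of the homotopy fibre over \<open>c\<close>.\<close>
    let ?g = "untranspose point (\<lambda>n z. act (level X 1) n 1 ((!) (snd z)) d)"
    have gm: "simplicial_map (sset_prod point interval) (level X 1) (\<lambda>n z. act (level X 1) n 1 ((!) (snd z)) d)"
      using sm_comp[OF sm_snd yoneda_map[OF bs_level[OF bisimp] d(1)]] .
    have p0: "const_cell 0 0 \<in> cells point 0" by (simp only: cells_point)
    have g: "?g 0 (const_cell 0 0) \<in> cells (path_space (level X 1)) 0"
      by (rule sm_closed[OF untranspose_map[OF gm simplicial_set_std bs_level[OF bisimp]] p0])
    have eg: "path_ev 0 (?g 0 (const_cell 0 0)) (const_cell i 0) = act (level X 1) 0 1 (\<lambda>_. i) d" if "i \<le> 1" for i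
      unfolding path_ev_untranspose[OF simplicial_set_std p0 const_cell_cells[OF that]]
      by (simp only: snd_conv, rule ss_eq[OF bs_level[OF bisimp] std_deltaD[OF const_cell_cells[OF that]] d(1)]) simp
    have "(x, ?g 0 (const_cell 0 0), const_cell 0 0) \<in> cells (hofibre (level X 0) (level X 1) ?s c) 0"
      unfolding hofibre_def cells_hpb point_map_def
      using eg[of 0] eg[of 1] d x g p0 \<open>act (level X 1) 0 0 (\<lambda>_. 0) c = c\<close> by simp
    then show ?thesis unfolding empty_sset_def by blast
  qed
  let ?P = "hpullback (level X 0) (restr (level X 1) ?D) (level X 1) ?s (\<lambda>n x. x)"
  have iD: "simplicial_map (restr (level X 1) ?D) (level X 1) (\<lambda>n x. x)"
    by (rule sm_sub[OF _ D]) (rule smI, auto)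
  have P: "simplicial_set ?P"
    by (rule simplicial_set_hpb[OF bs_level[OF bisimp] ss_sub[OF bs_level[OF bisimp] D] bs_level[OF bisimp] s iD])
  have ew: "simplicial_map L (restr (level X 1) ?D) (\<lambda>n l. ?e n (w n l))"
    unfolding full_sub_eq[symmetric]
    by (rule sm_full_sub[OF sm_comp[OF w e] L]) (use dgw sm_closed[OF e sm_closed[OF w]] in \<open>auto simp: V_def\<close>)
  \<comment> \<open>Lifting against the empty subcomplex amounts to lifting maps out of
    \<open>L\<close>; applied to the first edges of \<open>w\<close>, it chooses the paths to
    \<open>s\<^sub>0\<close> coherently.\<close>
  have "lifts ?P (restr (level X 1) ?D) (\<lambda>n x. snd (snd x)) L (\<lambda>_. {})"
    by (rule lifts_mono[OF mono_lifts[OF kan_level kan_level mono D ne] L subsset_empty P])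
  then obtain r where r: "simplicial_map L ?P r" "\<And>n l. l \<in> cells L n \<Longrightarrow> snd (snd (r n l)) = ?e n (w n l)"
    using liftsD[of ?P "restr (level X 1) ?D" "\<lambda>n x. snd (snd x)" L "\<lambda>_. {}" undefined "\<lambda>n l. ?e n (w n l)"] ew
    by (auto simp: simplicial_map_def)
  let ?Q = "hpullback (level X 0) (level X (Suc m)) (level X 1) ?s ?e"
  have rends: "path_ev n (fst (snd (r n l))) (const_cell 0 n) = ?s n (fst (r n l))"
     "path_ev n (fst (snd (r n l))) (const_cell 1 n) = ?e n (w n l)" if "l \<in> cells L n" for n l
    using sm_closed[OF r(1) that] r(2)[OF that]
    by (cases "r n l", simp add: cells_hpb del: replicate_Suc)+
  have k: "simplicial_map L ?Q (\<lambda>n l. (fst (r n l), fst (snd (r n l)), w n l))"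
    by (rule hpb_map[OF sm_comp[OF r(1) sm_hpb1] sm_comp[OF r(1) sm_hpb2] w]) (use rends in auto)
  have "generic_map 1 0 (\<lambda>_. 0)" "free_map 1 (Suc m) (\<lambda>i. i)"
    using de by (auto simp: generic_map_def free_map_def delta_map_const)
  with ds delta_pushout_edge have "pullback_square (level X m) (level X 0) (level X (Suc m)) (level X 1)
      (hact X 0 m (\<lambda>_. 0)) (hact X (Suc m) m (\<lambda>i. i - 1)) ?s ?e"
    unfolding decomposition_space_def by blast
  \<comment> \<open>\<open>K\<close> starts at the comparison map applied after \<open>g\<close> and
    ends at the identity. Its last component is the required homotopy in
    \<open>X\<^sub>m\<^sub>+\<^sub>1\<close>.\<close>
  then obtain g K where g: "simplicial_map ?Q (level X m) g" and K: "simplicial_map (sset_prod ?Q interval) ?Q K"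
    and K0: "\<forall>n. \<forall>x\<in>cells ?Q n. K n (x, const_cell 0 n) = ((\<lambda>n x. (hact X 0 m (\<lambda>_. 0) n x,
        const_path (level X 1) n (?s n (hact X 0 m (\<lambda>_. 0) n x)), hact X (Suc m) m (\<lambda>i. i - 1) n x)) n \<circ> g n) x
      \<and> K n (x, const_cell 1 n) = id x"
    unfolding pullback_square_def equivalence_def homotopic_def by blast
  from K0 have K1: "\<And>n x. x \<in> cells ?Q n \<Longrightarrow> snd (snd (K n (x, const_cell 0 n))) = hact X (Suc m) m (\<lambda>i. i - 1) n (g n x)"
    "\<And>n x. x \<in> cells ?Q n \<Longrightarrow> K n (x, const_cell 1 n) = x"
    by (simp_all del: replicate_Suc)
  let ?k = "\<lambda>n l. (fst (r n l), fst (snd (r n l)), w n l)"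
  show thesis
  proof (rule that)
    show "simplicial_map L (level X m) (\<lambda>n l. g n (?k n l))" by (rule sm_comp[OF k g])
    have "simplicial_map (sset_prod L interval) (sset_prod ?Q interval) (\<lambda>n x. (?k n (fst x), snd x))"
      by (rule sm_pair[OF sm_comp[OF sm_fst k] sm_snd])
    from sm_comp[OF sm_comp[OF this K] sm_hpb3]
    show "simplicial_map (sset_prod L interval) (level X (Suc m)) (\<lambda>n x. snd (snd (K n (?k n (fst x), snd x))))" .
  qed (use K1 sm_closed[OF k] in \<open>simp_all del: replicate_Suc\<close>)
qed

section \<open>Bisimplicial lifting problems\<close>

definition transposed :: "'a sspace \<Rightarrow> 'a sspace" where
  "transposed Z = \<lparr>level = row Z, hact = (\<lambda>m n \<theta> p. act (level Z p) m n \<theta>)\<rparr>"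

lemma level_transposed [simp]: "level (transposed Z) = row Z"
  and hact_transposed [simp]: "hact (transposed Z) m n \<theta> p = act (level Z p) m n \<theta>"
  by (simp_all add: transposed_def)

lemma row_transposed [simp]: "row (transposed Z) n = level Z n"
  by (rule sset.equality) (simp_all add: row_def)

lemma transposed_transposed [simp]: "transposed (transposed Z) = Z"
  by (rule sspace.equality) (auto simp: fun_eq_iff)

lemma bisimplicial_transposed:
  assumes "bisimplicial Z" shows "bisimplicial (transposed Z)"
  unfolding bisimplicial_def
proof (intro conjI allI impI)
  fix m n \<theta> assume d: "delta_map m n \<theta>"
  show "simplicial_map (level (transposed Z) n) (level (transposed Z) m) (hact (transposed Z) m n \<theta>)"
    by (rule smI) (use ss_closed[OF bs_level[OF assms] d] bs_nat[OF assms _ d] in auto)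
qed (use bs_level[OF assms] bs_row[OF assms] in auto)

text \<open>
  A \<open>bimap\<close> is a map of bisimplicial sets from the external product of \<open>S\<close> and \<open>L\<close>.  The predicate
  \<open>blifts Z p S L K\<close> says that maps on the union of \<open>\<Delta>[p] \<times> K\<close> and \<open>S \<times> L\<close> extend to \<open>\<Delta>[p] \<times> L\<close>.
\<close>

definition bimap :: "'a sspace \<Rightarrow> 's sset \<Rightarrow> 'l sset \<Rightarrow> (nat \<Rightarrow> nat \<Rightarrow> 's \<Rightarrow> 'l \<Rightarrow> 'a) \<Rightarrow> bool" where
  "bimap Z S L b \<longleftrightarrow>
     (\<forall>m n s l. s \<in> cells S m \<longrightarrow> l \<in> cells L n \<longrightarrow> b m n s l \<in> cells (level Z m) n) \<and>
     (\<forall>m' m n \<theta> s l. s \<in> cells S m \<longrightarrow> l \<in> cells L n \<longrightarrow> delta_map m' m \<theta> \<longrightarrow>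
        b m' n (act S m' m \<theta> s) l = hact Z m' m \<theta> n (b m n s l)) \<and>
     (\<forall>m n' n \<theta> s l. s \<in> cells S m \<longrightarrow> l \<in> cells L n \<longrightarrow> delta_map n' n \<theta> \<longrightarrow>
        b m n' s (act L n' n \<theta> l) = act (level Z m) n' n \<theta> (b m n s l))"

lemma bimapI:
  "(\<And>m n s l. s \<in> cells S m \<Longrightarrow> l \<in> cells L n \<Longrightarrow> b m n s l \<in> cells (level Z m) n) \<Longrightarrow>
   (\<And>m' m n \<theta> s l. s \<in> cells S m \<Longrightarrow> l \<in> cells L n \<Longrightarrow> delta_map m' m \<theta> \<Longrightarrow>
        b m' n (act S m' m \<theta> s) l = hact Z m' m \<theta> n (b m n s l)) \<Longrightarrow>
   (\<And>m n' n \<theta> s l. s \<in> cells S m \<Longrightarrow> l \<in> cells L n \<Longrightarrow> delta_map n' n \<theta> \<Longrightarrow>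
        b m n' s (act L n' n \<theta> l) = act (level Z m) n' n \<theta> (b m n s l)) \<Longrightarrow> bimap Z S L b"
  unfolding bimap_def by blast

lemma bimapD:
  assumes "bimap Z S L b" "s \<in> cells S m" "l \<in> cells L n"
  shows "b m n s l \<in> cells (level Z m) n"
    "delta_map m' m \<theta> \<Longrightarrow> b m' n (act S m' m \<theta> s) l = hact Z m' m \<theta> n (b m n s l)"
    "delta_map n' n \<theta> \<Longrightarrow> b m n' s (act L n' n \<theta> l) = act (level Z m) n' n \<theta> (b m n s l)"
  using assms unfolding bimap_def by blast+

definition blifts :: "'a sspace \<Rightarrow> nat \<Rightarrow> (nat \<Rightarrow> nat list set) \<Rightarrow> 'l sset \<Rightarrow> (nat \<Rightarrow> 'l set) \<Rightarrow> bool" where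
  "blifts Z p S L K \<longleftrightarrow>
     (\<forall>f b. simplicial_map (restr L K) (level Z p) f \<and> bimap Z (restr (std_simplex p) S) L b \<and>
       (\<forall>m n s k. s \<in> S m \<longrightarrow> k \<in> K n \<longrightarrow> hact Z m p ((!) s) n (f n k) = b m n s k) \<longrightarrow>
       (\<exists>h. simplicial_map L (level Z p) h \<and> (\<forall>n. \<forall>k\<in>K n. h n k = f n k) \<and>
         (\<forall>m n s l. s \<in> S m \<longrightarrow> l \<in> cells L n \<longrightarrow> hact Z m p ((!) s) n (h n l) = b m n s l)))"

lemma bliftsI:
  assumes "\<And>f b. simplicial_map (restr L K) (level Z p) f \<Longrightarrow> bimap Z (restr (std_simplex p) S) L b \<Longrightarrow>
       (\<And>m n s k. s \<in> S m \<Longrightarrow> k \<in> K n \<Longrightarrow> hact Z m p ((!) s) n (f n k) = b m n s k) \<Longrightarrow>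
       \<exists>h. simplicial_map L (level Z p) h \<and> (\<forall>n. \<forall>k\<in>K n. h n k = f n k) \<and>
         (\<forall>m n s l. s \<in> S m \<longrightarrow> l \<in> cells L n \<longrightarrow> hact Z m p ((!) s) n (h n l) = b m n s l)"
  shows "blifts Z p S L K"
  using assms unfolding blifts_def by blast

lemma bliftsD:
  assumes "blifts Z p S L K" "simplicial_map (restr L K) (level Z p) f" "bimap Z (restr (std_simplex p) S) L b"
    "\<And>m n s k. s \<in> S m \<Longrightarrow> k \<in> K n \<Longrightarrow> hact Z m p ((!) s) n (f n k) = b m n s k"
  obtains h where "simplicial_map L (level Z p) h" "\<And>n k. k\<in>K n \<Longrightarrow> h n k = f n k"
    "\<And>m n s l. s \<in> S m \<Longrightarrow> l \<in> cells L n \<Longrightarrow> hact Z m p ((!) s) n (h n l) = b m n s l"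
proof -
  have "simplicial_map (restr L K) (level Z p) f \<and> bimap Z (restr (std_simplex p) S) L b \<and>
       (\<forall>m n s k. s \<in> S m \<longrightarrow> k \<in> K n \<longrightarrow> hact Z m p ((!) s) n (f n k) = b m n s k)"
    using assms(2-4) by blast
  from assms(1)[unfolded blifts_def, rule_format, OF this] show thesis using that by blast
qed

text \<open>Extends \<open>matching_map\<close> from the boundary to an arbitrary subcomplex
  \<open>S\<close> of the simplex.\<close>

definition restriction :: "'a sspace \<Rightarrow> nat \<Rightarrow> (nat \<Rightarrow> nat list set) \<Rightarrow> nat \<Rightarrow> 'a \<Rightarrow> (nat \<Rightarrow> nat list \<Rightarrow> 'a)" where
  "restriction Z p S n x = (\<lambda>m. restrict (\<lambda>s. hact Z m p ((!) s) n x) (S m))"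

lemma cells_map_space: "\<phi> \<in> cells (map_space K X) p \<longleftrightarrow> simplicial_map K (row X p) \<phi> \<and> (\<forall>n. \<phi> n \<in> extensional (cells K n))"
  by (simp add: map_space_def sset_hom_def)

lemma act_map_space: "act (map_space K X) p q \<theta> \<phi> n = restrict (\<lambda>k. act (level X n) p q \<theta> (\<phi> n k)) (cells K n)"
  by (simp add: map_space_def)

lemma simplicial_set_map_space:
  assumes bisimp: "bisimplicial X" and K: "simplicial_set K"
  shows "simplicial_set (map_space K X)"
proof -
  let ?M = "map_space K X"
  have B: "\<phi> m k \<in> cells (level X m) q" if "\<phi> \<in> cells ?M q" "k \<in> cells K m" for \<phi> m k q
    using sm_closed[of K "row X q" \<phi> k m] that by (simp add: cells_map_space)
  have cl: "act ?M q p \<theta> \<phi> \<in> cells ?M q" if "\<phi> \<in> cells ?M p" and d: "delta_map q p \<theta>" for \<phi> p q \<theta>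
    unfolding cells_map_space
  proof (intro conjI allI smI)
    have ph: "simplicial_map K (row X p) \<phi>" using that by (simp add: cells_map_space)
    fix m k assume k: "k \<in> cells K m"
    then show "act ?M q p \<theta> \<phi> m k \<in> cells (row X q) m"
      using ss_closed[OF bs_level[OF bisimp] d B[OF that(1)]] by (simp add: act_map_space)
    fix m' \<psi> assume d': "delta_map m' m \<psi>"
    have "\<phi> m' (act K m' m \<psi> k) = hact X m' m \<psi> p (\<phi> m k)" using sm_nat[OF ph k d'] by simp
    then show "act ?M q p \<theta> \<phi> m' (act K m' m \<psi> k) = act (row X q) m' m \<psi> (act ?M q p \<theta> \<phi> m k)"
      using k ss_closed[OF K d', of k] bs_nat[OF bisimp d' d B[OF that(1)], of k] by (simp add: act_map_space)
  qed (simp add: act_map_space)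
  show ?thesis unfolding simplicial_set_def
  proof (intro conjI allI ballI impI)
    fix q p \<theta> assume "delta_map q p \<theta>"
    then show "act ?M q p \<theta> \<in> cells ?M p \<rightarrow> cells ?M q" using cl by blast
  next
    fix q p \<theta> \<phi> x assume x: "x \<in> cells ?M p" and d: "delta_map q p \<theta> \<and> delta_map q p \<phi> \<and> delta_eq q \<theta> \<phi>"
    show "act ?M q p \<theta> x = act ?M q p \<phi> x"
    proof
      fix m show "act ?M q p \<theta> x m = act ?M q p \<phi> x m"
        unfolding act_map_space
        by (rule restrict_ext, rule ss_eq[OF bs_level[OF bisimp]]) (use d B[OF x] in \<open>auto simp: delta_eq_def\<close>)
    qed
  next
    fix p x assume x: "x \<in> cells ?M p"
    show "act ?M p p id x = x"
    proof
      fix m show "act ?M p p id x m = x m"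
        unfolding act_map_space
        by (rule extensionalityI[of _ "cells K m"])
          (use x ss_id[OF bs_level[OF bisimp] B[OF x]] in \<open>auto simp: cells_map_space\<close>)
    qed
  next
    fix l m p \<theta> \<phi> x assume x: "x \<in> cells ?M p" and d: "delta_map l m \<phi> \<and> delta_map m p \<theta>"
    show "act ?M l p (\<theta> \<circ> \<phi>) x = act ?M l m \<phi> (act ?M m p \<theta> x)"
    proof
      fix r show "act ?M l p (\<theta> \<circ> \<phi>) x r = act ?M l m \<phi> (act ?M m p \<theta> x) r"
        unfolding act_map_space
        by (rule restrict_ext) (use d ss_comp[OF bs_level[OF bisimp] _ _ B[OF x]] in auto)
    qed
  qed
qed

text \<open>A bimap out of \<open>S\<close> and \<open>L\<close> is the same as a map from
  \<open>L\<close> to the mapping space out of \<open>S\<close>. Through this adjunction the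
  one-variable lemmas such as \<open>lifts_mono\<close> and \<open>cone_lifts\<close> become
  available for \<open>blifts\<close>.\<close>

lemma blifts_iff_lifts:
  assumes Z: "bisimplicial Z" and S: "subsset (std_simplex p) S" and L: "simplicial_set L" and K: "subsset L K"
  shows "lifts (level Z p) (map_space (restr (std_simplex p) S) Z) (restriction Z p S) L K \<longleftrightarrow> blifts Z p S L K"
proof
  let ?S = "restr (std_simplex p) S"
  assume l: "lifts (level Z p) (map_space ?S Z) (restriction Z p S) L K"
  show "blifts Z p S L K"
  proof (rule bliftsI)
    fix f b assume f: "simplicial_map (restr L K) (level Z p) f" and b: "bimap Z ?S L b"
      and c: "\<And>m n s k. s \<in> S m \<Longrightarrow> k \<in> K n \<Longrightarrow> hact Z m p ((!) s) n (f n k) = b m n s k"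
    note bD = bimapD[OF b, simplified]
    have sS: "s \<in> S m \<Longrightarrow> delta_map m' m \<theta> \<Longrightarrow> act (std_simplex p) m' m \<theta> s \<in> S m'" for s m m' \<theta>
      using subsset_act[OF S] by blast
    define b' where "b' n l = (\<lambda>m. restrict (\<lambda>s. b m n s l) (S m))" for n l
    have b': "simplicial_map L (map_space ?S Z) b'"
    proof (rule smI)
      fix n l assume l: "l \<in> cells L n"
      show "b' n l \<in> cells (map_space ?S Z) n"
        unfolding cells_map_space
        by (intro conjI smI allI) (use l bD sS in \<open>auto simp: b'_def\<close>)
    next
      fix n' n \<theta> l assume l: "l \<in> cells L n" and d: "delta_map n' n \<theta>"
      show "b' n' (act L n' n \<theta> l) = act (map_space ?S Z) n' n \<theta> (b' n l)"
      proof
        fix m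
        show "b' n' (act L n' n \<theta> l) m = act (map_space ?S Z) n' n \<theta> (b' n l) m"
          unfolding act_map_space b'_def using bD(3)[OF _ l d] by (auto simp: restrict_def fun_eq_iff)
      qed
    qed
    have cc: "restriction Z p S n (f n k) = b' n k" if "k \<in> K n" for n k
      unfolding restriction_def b'_def using c that by (intro ext restrict_ext) auto
    obtain h where h: "simplicial_map L (level Z p) h" "\<And>n k. k\<in>K n \<Longrightarrow> h n k = f n k"
      "\<And>n l. l \<in> cells L n \<Longrightarrow> restriction Z p S n (h n l) = b' n l"
      using liftsD[OF l f b' cc] by blast
    have "hact Z m p ((!) s) n (h n l) = b m n s l" if "s \<in> S m" "l \<in> cells L n" for m n s l
      using fun_cong[OF fun_cong[OF h(3)[OF that(2)], of m], of s] that(1) by (simp add: restriction_def b'_def)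
    then show "\<exists>h. simplicial_map L (level Z p) h \<and> (\<forall>n. \<forall>k\<in>K n. h n k = f n k) \<and>
         (\<forall>m n s l. s \<in> S m \<longrightarrow> l \<in> cells L n \<longrightarrow> hact Z m p ((!) s) n (h n l) = b m n s l)"
      using h by blast
  qed
next
  let ?S = "restr (std_simplex p) S"
  assume l: "blifts Z p S L K"
  show "lifts (level Z p) (map_space ?S Z) (restriction Z p S) L K"
  proof (rule liftsI)
    fix f b' assume f: "simplicial_map (restr L K) (level Z p) f" and b': "simplicial_map L (map_space ?S Z) b'"
      and c: "\<And>n k. k \<in> K n \<Longrightarrow> restriction Z p S n (f n k) = b' n k"
    have hom: "simplicial_map ?S (row Z n) (b' n l)" "b' n l m \<in> extensional (S m)" if "l \<in> cells L n" for n l m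
      using sm_closed[OF b' that] by (auto simp: cells_map_space)
    define b where "b m n s l = b' n l m s" for m n s l
    have b: "bimap Z ?S L b"
    proof (rule bimapI)
      fix m n s l assume "s \<in> cells ?S m" "l \<in> cells L n"
      then show "b m n s l \<in> cells (level Z m) n" using sm_closed[OF hom(1)] by (auto simp: b_def)
    next
      fix m' m n \<theta> s l assume "s \<in> cells ?S m" "l \<in> cells L n" "delta_map m' m \<theta>"
      then show "b m' n (act ?S m' m \<theta> s) l = hact Z m' m \<theta> n (b m n s l)"
        using sm_nat[OF hom(1)] by (auto simp: b_def)
    next
      fix m n' n \<theta> s l assume "s \<in> cells ?S m" "l \<in> cells L n" "delta_map n' n \<theta>"
      then show "b m n' s (act L n' n \<theta> l) = act (level Z m) n' n \<theta> (b m n s l)"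
        using sm_nat[OF b'] by (auto simp: b_def act_map_space)
    qed
    have cc: "hact Z m p ((!) s) n (f n k) = b m n s k" if "s \<in> S m" "k \<in> K n" for m n s k
      using fun_cong[OF fun_cong[OF c[OF that(2)], of m], of s] that(1) by (simp add: restriction_def b_def)
    obtain h where h: "simplicial_map L (level Z p) h" "\<And>n k. k\<in>K n \<Longrightarrow> h n k = f n k"
      "\<And>m n s l. s \<in> S m \<Longrightarrow> l \<in> cells L n \<Longrightarrow> hact Z m p ((!) s) n (h n l) = b m n s l"
      using bliftsD[OF l f b cc] by blast
    have "restriction Z p S n (h n l) = b' n l" if "l \<in> cells L n" for n l
    proof
      fix m
      show "restriction Z p S n (h n l) m = b' n l m"
        by (rule extensionalityI[OF _ hom(2)[OF that]]) (use h(3) that in \<open>auto simp: restriction_def b_def\<close>)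
    qed
    then show "\<exists>h. simplicial_map L (level Z p) h \<and> (\<forall>n. \<forall>x\<in>K n. h n x = f n x) \<and>
      (\<forall>n. \<forall>x\<in>cells L n. restriction Z p S n (h n x) = b' n x)" using h by blast
  qed
qed

text \<open>A bimap out of two simplices is a single bisimplicial cell, by the Yoneda lemma in
  either variable. The lifting problem for two inclusions into simplices is therefore symmetric in
  the two inclusions.\<close>

lemma blifts_exchange:
  assumes X: "bisimplicial X" and K: "subsset (std_simplex n) K" and S: "subsset (std_simplex p) S"
    and l: "blifts X n K (std_simplex p) S"
  shows "blifts (transposed X) p S (std_simplex n) K"
proof (rule bliftsI)
  fix f b assume f: "simplicial_map (restr (std_simplex n) K) (level (transposed X) p) f"
    and b: "bimap (transposed X) (restr (std_simplex p) S) (std_simplex n) b"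
    and c: "\<And>m j s k. s \<in> S m \<Longrightarrow> k \<in> K j \<Longrightarrow> hact (transposed X) m p ((!) s) j (f j k) = b m j s k"
  note bD = bimapD[OF b, simplified]
  have Kc: "k \<in> cells (std_simplex n) j" if "k \<in> K j" for k j using subsset_in[OF K that] .
  have Sc: "s \<in> cells (std_simplex p) j" if "s \<in> S j" for s j using subsset_in[OF S that] .
  have fc: "f j k \<in> cells (level X j) p" if "k \<in> K j" for j k using sm_closed[OF f, of k j] that by simp
  have fn: "f i (act (std_simplex n) i j \<theta> k) = hact X i j \<theta> p (f j k)" if "k \<in> K j" "delta_map i j \<theta>" for i j k \<theta>
    using sm_nat[OF f _ that(2), of k] that by simp
  define F where "F m s = b m n s [0..<Suc n]" for m s
  have F: "simplicial_map (restr (std_simplex p) S) (level X n) F"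
    by (rule smI) (use bD std_id in \<open>auto simp: F_def simp del: upt_Suc\<close>)
  define e where "e j m k s = act (level X j) m p ((!) s) (f j k)" for j m k s
  have e: "bimap X (restr (std_simplex n) K) (std_simplex p) e"
  proof (rule bimapI)
    fix j m k s assume "k \<in> cells (restr (std_simplex n) K) j" "s \<in> cells (std_simplex p) m"
    then show "e j m k s \<in> cells (level X j) m"
      unfolding e_def using ss_closed[OF bs_level[OF X] std_deltaD fc] by simp
  next
    fix i j m \<theta> k s assume "k \<in> cells (restr (std_simplex n) K) j" "s \<in> cells (std_simplex p) m" "delta_map i j \<theta>"
    then show "e i m (act (restr (std_simplex n) K) i j \<theta> k) s = hact X i j \<theta> m (e j m k s)"
      unfolding e_def using fn bs_nat[OF X _ std_deltaD fc] by simp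
  next
    fix j m' m \<theta> k s assume "k \<in> cells (restr (std_simplex n) K) j" "s \<in> cells (std_simplex p) m" "delta_map m' m \<theta>"
    then show "e j m' k (act (std_simplex p) m' m \<theta> s) = act (level X j) m' m \<theta> (e j m k s)"
      unfolding e_def using act_act_std[OF bs_level[OF X] fc] by simp
  qed
  have ce: "hact X j n ((!) k) m (F m s) = e j m k s" if k: "k \<in> K j" and s: "s \<in> S m" for j m k s
  proof -
    have "hact X j n ((!) k) m (F m s) = b m j s (act (std_simplex n) j n ((!) k) [0..<Suc n])"
      unfolding F_def using bD(3)[OF s std_id std_deltaD[OF Kc[OF k]]] by simp
    then show ?thesis using std_act_id[OF Kc[OF k]] c[OF s k] by (simp add: e_def del: upt_Suc)
  qed
  obtain G where G: "simplicial_map (std_simplex p) (level X n) G" "\<And>m s. s \<in> S m \<Longrightarrow> G m s = F m s"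
    "\<And>j m k s. k \<in> K j \<Longrightarrow> s \<in> cells (std_simplex p) m \<Longrightarrow> hact X j n ((!) k) m (G m s) = e j m k s"
    using bliftsD[OF l F e ce] by blast
  \<comment> \<open>The cell that represents the extension \<open>G\<close>; the solution
    \<open>?h\<close> reads the same cell in the other variable.\<close>
  let ?y = "G p [0..<Suc p]"
  have y: "?y \<in> cells (level X n) p" by (rule sm_closed[OF G(1) std_id])
  let ?h = "\<lambda>j k. hact X j n ((!) k) p ?y"
  have h: "simplicial_map (std_simplex n) (level (transposed X) p) ?h"
    using yoneda_map[OF bs_row[OF X, of p], of ?y n] y by simp
  have "?h j k = f j k" if k: "k \<in> K j" for j k
    using G(3)[OF k std_id] ss_id[OF bs_level[OF X] fc[OF k], of "(!) [0..<Suc p]"]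
    by (simp add: e_def nth_append less_Suc_eq)
  moreover have "act (level X j) m p ((!) s) (?h j k) = b m j s k"
    if s: "s \<in> S m" and k: "k \<in> cells (std_simplex n) j" for m j s k
  proof -
    have "act (level X j) m p ((!) s) (?h j k) = hact X j n ((!) k) m (act (level X n) m p ((!) s) ?y)"
      by (rule bs_nat[OF X std_deltaD[OF k] std_deltaD[OF Sc[OF s]] y, symmetric])
    also have "act (level X n) m p ((!) s) ?y = b m n s [0..<Suc n]"
      using yoneda_eq[OF G(1) Sc[OF s]] G(2)[OF s] by (simp add: F_def del: upt_Suc)
    also have "hact X j n ((!) k) m (b m n s [0..<Suc n]) = b m j s k"
      using bD(3)[OF s std_id std_deltaD[OF k]] std_act_id[OF k] by (simp del: upt_Suc)
    finally show ?thesis .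
  qed
  ultimately show "\<exists>h. simplicial_map (std_simplex n) (level (transposed X) p) h \<and> (\<forall>j. \<forall>k\<in>K j. h j k = f j k) \<and>
         (\<forall>m j s k. s \<in> S m \<longrightarrow> k \<in> cells (std_simplex n) j \<longrightarrow> hact (transposed X) m p ((!) s) j (h j k) = b m j s k)"
    using h by (intro exI[of _ ?h]) simp
qed

lemma subsset_const_cell: "i \<le> n \<Longrightarrow> subsset (std_simplex n) (\<lambda>m. {const_cell i m})"
  by (rule subssetI) (simp_all add: const_cell_cells act_const_cell del: replicate_Suc)

text \<open>A bimap out of a vertex and \<open>L\<close> is determined by its component in degree 0,
  a map from \<open>L\<close> to the level 0. What remains is a lifting problem for evaluation at
  vertex 0.\<close>

lemma blifts_vertex:
  assumes Z: "bisimplicial Z" and L: "simplicial_set L" and K: "subsset L K"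
  shows "blifts Z n (\<lambda>m. {const_cell 0 m}) L K \<longleftrightarrow> lifts (level Z n) (level Z 0) (hact Z 0 n (\<lambda>_. 0)) L K"
proof
  assume l: "blifts Z n (\<lambda>m. {const_cell 0 m}) L K"
  show "lifts (level Z n) (level Z 0) (hact Z 0 n (\<lambda>_. 0)) L K"
  proof (rule liftsI)
    fix f b assume f: "simplicial_map (restr L K) (level Z n) f" and b: "simplicial_map L (level Z 0) b"
      and c: "\<And>j x. x \<in> K j \<Longrightarrow> hact Z 0 n (\<lambda>_. 0) j (f j x) = b j x"
    have fc: "f j k \<in> cells (level Z n) j" if "k \<in> K j" for j k using sm_closed[OF f, of k j] that by simp
    define e where "e m j s l = hact Z m 0 (\<lambda>_. 0) j (b j l)" for m j and s :: "nat list" and l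
    have e: "bimap Z (restr (std_simplex n) (\<lambda>m. {const_cell 0 m})) L e"
    proof (rule bimapI)
      fix m j s l assume "l \<in> cells L j"
      then show "e m j s l \<in> cells (level Z m) j"
        unfolding e_def by (intro bs_closed[OF Z delta_map_const] sm_closed[OF b]) auto
    next
      fix m' m j \<theta> s l assume "l \<in> cells L j" "delta_map m' m \<theta>"
      then show "e m' j (act (restr (std_simplex n) (\<lambda>m. {const_cell 0 m})) m' m \<theta> s) l = hact Z m' m \<theta> j (e m j s l)"
        unfolding e_def by (intro bs_comp[OF Z _ delta_map_const sm_closed[OF b], symmetric]) auto
    next
      fix m j' j \<theta> s l assume "l \<in> cells L j" "delta_map j' j \<theta>"
      then show "e m j' s (act L j' j \<theta> l) = act (level Z m) j' j \<theta> (e m j s l)"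
        unfolding e_def using bs_nat[OF Z delta_map_const _ sm_closed[OF b]] sm_nat[OF b] by simp
    qed
    obtain h where h: "simplicial_map L (level Z n) h" "\<And>j k. k\<in>K j \<Longrightarrow> h j k = f j k"
      "\<And>m j s l. s \<in> {const_cell 0 m} \<Longrightarrow> l \<in> cells L j \<Longrightarrow> hact Z m n ((!) s) j (h j l) = e m j s l"
    proof (rule bliftsD[OF l f e])
      fix m j s k assume s: "s \<in> {const_cell 0 m}" and k: "k \<in> K j"
      have "hact Z m 0 (\<lambda>_. 0) j (hact Z 0 n (\<lambda>_. 0) j (f j k)) = hact Z m n ((!) s) j (f j k)"
        by (rule bs_comp[OF Z delta_map_const delta_map_const fc[OF k]])
          (use s in \<open>auto simp: less_Suc_eq_le simp del: replicate_Suc\<close>)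
      then show "hact Z m n ((!) s) j (f j k) = e m j s k" using c[OF k] by (simp add: e_def)
    qed blast
    have "hact Z 0 n (\<lambda>_. 0) j (h j l) = b j l" if l: "l \<in> cells L j" for j l
    proof -
      have "hact Z 0 n (\<lambda>_. 0) j (h j l) = hact Z 0 n ((!) (const_cell 0 0)) j (h j l)"
        by (rule bs_eq[OF Z delta_map_const sm_closed[OF h(1) l]]) auto
      also have "\<dots> = b j l" using h(3)[of "const_cell 0 0" 0 l j] l bs_id[OF Z sm_closed[OF b l]] by (simp add: e_def)
      finally show ?thesis .
    qed
    then show "\<exists>h. simplicial_map L (level Z n) h \<and> (\<forall>j. \<forall>x\<in>K j. h j x = f j x) \<and>
        (\<forall>j. \<forall>x\<in>cells L j. hact Z 0 n (\<lambda>_. 0) j (h j x) = b j x)" using h by blast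
  qed
next
  assume l: "lifts (level Z n) (level Z 0) (hact Z 0 n (\<lambda>_. 0)) L K"
  show "blifts Z n (\<lambda>m. {const_cell 0 m}) L K"
  proof (rule bliftsI)
    fix f e assume f: "simplicial_map (restr L K) (level Z n) f" and e: "bimap Z (restr (std_simplex n) (\<lambda>m. {const_cell 0 m})) L e"
      and c: "\<And>m j s k. s \<in> {const_cell 0 m} \<Longrightarrow> k \<in> K j \<Longrightarrow> hact Z m n ((!) s) j (f j k) = e m j s k"
    have fc: "f j k \<in> cells (level Z n) j" if "k \<in> K j" for j k using sm_closed[OF f, of k j] that by simp
    have s0: "const_cell 0 m \<in> cells (restr (std_simplex n) (\<lambda>m. {const_cell 0 m})) m" for m by simp
    have b: "simplicial_map L (level Z 0) (\<lambda>j l. e 0 j (const_cell 0 0) l)"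
      by (rule smI) (use bimapD[OF e s0] in blast)+
    obtain h where h: "simplicial_map L (level Z n) h" "\<And>j k. k\<in>K j \<Longrightarrow> h j k = f j k"
      "\<And>j l. l \<in> cells L j \<Longrightarrow> hact Z 0 n (\<lambda>_. 0) j (h j l) = e 0 j (const_cell 0 0) l"
    proof (rule liftsD[OF l f b])
      fix j k assume k: "k \<in> K j"
      have "hact Z 0 n (\<lambda>_. 0) j (f j k) = hact Z 0 n ((!) (const_cell 0 0)) j (f j k)"
        by (rule bs_eq[OF Z delta_map_const fc[OF k]]) auto
      then show "hact Z 0 n (\<lambda>_. 0) j (f j k) = e 0 j (const_cell 0 0) k" using c[of "const_cell 0 0" 0 k j] k by simp
    qed blast
    have "hact Z m n ((!) s) j (h j l) = e m j s l" if s: "s \<in> {const_cell 0 m}" and l: "l \<in> cells L j" for m j s l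
    proof -
      have "hact Z m n ((!) s) j (h j l) = hact Z m 0 (\<lambda>_. 0) j (hact Z 0 n (\<lambda>_. 0) j (h j l))"
        by (rule bs_comp[OF Z delta_map_const delta_map_const sm_closed[OF h(1) l], symmetric])
          (use s in \<open>auto simp: less_Suc_eq_le simp del: replicate_Suc\<close>)
      also have "\<dots> = e m j (act (std_simplex n) m 0 (\<lambda>_. 0) (const_cell 0 0)) l"
        using bimapD(2)[OF e s0[of 0] l delta_map_const[of 0 0 m]] h(3)[OF l] by simp
      also have "act (std_simplex n) m 0 (\<lambda>_. 0) (const_cell 0 0) = s"
        using act_const_cell[OF delta_map_const[of 0 0 m]] s by (simp del: replicate_Suc)
      finally show ?thesis .
    qed
    then show "\<exists>h. simplicial_map L (level Z n) h \<and> (\<forall>j. \<forall>k\<in>K j. h j k = f j k) \<and>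
         (\<forall>m j s l. s \<in> {const_cell 0 m} \<longrightarrow> l \<in> cells L j \<longrightarrow> hact Z m n ((!) s) j (h j l) = e m j s l)"
      using h by blast
  qed
qed

section \<open>The totally degenerate part\<close>

text \<open>All edges are tested, not only the principal ones, so that the condition is visibly
  stable under every simplicial operator.\<close>

definition degenerate_vertices :: "'a sspace \<Rightarrow> nat \<Rightarrow> 'a set" where
  "degenerate_vertices X n = {x \<in> cells (level X n) 0. \<forall>\<theta>. delta_map 1 n \<theta> \<longrightarrow> degenerate X (hact X 1 n \<theta> 0 x)}"

definition degenerate_part :: "'a sspace \<Rightarrow> 'a sspace" where
  "degenerate_part X = \<lparr>level = (\<lambda>n. full_sub (level X n) (degenerate_vertices X n)), hact = hact X\<rparr>"

lemma level_degenerate_part: "level (degenerate_part X) n = full_sub (level X n) (degenerate_vertices X n)"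
  and hact_degenerate_part [simp]: "hact (degenerate_part X) = hact X"
  by (simp_all add: degenerate_part_def)

lemma act_degenerate_part [simp]: "act (level (degenerate_part X) n) = act (level X n)"
  by (simp add: level_degenerate_part full_sub_eq)

lemma cells_degenerate_part: "x \<in> cells (level (degenerate_part X) n) p \<longleftrightarrow>
    x \<in> cells (level X n) p \<and> (\<forall>i\<le>p. act (level X n) 0 p (\<lambda>_. i) x \<in> degenerate_vertices X n)"
  by (simp add: level_degenerate_part full_sub_eq full_cells_def)

context
  fixes X :: "'a sspace"
  assumes X: "complete_decomposition_space X"
begin

lemma simp_space: "simplicial_space X"
  using X by (simp add: complete_decomposition_space_def decomposition_space_def)

lemmas bisimp = simplicial_space_bs[OF simp_space]

lemma kan_level: "kan_complex (level X n)"
  using simp_space by (simp add: simplicial_space_def)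

section \<open>Stability of the degenerate part under operators and homotopies\<close>

lemma degenerate_vertices_act:
  assumes "x \<in> degenerate_vertices X n" "delta_map m n \<theta>"
  shows "hact X m n \<theta> 0 x \<in> degenerate_vertices X m"
proof -
  have x: "x \<in> cells (level X n) 0" using assms by (simp add: degenerate_vertices_def)
  have "degenerate X (hact X 1 m \<phi> 0 (hact X m n \<theta> 0 x))" if "delta_map 1 m \<phi>" for \<phi>
    using bs_comp[OF bisimp that assms(2) x, of "\<theta> \<circ> \<phi>"] delta_map_comp[OF that assms(2)] assms(1) by (simp add: degenerate_vertices_def)
  then show ?thesis using bs_closed[OF bisimp assms(2) x] by (simp add: degenerate_vertices_def)
qed

lemma degenerate_vertices_path:
  assumes e: "e \<in> cells (level X n) 1"
  shows "act (level X n) 0 1 (\<lambda>_. 0) e \<in> degenerate_vertices X n \<longleftrightarrow> act (level X n) 0 1 (\<lambda>_. 1) e \<in> degenerate_vertices X n"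
proof -
  have "degenerate X (hact X 1 n \<theta> 0 (act (level X n) 0 1 (\<lambda>_. 0) e)) \<longleftrightarrow> degenerate X (hact X 1 n \<theta> 0 (act (level X n) 0 1 (\<lambda>_. 1) e))"
    if d: "delta_map 1 n \<theta>" for \<theta>
    using degenerate_path[OF kan_level bs_closed[OF bisimp d e]] bs_nat[OF bisimp d delta_map_const e] by simp
  then show ?thesis
    using ss_closed[OF bs_level[OF bisimp] delta_map_const e] by (auto simp: degenerate_vertices_def)
qed

text \<open>Restricted to a fixed vertex \<open>l\<close>, the homotopy is a path in
  \<open>X\<^sub>n\<close>, namely the image of the edge \<open>?i\<close> from
  \<open>(l, 0)\<close> to \<open>(l, 1)\<close>, and total degeneracy is constant along
  paths.\<close>

lemma degenerate_vertices_homotopy: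
  assumes H: "simplicial_map (sset_prod L interval) (level X n) H" and L: "simplicial_set L"
    and e: "\<epsilon> \<le> 1" "\<epsilon>' \<le> 1" and l: "l \<in> cells L 0" and d: "H 0 (l, const_cell \<epsilon> 0) \<in> degenerate_vertices X n"
  shows "H 0 (l, const_cell \<epsilon>' 0) \<in> degenerate_vertices X n"
proof -
  let ?i = "(act L 1 0 (\<lambda>_. 0) l, [0..<Suc 1])"
  have i: "?i \<in> cells (sset_prod L interval) 1"
    using ss_closed[OF L delta_map_const l] std_id[of 1] by (simp del: upt_Suc)
  have "act (sset_prod L interval) 0 1 (\<lambda>_. j) ?i = (l, const_cell j 0)" if "j \<le> 1" for j
  proof -
    have "act L 0 1 (\<lambda>_. j) (act L 1 0 (\<lambda>_. 0) l) = act L 0 0 (\<lambda>_. 0) l"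
      by (rule ss_comp'[OF L delta_map_const[OF that] delta_map_const l]) simp_all
    also have "\<dots> = l" by (rule ss_id[OF L l]) simp
    finally show ?thesis using that by (simp add: act_std less_Suc_eq_le del: upt_Suc)
      (simp add: less_Suc_eq_le)
  qed
  then have "act (level X n) 0 1 (\<lambda>_. j) (H 1 ?i) = H 0 (l, const_cell j 0)" if "j \<le> 1" for j
    using sm_nat[OF H i delta_map_const[OF that]] that by metis
  then have "H 0 (l, const_cell 0 0) \<in> degenerate_vertices X n \<longleftrightarrow> H 0 (l, const_cell 1 0) \<in> degenerate_vertices X n"
    using degenerate_vertices_path[OF sm_closed[OF H i]] by simp
  then show ?thesis using d e by (cases \<epsilon>; cases \<epsilon>') (auto simp: One_nat_def)
qed

lemma bisimplicial_degenerate_part: "bisimplicial (degenerate_part X)"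
proof -
  have hc: "hact X m n \<theta> p x \<in> cells (level (degenerate_part X) m) p"
    if d: "delta_map m n \<theta>" and x: "x \<in> cells (level (degenerate_part X) n) p" for m n \<theta> p x
  proof -
    have x': "x \<in> cells (level X n) p" using x by (simp add: cells_degenerate_part)
    show ?thesis unfolding cells_degenerate_part
    proof (intro conjI allI impI bs_closed[OF bisimp d x'])
      fix i assume "i \<le> p"
      then show "act (level X m) 0 p (\<lambda>_. i) (hact X m n \<theta> p x) \<in> degenerate_vertices X m"
        using degenerate_vertices_act[OF _ d, of "act (level X n) 0 p (\<lambda>_. i) x"] x
          bs_nat[OF bisimp d delta_map_const x', of i 0] by (simp add: cells_degenerate_part)
    qed
  qed
  show ?thesis unfolding bisimplicial_def
  proof (intro conjI allI impI)
    fix n show "simplicial_set (level (degenerate_part X) n)"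
      unfolding level_degenerate_part full_sub_eq by (rule ss_sub[OF bs_level[OF bisimp] subsset_full_cells[OF bs_level[OF bisimp]]])
  next
    fix p
    have "row (degenerate_part X) p = restr (row X p) (\<lambda>n. cells (level (degenerate_part X) n) p)"
      by (rule sset.equality) (simp_all add: row_def)
    moreover have "subsset (row X p) (\<lambda>n. cells (level (degenerate_part X) n) p)"
      by (rule subssetI) (use hc in \<open>auto simp: cells_degenerate_part\<close>)
    ultimately show "simplicial_set (row (degenerate_part X) p)" using ss_sub[OF bs_row[OF bisimp]] by simp
  next
    fix m n \<theta> assume d: "delta_map m n \<theta>"
    show "simplicial_map (level (degenerate_part X) n) (level (degenerate_part X) m) (hact (degenerate_part X) m n \<theta>)"
      by (rule smI) (use hc[OF d] bs_nat[OF bisimp d] in \<open>auto simp: cells_degenerate_part\<close>)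
  qed
qed

lemma dpart_incl: "simplicial_map L (level (degenerate_part X) n) f \<Longrightarrow> simplicial_map L (level X n) f"
  unfolding simplicial_map_def by (auto simp: cells_degenerate_part Pi_iff)

lemma dpart_map:
  assumes f: "simplicial_map L (level X n) f" and L: "simplicial_set L" and V: "\<And>l. l \<in> cells L 0 \<Longrightarrow> f 0 l \<in> degenerate_vertices X n"
  shows "simplicial_map L (level (degenerate_part X) n) f"
  unfolding level_degenerate_part by (rule sm_full_sub[OF f L V])

lemma dpart_cell0: "x \<in> cells (level (degenerate_part X) n) 0 \<longleftrightarrow> x \<in> degenerate_vertices X n"
proof
  assume "x \<in> cells (level (degenerate_part X) n) 0"
  then show "x \<in> degenerate_vertices X n" using ss_id[OF bs_level[OF bisimp], of x n 0 "\<lambda>_. 0"] by (auto simp: cells_degenerate_part)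
next
  assume "x \<in> degenerate_vertices X n"
  then show "x \<in> cells (level (degenerate_part X) n) 0"
    using ss_id[OF bs_level[OF bisimp], of x n 0 "\<lambda>_. 0"] by (auto simp: cells_degenerate_part degenerate_vertices_def)
qed

lemma degenerate_part_0: "level (degenerate_part X) 0 = level X 0"
proof -
  have "x \<in> degenerate_vertices X 0" if x: "x \<in> cells (level X 0) 0" for x
  proof -
    have "hact X 1 0 \<theta> 0 x = hact X 1 0 (\<lambda>_. 0) 0 x" if "delta_map 1 0 \<theta>" for \<theta>
      by (rule bs_eq[OF bisimp that x]) (use that in \<open>auto simp: delta_map_def\<close>)
    then show ?thesis using degenerate_s0[OF bisimp x] x by (simp add: degenerate_vertices_def)
  qed
  then have "full_cells (level X 0) (degenerate_vertices X 0) = cells (level X 0)"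
    using ss_closed[OF bs_level[OF bisimp] delta_map_const] by (fastforce simp: full_cells_def)
  then show ?thesis unfolding level_degenerate_part full_sub_eq by simp
qed

text \<open>Reedy fibrancy of \<open>X\<close> provides a filler in \<open>X\<^sub>n\<close>. The
  horn contains the vertex \<open>j\<close>, every vertex of the simplex is joined to
  \<open>j\<close> by an edge, and total degeneracy is invariant along edges, so the filler stays in
  the degenerate part.\<close>

lemma dpart_reedy:
  assumes j: "j \<le> Suc p"
  shows "blifts (degenerate_part X) n (boundary n) (std_simplex (Suc p)) (horn_cells (Suc p) j)"
proof -
  let ?M = "map_space (restr (std_simplex n) (boundary n)) X"
  have mm: "restriction X n (boundary n) = matching_map X n"
    by (intro ext) (simp add: restriction_def matching_map_def simplex_boundary_eq)
  have "kan_fibration (level X n) ?M (restriction X n (boundary n))"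
    unfolding mm using simp_space by (simp add: simplicial_space_def simplex_boundary_eq)
  moreover have "simplicial_set ?M"
    by (rule simplicial_set_map_space[OF bisimp ss_sub[OF simplicial_set_std subsset_boundary]])
  ultimately have "lifts (level X n) ?M (restriction X n (boundary n)) (std_simplex (Suc p)) (horn_cells (Suc p) j)"
    using kan_lifts[OF _ bs_level[OF bisimp] _ j] by blast
  then have bl: "blifts X n (boundary n) (std_simplex (Suc p)) (horn_cells (Suc p) j)"
    using blifts_iff_lifts[OF bisimp subsset_boundary simplicial_set_std subsset_horn_cells] by blast
  show ?thesis
  proof (rule bliftsI)
    fix f b
    assume f: "simplicial_map (restr (std_simplex (Suc p)) (horn_cells (Suc p) j)) (level (degenerate_part X) n) f"
      and b: "bimap (degenerate_part X) (restr (std_simplex n) (boundary n)) (std_simplex (Suc p)) b"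
      and c: "\<And>m i s k. s \<in> boundary n m \<Longrightarrow> k \<in> horn_cells (Suc p) j i \<Longrightarrow> hact (degenerate_part X) m n ((!) s) i (f i k) = b m i s k"
    have b': "bimap X (restr (std_simplex n) (boundary n)) (std_simplex (Suc p)) b"
      using b unfolding bimap_def by (auto simp: cells_degenerate_part)
    obtain h where h: "simplicial_map (std_simplex (Suc p)) (level X n) h"
      "\<And>i k. k\<in>horn_cells (Suc p) j i \<Longrightarrow> h i k = f i k"
      "\<And>m i s l. s \<in> boundary n m \<Longrightarrow> l \<in> cells (std_simplex (Suc p)) i \<Longrightarrow> hact X m n ((!) s) i (h i l) = b m i s l"
      using bliftsD[OF bl dpart_incl[OF f] b'] c by auto
    have hj: "const_cell j 0 \<in> horn_cells (Suc p) j 0"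
    proof -
      have "\<exists>u\<le>Suc p. u \<noteq> j" by (cases j) auto
      then show ?thesis using const_cell_cells[OF j, of 0] by (auto simp: horn_cells_def)
    qed
    have "h 0 (const_cell j 0) \<in> degenerate_vertices X n"
      using h(2)[OF hj] sm_closed[OF f, of "const_cell j 0" 0] hj dpart_cell0 by simp
    moreover have "h 0 l \<in> degenerate_vertices X n \<longleftrightarrow> h 0 (const_cell j 0) \<in> degenerate_vertices X n" if l: "l \<in> cells (std_simplex (Suc p)) 0" for l
    proof -
      let ?v = "l ! 0"
      have lv: "l = const_cell ?v 0" using const_cell_iff[OF l, of ?v] by simp
      have v: "?v \<le> Suc p" using l by (simp add: cells_std)
      have key: "h 0 (const_cell x 0) \<in> degenerate_vertices X n \<longleftrightarrow> h 0 (const_cell y 0) \<in> degenerate_vertices X n" if "x \<le> y" "y \<le> Suc p" for x y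
      proof -
        have e: "[x, y] \<in> cells (std_simplex (Suc p)) 1"
          using that by (auto simp: std_simplex_def cells_nerve One_nat_def)
        have "act (std_simplex (Suc p)) 0 1 (\<lambda>_. i) [x, y] = const_cell ([x, y] ! i) 0" for i
          by (simp add: act_std)
        then have "act (level X n) 0 1 (\<lambda>_. i) (h 1 [x, y]) = h 0 (const_cell ([x, y] ! i) 0)" if "i \<le> 1" for i
          using sm_nat[OF h(1) e delta_map_const[OF that]] by metis
        from this[of 0] this[of 1] show ?thesis using degenerate_vertices_path[OF sm_closed[OF h(1) e]] by simp
      qed
      show ?thesis using key[of ?v j] key[of j ?v] v j lv by (metis nat_le_linear)
    qed
    ultimately have "simplicial_map (std_simplex (Suc p)) (level (degenerate_part X) n) h"
      by (intro dpart_map[OF h(1) simplicial_set_std]) blast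
    then show "\<exists>h. simplicial_map (std_simplex (Suc p)) (level (degenerate_part X) n) h \<and> (\<forall>i. \<forall>k\<in>horn_cells (Suc p) j i. h i k = f i k) \<and>
         (\<forall>m i s l. s \<in> boundary n m \<longrightarrow> l \<in> cells (std_simplex (Suc p)) i \<longrightarrow> hact (degenerate_part X) m n ((!) s) i (h i l) = b m i s l)"
      using h by auto
  qed
qed

text \<open>Once the horn occupies the first variable, \<open>lifts_mono\<close> replaces boundaries
  by arbitrary inclusions in the second. This is the statement that restriction from
  \<open>L\<close> to \<open>K\<close> is a fibration of mapping spaces into the degenerate
  part.\<close>

lemma dpart_fib:
  assumes j: "j \<le> Suc p" and L: "simplicial_set L" and K: "subsset L K"
  shows "blifts (transposed (degenerate_part X)) (Suc p) (horn_cells (Suc p) j) L K"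
proof -
  note bT = bisimplicial_transposed[OF bisimplicial_degenerate_part]
  have "lifts (level (transposed (degenerate_part X)) (Suc p)) (map_space (restr (std_simplex (Suc p)) (horn_cells (Suc p) j)) (transposed (degenerate_part X)))
      (restriction (transposed (degenerate_part X)) (Suc p) (horn_cells (Suc p) j)) (std_simplex n) (boundary n)" for n
    using blifts_exchange[OF bisimplicial_degenerate_part subsset_boundary subsset_horn_cells dpart_reedy[OF j]]
      blifts_iff_lifts[OF bT subsset_horn_cells simplicial_set_std subsset_boundary] by blast
  from lifts_mono[OF this L K bs_level[OF bT]] show ?thesis
    using blifts_iff_lifts[OF bT subsset_horn_cells L K] by blast
qed

text \<open>Evaluation at vertex 0 is restriction along the inclusion of that vertex in
  \<open>std_simplex n\<close>. So this is an instance of \<open>dpart_fib\<close>, with the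
  directions exchanged back.\<close>

lemma dpart_vertex_hornlift: "hornlift (level (degenerate_part X) n) (level (degenerate_part X) 0) (hact X 0 n (\<lambda>_. 0))"
  unfolding hornlift_def
proof (intro allI impI)
  fix p j assume j: "j \<le> Suc p"
  have s0: "subsset (std_simplex n) (\<lambda>m. {const_cell 0 m})" by (rule subsset_const_cell) simp
  have "blifts (transposed (transposed (degenerate_part X))) n (\<lambda>m. {const_cell 0 m}) (std_simplex (Suc p)) (horn_cells (Suc p) j)"
    by (rule blifts_exchange[OF bisimplicial_transposed[OF bisimplicial_degenerate_part] subsset_horn_cells s0 dpart_fib[OF j simplicial_set_std s0]])
  then show "lifts (level (degenerate_part X) n) (level (degenerate_part X) 0) (hact X 0 n (\<lambda>_. 0)) (std_simplex (Suc p)) (horn_cells (Suc p) j)"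
    using blifts_vertex[OF bisimplicial_degenerate_part simplicial_set_std subsset_horn_cells] by simp
qed

text \<open>
  Every sphere in \<open>degenerate_part X\<close> is homotopic to a degenerate one, and fillability of a sphere over a given
  simplex of \<open>X\<^sub>0\<close> is invariant under homotopy.
\<close>

lemma dpart_vertex_lifts:
  "lifts (level (degenerate_part X) n) (level (degenerate_part X) 0) (hact X 0 n (\<lambda>_. 0)) (std_simplex p) (boundary p)"
proof (induction n)
  case 0
  show ?case
  proof (rule liftsI)
    fix f b assume f: "simplicial_map (restr (std_simplex p) (boundary p)) (level (degenerate_part X) 0) f"
      and b: "simplicial_map (std_simplex p) (level (degenerate_part X) 0) b"
      and c: "\<And>n x. x \<in> boundary p n \<Longrightarrow> hact X 0 0 (\<lambda>_. 0) n (f n x) = b n x"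
    have i: "hact X 0 0 (\<lambda>_. 0) n x = x" if "x \<in> cells (level (degenerate_part X) 0) n" for n x
      using bs_id[OF bisimplicial_degenerate_part that] by simp
    have "f n x = b n x" if "x \<in> boundary p n" for n x
      using i[OF sm_closed[OF f, of x n]] c[OF that] that by simp
    then show "\<exists>h. simplicial_map (std_simplex p) (level (degenerate_part X) 0) h \<and> (\<forall>n. \<forall>x\<in>boundary p n. h n x = f n x) \<and>
        (\<forall>n. \<forall>x\<in>cells (std_simplex p) n. hact X 0 0 (\<lambda>_. 0) n (h n x) = b n x)"
      using b i[OF sm_closed[OF b]] by (intro exI[of _ b]) simp
  qed
next
  case (Suc m)
  let ?Y = "level (degenerate_part X)" and ?\<Delta> = "std_simplex p" and ?s = "hact X (Suc m) m (\<lambda>i. i - 1)"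
  let ?v = "\<lambda>n. hact X 0 n (\<lambda>_. 0)"
  show ?case
  proof (rule liftsI)
    fix f b assume f: "simplicial_map (restr ?\<Delta> (boundary p)) (?Y (Suc m)) f"
      and b: "simplicial_map ?\<Delta> (?Y 0) b" and c: "\<And>n x. x \<in> boundary p n \<Longrightarrow> ?v (Suc m) n (f n x) = b n x"
    let ?L = "restr ?\<Delta> (boundary p)"
    have L: "simplicial_set ?L" by (rule ss_sub[OF simplicial_set_std subsset_boundary])
    have ds: "delta_map (Suc m) m (\<lambda>i. i - 1)" by (rule delta_mapI) auto
    have dS: "delta_map m (Suc m) Suc" by (rule delta_mapI) auto
    have I0: "const_cell 0 n \<in> cells interval n" and interval: "const_cell 1 n \<in> cells interval n" for n by (simp_all add: const_cell_cells del: replicate_Suc)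
    have f0: "f 0 l \<in> degenerate_vertices X (Suc m)" if "l \<in> cells ?L 0" for l
      using sm_closed[OF f that] dpart_cell0 by simp
    have "degenerate X (hact X 1 (Suc m) (\<lambda>i. i) 0 (f 0 l))" if "l \<in> cells ?L 0" for l
    proof -
      have "delta_map 1 (Suc m) (\<lambda>i. i)" by (rule delta_mapI) auto
      then show ?thesis using f0[OF that] by (simp add: degenerate_vertices_def)
    qed
    \<comment> \<open>The homotopy \<open>H\<close> runs from the degenerate sphere on
      \<open>v\<close>, at parameter 0, to the given sphere \<open>f\<close>, at parameter
      1.\<close>
    then obtain v H where v: "simplicial_map ?L (level X m) v" and H: "simplicial_map (sset_prod ?L interval) (level X (Suc m)) H"
      "\<And>n l. l \<in> cells ?L n \<Longrightarrow> H n (l, const_cell 0 n) = ?s n (v n l)"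
      "\<And>n l. l \<in> cells ?L n \<Longrightarrow> H n (l, const_cell 1 n) = f n l"
      using split_degenerate[OF X L dpart_incl[OF f]] by blast
    have H1: "H 0 (l, const_cell 1 0) \<in> degenerate_vertices X (Suc m)" if "l \<in> cells ?L 0" for l using H(3)[OF that] f0[OF that] by simp
    have HY: "simplicial_map (sset_prod ?L interval) (?Y (Suc m)) H"
    proof (rule dpart_map[OF H(1) simplicial_set_prod[OF L simplicial_set_std]])
      fix x assume "x \<in> cells (sset_prod ?L interval) 0"
      then obtain l t where x: "x = (l, t)" "l \<in> cells ?L 0" "t \<in> cells interval 0" by auto
      have "t = const_cell (t ! 0) 0" "t ! 0 \<le> 1" using const_cell_iff[OF x(3), of "t ! 0"] x(3) by (auto simp: cells_std)
      then show "H 0 x \<in> degenerate_vertices X (Suc m)" using degenerate_vertices_homotopy[OF H(1) L _ _ x(2) H1[OF x(2)], of "t ! 0"] x(1) by simp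
    qed
    \<comment> \<open>The operator \<open>Suc\<close> is a section of the collapse, so
      \<open>v\<close> is recovered as a face of the degenerate sphere and inherits its degenerate
      edges.\<close>
    have vY: "simplicial_map ?L (?Y m) v"
    proof (rule dpart_map[OF v L])
      fix l assume l: "l \<in> cells ?L 0"
      have "?s 0 (v 0 l) \<in> degenerate_vertices X (Suc m)"
        using degenerate_vertices_homotopy[OF H(1) L _ _ l H1[OF l], of 0] H(2)[OF l] by simp
      from degenerate_vertices_act[OF this dS] show "v 0 l \<in> degenerate_vertices X m"
        using bs_comp[OF bisimp dS ds sm_closed[OF v l], of "\<lambda>i. i"] bs_id[OF bisimp sm_closed[OF v l], of "\<lambda>i. i"] by simp
    qed
    have vm: "simplicial_map (?Y n) (?Y 0) (?v n)" for n
      using bs_hact[OF bisimplicial_degenerate_part delta_map_const[of 0 n 0]] by simp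
    have sY: "simplicial_map (?Y m) (?Y (Suc m)) ?s" using bs_hact[OF bisimplicial_degenerate_part ds] by simp
    have vs: "?v (Suc m) n (?s n y) = ?v m n y" if "y \<in> cells (?Y m) n" for n y
      using bs_comp[OF bisimplicial_degenerate_part delta_map_const[of 0 "Suc m" 0] ds that, of "\<lambda>_. 0"] by simp
    have h0: "hornlift (?Y 0) point to_point" unfolding degenerate_part_0 by (rule kan_complex_hornlift[OF kan_level])
    \<comment> \<open>The base values of \<open>H\<close> move as well. They are extended backwards
      from \<open>b\<close>, at parameter 1, to a homotopy on the whole simplex.\<close>
    obtain \<Gamma> where G: "simplicial_map (sset_prod ?\<Delta> interval) (?Y 0) \<Gamma>"
       "\<And>n l. l\<in>cells ?\<Delta> n \<Longrightarrow> \<Gamma> n (l, const_cell 1 n) = b n l"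
       "\<And>n l t. l\<in>boundary p n \<Longrightarrow> t\<in>cells interval n \<Longrightarrow> \<Gamma> n (l, t) = ?v (Suc m) n (H n (l, t))"
    proof (rule homotopy_lifts_point[OF h0 bs_level[OF bisimplicial_degenerate_part] simplicial_set_std subsset_boundary order_refl b sm_comp[OF HY vm]])
      fix n l assume "l \<in> boundary p n"
      then show "?v (Suc m) n (H n (l, const_cell 1 n)) = b n l" using H(3)[of l n] c by simp
    qed blast
    have i0: "simplicial_map ?\<Delta> (sset_prod ?\<Delta> interval) (\<lambda>n s. (s, const_cell 0 n))"
      by (rule smI) (use I0 act_const_cell in \<open>auto simp del: replicate_Suc\<close>)
    have i1: "simplicial_map ?\<Delta> (sset_prod ?\<Delta> interval) (\<lambda>n s. (s, const_cell 1 n))"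
      by (rule smI) (use interval act_const_cell in \<open>auto simp del: replicate_Suc\<close>)
    \<comment> \<open>The induction hypothesis fills \<open>v\<close> over the start of \<Gamma>,
      one level lower.\<close>
    obtain V where V: "simplicial_map ?\<Delta> (?Y m) V" "\<And>n l. l \<in> boundary p n \<Longrightarrow> V n l = v n l"
      "\<And>n l. l \<in> cells ?\<Delta> n \<Longrightarrow> ?v m n (V n l) = \<Gamma> n (l, const_cell 0 n)"
    proof (rule liftsD[OF Suc.IH vY sm_comp[OF i0 G(1)]])
      fix n l assume l: "l \<in> boundary p n"
      then show "?v m n (v n l) = \<Gamma> n (l, const_cell 0 n)"
        using G(3)[OF l I0] H(2)[of l n] vs[OF sm_closed[OF vY, of l n]] by simp
    qed blast
    \<comment> \<open>The degeneracy of \<open>V\<close> fills the degenerate sphere. The fibration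
      property carries this filler along \<open>H\<close> and \<Gamma> to parameter 1, where it
      fills \<open>f\<close> over \<open>b\<close>.\<close>
    obtain W where W: "simplicial_map (sset_prod ?\<Delta> interval) (?Y (Suc m)) W"
       "\<And>n l t. l\<in>boundary p n \<Longrightarrow> t\<in>cells interval n \<Longrightarrow> W n (l, t) = H n (l, t)"
       "\<And>n l t. l\<in>cells ?\<Delta> n \<Longrightarrow> t\<in>cells interval n \<Longrightarrow> ?v (Suc m) n (W n (l, t)) = \<Gamma> n (l, t)"
    proof (rule homotopy_liftsD[OF homotopy_lifts_hornlift[OF dpart_vertex_hornlift vm bs_level[OF bisimplicial_degenerate_part] bs_level[OF bisimplicial_degenerate_part]
          simplicial_set_std subsset_boundary, of 0 "Suc m"] sm_comp[OF V(1) sY] HY G(1)])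
      fix n l assume l: "l \<in> boundary p n"
      then show "H n (l, const_cell 0 n) = ?s n (V n l)" using H(2)[of l n] V(2)[OF l] by simp
    next
      fix n l assume l: "l \<in> cells ?\<Delta> n"
      then show "?v (Suc m) n (?s n (V n l)) = \<Gamma> n (l, const_cell 0 n)" using vs[OF sm_closed[OF V(1) l]] V(3)[OF l] by simp
    qed (use G(3) in auto)
    from sm_comp[OF i1 W(1)] show "\<exists>h. simplicial_map ?\<Delta> (?Y (Suc m)) h \<and> (\<forall>n. \<forall>x\<in>boundary p n. h n x = f n x) \<and>
        (\<forall>n. \<forall>x\<in>cells ?\<Delta> n. ?v (Suc m) n (h n x) = b n x)"
      using W(2)[OF _ interval] W(3)[OF _ interval] H(3) G(2) by (intro exI[of _ "\<lambda>n s. W n (s, const_cell 1 n)"]) (simp del: replicate_Suc)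
  qed
qed

text \<open>The content of \<open>dpart_vertex_lifts\<close>, read in the direction in which cells
  of \<open>walking_iso\<close> are attached.\<close>

lemma dpart_root_lifts: "blifts (transposed (degenerate_part X)) p (boundary p) (std_simplex n) (\<lambda>m. {const_cell 0 m})"
proof -
  have s0: "subsset (std_simplex n) (\<lambda>m. {const_cell 0 m})" by (rule subsset_const_cell) simp
  have "blifts (degenerate_part X) n (\<lambda>m. {const_cell 0 m}) (std_simplex p) (boundary p)"
    using blifts_vertex[OF bisimplicial_degenerate_part simplicial_set_std subsset_boundary] dpart_vertex_lifts by simp
  from blifts_exchange[OF bisimplicial_degenerate_part s0 subsset_boundary this] show ?thesis .
qed

end

section \<open>Outer horns\<close>

lemma std_sub_simplex: "s \<in> cells (std_simplex (Suc p)) m \<Longrightarrow> Suc p \<notin> set s \<Longrightarrow> s \<in> cells (std_simplex p) m"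
  by (auto simp: std_simplex_def cells_nerve le_Suc_eq)

text \<open>
  Of the two solutions \<open>x\<close> (rel \<open>A\<close>) and the prescribed \<open>f\<close> on \<open>B\<close>, the former is moved to the latter along
  a \<open>(p+1)\<close>-simplex whose last two faces are \<open>x\<close> and \<open>f\<close> and whose other faces are degenerate.
\<close>

lemma blifts_cancel:
  assumes Z: "bisimplicial Z" and L: "simplicial_set L" and A: "subsset L A" and B: "subsset L B" and AB: "\<And>n. A n \<subseteq> B n"
    and 1: "\<And>p. blifts Z p (boundary p) L A" and 2: "\<And>p. blifts Z p (boundary p) (restr L B) A"
    and 3: "\<And>p. blifts Z (Suc p) (horn_cells (Suc p) (Suc p)) L B"
  shows "blifts Z p (boundary p) L B"
proof (rule bliftsI)
  fix f b assume f: "simplicial_map (restr L B) (level Z p) f" and b: "bimap Z (restr (std_simplex p) (boundary p)) L b"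
    and c: "\<And>m n s k. s \<in> boundary p m \<Longrightarrow> k \<in> B n \<Longrightarrow> hact Z m p ((!) s) n (f n k) = b m n s k"
  have Ls: "restr (restr L B) A = restr L A" by simp
  have fA: "simplicial_map (restr L A) (level Z p) f"
    unfolding Ls[symmetric] by (rule sm_sub[OF f]) (use A AB in \<open>auto simp: subsset_def\<close>)
  have fc: "f n l \<in> cells (level Z p) n" if "l \<in> B n" for n l using sm_closed[OF f, of l n] that by simp
  obtain x where x: "simplicial_map L (level Z p) x" "\<And>n k. k \<in> A n \<Longrightarrow> x n k = f n k"
    "\<And>m n s l. s \<in> boundary p m \<Longrightarrow> l \<in> cells L n \<Longrightarrow> hact Z m p ((!) s) n (x n l) = b m n s l"
  proof (rule bliftsD[OF 1 fA b])
    fix m n s k assume "s \<in> boundary p m" "k \<in> A n"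
    then show "hact Z m p ((!) s) n (f n k) = b m n s k" using c AB by blast
  qed blast
  define \<sigma> where "\<sigma> i = min i p" for i :: nat
  have d\<sigma>: "delta_map (Suc p) p \<sigma>" by (rule delta_mapI) (auto simp: \<sigma>_def)
  have d\<sigma>s: "delta_map m p (\<lambda>i. \<sigma> (s ! i))" if "s \<in> cells (std_simplex (Suc p)) m" for m s
    using delta_map_comp[OF std_deltaD[OF that] d\<sigma>] by (simp add: comp_def)
  have \<sigma>s: "\<sigma> (s ! i) = s ! i" if "s \<in> cells (std_simplex (Suc p)) m" "Suc p \<notin> set s" "i \<le> m" for m s i
    using std_sub_simplex[OF that(1,2)] that(3) by (simp add: cells_std \<sigma>_def)
  \<comment> \<open>Faces through the last vertex \<open>Suc p\<close> come from the degeneracy of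
    \<open>x\<close> that repeats the vertex \<open>p\<close>; the face opposite
    \<open>Suc p\<close> is \<open>f\<close>. The two prescriptions match because \<open>x\<close>
    and \<open>f\<close> agree on \<open>boundary p\<close>.\<close>
  define cc where "cc m n s l = (if Suc p \<in> set s then hact Z m p (\<lambda>i. \<sigma> (s ! i)) n (x n l) else hact Z m p ((!) s) n (f n l))"
    for m n and s :: "nat list" and l
  have bdc: "s \<in> boundary (Suc p) m \<Longrightarrow> s \<in> cells (std_simplex (Suc p)) m" for s m by (simp add: boundary_def)
  have Bc: "l \<in> B n \<Longrightarrow> l \<in> cells L n" for l n by (rule subsset_in[OF B])
  have cc: "bimap Z (restr (std_simplex (Suc p)) (boundary (Suc p))) (restr L B) cc"
  proof (rule bimapI)
    fix m n s l assume "s \<in> cells (restr (std_simplex (Suc p)) (boundary (Suc p))) m" "l \<in> cells (restr L B) n"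
    then have s: "s \<in> cells (std_simplex (Suc p)) m" and l: "l \<in> B n" by (auto dest: bdc)
    show "cc m n s l \<in> cells (level Z m) n"
      using bs_closed[OF Z d\<sigma>s[OF s] sm_closed[OF x(1) Bc[OF l]]]
        bs_closed[OF Z std_deltaD[OF std_sub_simplex[OF s]] fc[OF l]] by (auto simp: cc_def)
  next
    fix m' m n \<theta> s l assume "s \<in> cells (restr (std_simplex (Suc p)) (boundary (Suc p))) m" "l \<in> cells (restr L B) n"
      and d: "delta_map m' m \<theta>"
    then have sb: "s \<in> boundary (Suc p) m" and s: "s \<in> cells (std_simplex (Suc p)) m" and l: "l \<in> B n" by (auto dest: bdc)
    let ?s = "act (std_simplex (Suc p)) m' m \<theta> s"
    have s': "?s \<in> cells (std_simplex (Suc p)) m'" by (rule ss_closed[OF simplicial_set_std d s])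
    have sub: "set ?s \<subseteq> set s" by (rule act_std_set[OF s d])
    note xl = sm_closed[OF x(1) Bc[OF l]]
    have "cc m' n ?s l = hact Z m' m \<theta> n (cc m n s l)"
    proof (cases "Suc p \<in> set s")
      case False
      then have "Suc p \<notin> set ?s" using sub by blast
      moreover have "hact Z m' m \<theta> n (hact Z m p ((!) s) n (f n l)) = hact Z m' p ((!) ?s) n (f n l)"
        by (rule bs_comp[OF Z d std_deltaD[OF std_sub_simplex[OF s False]] fc[OF l]]) (simp add: nth_act_std)
      ultimately show ?thesis using False by (simp add: cc_def)
    next
      case True
      have e: "hact Z m' m \<theta> n (cc m n s l) = hact Z m' p (\<lambda>i. \<sigma> (?s ! i)) n (x n l)"
        unfolding cc_def using True bs_comp[OF Z d d\<sigma>s[OF s] xl, of "\<lambda>i. \<sigma> (?s ! i)"] by (simp add: nth_act_std)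
      show ?thesis
      proof (cases "Suc p \<in> set ?s")
        case True then show ?thesis using e by (simp add: cc_def)
      next
        case False
        have "\<exists>u. u \<le> p \<and> u \<notin> set ?s"
        proof -
          obtain u where "u \<le> Suc p" "u \<notin> set s" using sb std_set_le[OF s] by (auto simp: boundary_def)
          then show ?thesis using True sub by (metis le_SucE subsetD)
        qed
        then have "?s \<in> boundary p m'" using std_sub_simplex[OF s' False] by (auto simp: boundary_def)
        then have "hact Z m' p ((!) ?s) n (x n l) = hact Z m' p ((!) ?s) n (f n l)"
          using c[OF _ l] x(3)[OF _ Bc[OF l]] by simp
        moreover have "hact Z m' p (\<lambda>i. \<sigma> (?s ! i)) n (x n l) = hact Z m' p ((!) ?s) n (x n l)"
          by (rule bs_eq[OF Z d\<sigma>s[OF s'] xl \<sigma>s[OF s' False]])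
        ultimately show ?thesis using e False by (simp add: cc_def)
      qed
    qed
    then show "cc m' n (act (restr (std_simplex (Suc p)) (boundary (Suc p))) m' m \<theta> s) l = hact Z m' m \<theta> n (cc m n s l)"
      by simp
  next
    fix m n' n \<theta> s l assume "s \<in> cells (restr (std_simplex (Suc p)) (boundary (Suc p))) m" "l \<in> cells (restr L B) n"
      and d: "delta_map n' n \<theta>"
    then have s: "s \<in> cells (std_simplex (Suc p)) m" and l: "l \<in> B n" by (auto dest: bdc)
    have "f n' (act L n' n \<theta> l) = act (level Z p) n' n \<theta> (f n l)" using sm_nat[OF f _ d, of l] l by simp
    then show "cc m n' s (act (restr L B) n' n \<theta> l) = act (level Z m) n' n \<theta> (cc m n s l)"
      using bs_nat[OF Z d\<sigma>s[OF s] d sm_closed[OF x(1) Bc[OF l]]] sm_nat[OF x(1) Bc[OF l] d]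
        bs_nat[OF Z std_deltaD[OF std_sub_simplex[OF s]] d fc[OF l]] by (simp add: cc_def)
  qed
  have xs: "simplicial_map L (level Z (Suc p)) (\<lambda>n l. hact Z (Suc p) p \<sigma> n (x n l))"
    by (rule sm_comp[OF x(1) bs_hact[OF Z d\<sigma>]])
  have \<sigma>comp: "hact Z m (Suc p) ((!) s) n (hact Z (Suc p) p \<sigma> n y) = hact Z m p (\<lambda>i. \<sigma> (s ! i)) n y"
    if "s \<in> cells (std_simplex (Suc p)) m" "y \<in> cells (level Z p) n" for m n s y
    by (rule bs_comp[OF Z std_deltaD[OF that(1)] d\<sigma> that(2)]) simp
  have \<sigma>x: "hact Z m p (\<lambda>i. \<sigma> (s ! i)) n y = hact Z m p ((!) s) n y"
    if "s \<in> cells (std_simplex (Suc p)) m" "Suc p \<notin> set s" "y \<in> cells (level Z p) n" for m n s y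
    by (rule bs_eq[OF Z d\<sigma>s[OF that(1)] that(3) \<sigma>s[OF that(1,2)]])
  \<comment> \<open>Over \<open>A\<close> the maps \<open>x\<close> and \<open>f\<close> coincide,
    so there the degeneracy of \<open>x\<close> already has the prescribed faces; over
    \<open>B\<close> it is extended relative to \<open>A\<close>.\<close>
  obtain h where h: "simplicial_map (restr L B) (level Z (Suc p)) h"
    "\<And>m n s l. s \<in> boundary (Suc p) m \<Longrightarrow> l \<in> B n \<Longrightarrow> hact Z m (Suc p) ((!) s) n (h n l) = cc m n s l"
  proof (rule bliftsD[OF 2[of "Suc p"] _ cc])
    show "simplicial_map (restr (restr L B) A) (level Z (Suc p)) (\<lambda>n l. hact Z (Suc p) p \<sigma> n (x n l))"
      unfolding Ls by (rule sm_sub[OF xs A])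
    fix m n s k assume s: "s \<in> boundary (Suc p) m" and k: "k \<in> A n"
    have kB: "k \<in> B n" using k AB by blast
    show "hact Z m (Suc p) ((!) s) n (hact Z (Suc p) p \<sigma> n (x n k)) = cc m n s k"
      using \<sigma>comp[OF bdc[OF s] sm_closed[OF x(1) Bc[OF kB]]] \<sigma>x[OF bdc[OF s] _ fc[OF kB]] x(2)[OF k]
      by (auto simp: cc_def)
  qed auto
  \<comment> \<open>On all of \<open>L\<close>, every face except the one opposite
    \<open>Suc p\<close> is prescribed by the degeneracy of \<open>x\<close>; the omitted face is
    left free to move away from \<open>x\<close>.\<close>
  define e where "e m n s l = hact Z m p (\<lambda>i. \<sigma> (s ! i)) n (x n l)" for m n and s :: "nat list" and l
  have hnc: "s \<in> horn_cells (Suc p) (Suc p) m \<Longrightarrow> s \<in> cells (std_simplex (Suc p)) m" for s m by (simp add: horn_cells_def)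
  have e: "bimap Z (restr (std_simplex (Suc p)) (horn_cells (Suc p) (Suc p))) L e"
  proof (rule bimapI)
    fix m n s l assume "s \<in> cells (restr (std_simplex (Suc p)) (horn_cells (Suc p) (Suc p))) m" "l \<in> cells L n"
    then show "e m n s l \<in> cells (level Z m) n"
      unfolding e_def using bs_closed[OF Z d\<sigma>s sm_closed[OF x(1)]] by (auto dest: hnc)
  next
    fix m' m n \<theta> s l assume "s \<in> cells (restr (std_simplex (Suc p)) (horn_cells (Suc p) (Suc p))) m" "l \<in> cells L n"
      and d: "delta_map m' m \<theta>"
    then have s: "s \<in> cells (std_simplex (Suc p)) m" and l: "l \<in> cells L n" by (auto dest: hnc)
    show "e m' n (act (restr (std_simplex (Suc p)) (horn_cells (Suc p) (Suc p))) m' m \<theta> s) l = hact Z m' m \<theta> n (e m n s l)"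
      unfolding e_def by (rule bs_comp[OF Z d d\<sigma>s[OF s] sm_closed[OF x(1) l], symmetric]) (simp add: nth_act_std)
  next
    fix m n' n \<theta> s l assume "s \<in> cells (restr (std_simplex (Suc p)) (horn_cells (Suc p) (Suc p))) m" "l \<in> cells L n"
      and d: "delta_map n' n \<theta>"
    then have s: "s \<in> cells (std_simplex (Suc p)) m" and l: "l \<in> cells L n" by (auto dest: hnc)
    show "e m n' s (act L n' n \<theta> l) = act (level Z m) n' n \<theta> (e m n s l)"
      unfolding e_def using bs_nat[OF Z d\<sigma>s[OF s] d sm_closed[OF x(1) l]] sm_nat[OF x(1) l d] by simp
  qed
  obtain H where H: "simplicial_map L (level Z (Suc p)) H" "\<And>n k. k \<in> B n \<Longrightarrow> H n k = h n k"
    "\<And>m n s l. s \<in> horn_cells (Suc p) (Suc p) m \<Longrightarrow> l \<in> cells L n \<Longrightarrow> hact Z m (Suc p) ((!) s) n (H n l) = e m n s l"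
  proof (rule bliftsD[OF 3 h(1) e])
    fix m n s k assume s: "s \<in> horn_cells (Suc p) (Suc p) m" and k: "k \<in> B n"
    obtain u where u: "u \<le> p" "\<And>r. r \<le> m \<Longrightarrow> s ! r \<noteq> u" using s horn_cells_iff[OF hnc[OF s]] by (metis le_SucE)
    have sb: "s \<in> boundary (Suc p) m" unfolding boundary_iff[OF hnc[OF s]] using u le_SucI by blast
    have "cc m n s k = e m n s k"
    proof (cases "Suc p \<in> set s")
      case False
      then have "s \<in> boundary p m" using boundary_iff[OF std_sub_simplex[OF hnc[OF s]]] u by blast
      then have "hact Z m p ((!) s) n (f n k) = hact Z m p ((!) s) n (x n k)" using c[OF _ k] x(3)[OF _ Bc[OF k]] by simp
      then show ?thesis using False \<sigma>x[OF hnc[OF s] False sm_closed[OF x(1) Bc[OF k]]] by (simp add: cc_def e_def)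
    qed (simp add: cc_def e_def)
    then show "hact Z m (Suc p) ((!) s) n (h n k) = e m n s k" using h(2)[OF sb k] by simp
  qed blast
  have di: "delta_map p (Suc p) (\<lambda>i. i)" by (rule delta_mapI) auto
  \<comment> \<open>The free face, opposite \<open>Suc p\<close>, is the solution: over
    \<open>B\<close> it is \<open>f\<close> by \<open>cc\<close>, and on its boundary it is still
    \<open>b\<close>.\<close>
  let ?h = "\<lambda>n l. hact Z p (Suc p) (\<lambda>i. i) n (H n l)"
  have "simplicial_map L (level Z p) ?h" by (rule sm_comp[OF H(1) bs_hact[OF Z di]])
  moreover have "?h n k = f n k" if k: "k \<in> B n" for n k
  proof -
    let ?s = "[0..<Suc p]"
    have s: "?s \<in> cells (std_simplex (Suc p)) p" using std_of_delta[OF di] by simp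
    have ns: "Suc p \<notin> set ?s" by auto
    have sb: "?s \<in> boundary (Suc p) p" using s ns by (auto simp: boundary_def simp del: upt_Suc)
    have hc: "h n k \<in> cells (level Z (Suc p)) n" using sm_closed[OF h(1), of k n] k by simp
    have "?h n k = hact Z p (Suc p) ((!) ?s) n (h n k)"
      unfolding H(2)[OF k] by (rule bs_eq[OF Z di hc]) (simp add: less_Suc_eq_le del: upt_Suc)
    also have "\<dots> = hact Z p p ((!) ?s) n (f n k)" using h(2)[OF sb k] ns by (simp add: cc_def del: upt_Suc)
    also have "\<dots> = f n k" by (rule bs_id[OF Z fc[OF k]]) (simp add: less_Suc_eq_le del: upt_Suc)
    finally show ?thesis .
  qed
  moreover have "hact Z m p ((!) s) n (?h n l) = b m n s l" if s: "s \<in> boundary p m" and l: "l \<in> cells L n" for m n s l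
  proof -
    have sc: "s \<in> cells (std_simplex p) m" using s by (simp add: boundary_def)
    have sc': "s \<in> cells (std_simplex (Suc p)) m" using sc by (auto simp: cells_std le_SucI)
    have ns: "Suc p \<notin> set s" using std_set_le[OF sc] by auto
    have sh: "s \<in> horn_cells (Suc p) (Suc p) m"
      using s boundary_iff[OF sc] horn_cells_iff[OF sc'] by (metis le_SucI not_less_eq_eq)
    have "hact Z m p ((!) s) n (?h n l) = hact Z m (Suc p) ((!) s) n (H n l)"
      by (rule bs_comp[OF Z std_deltaD[OF sc] di sm_closed[OF H(1) l]]) simp
    also have "\<dots> = hact Z m p ((!) s) n (x n l)"
      using H(3)[OF sh l] \<sigma>x[OF sc' ns sm_closed[OF x(1) l]] by (simp add: e_def)
    also have "\<dots> = b m n s l" by (rule x(3)[OF s l])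
    finally show ?thesis .
  qed
  ultimately show "\<exists>h. simplicial_map L (level Z p) h \<and> (\<forall>n. \<forall>k\<in>B n. h n k = f n k) \<and>
         (\<forall>m n s l. s \<in> boundary p m \<longrightarrow> l \<in> cells L n \<longrightarrow> hact Z m p ((!) s) n (h n l) = b m n s l)"
    by (intro exI[of _ ?h]) blast
qed

text \<open>When \<open>F\<close> is closed under nonempty subsets, this is the simplicial set of
  the abstract simplicial complex \<open>F\<close> with ordered vertices
  \<open>{..k}\<close>.\<close>

definition vertex_complex :: "nat \<Rightarrow> nat set set \<Rightarrow> nat \<Rightarrow> nat list set" where
  "vertex_complex k F m = {s \<in> cells (std_simplex k) m. set s \<in> F}"

lemma subsset_vertex_complex:
  assumes "\<And>A B. A \<in> F \<Longrightarrow> B \<subseteq> A \<Longrightarrow> B \<noteq> {} \<Longrightarrow> B \<in> F"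
  shows "subsset (std_simplex k) (vertex_complex k F)"
proof (rule subssetI)
  fix m n \<theta> x assume d: "delta_map m n \<theta>" and x: "x \<in> vertex_complex k F n"
  then have x': "x \<in> cells (std_simplex k) n" by (simp add: vertex_complex_def)
  have "set (act (std_simplex k) m n \<theta> x) \<noteq> {}" by (simp add: act_std)
  then show "act (std_simplex k) m n \<theta> x \<in> vertex_complex k F m"
    using ss_closed[OF simplicial_set_std d x'] act_std_set[OF x' d] x assms by (auto simp: vertex_complex_def)
qed (simp add: vertex_complex_def)

text \<open>A cone with apex \<open>0\<close> is built from its apex by attaching simplices \<open>A\<close> along their \<open>0\<close>-th horns.\<close>

lemma cone_lifts:
  assumes h: "\<And>m. 1 \<le> m \<Longrightarrow> m < N \<Longrightarrow> lifts E B q (std_simplex m) (horn_cells m 0)"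
    and "finite F" and "\<And>A. A \<in> F \<Longrightarrow> A \<subseteq> {..k} \<and> A \<noteq> {} \<and> card A \<le> N \<and> insert 0 A \<in> F"
    and "\<And>A B. A \<in> F \<Longrightarrow> B \<subseteq> A \<Longrightarrow> B \<noteq> {} \<Longrightarrow> B \<in> F" and "{0} \<in> F"
  shows "lifts E B q (restr (std_simplex k) (vertex_complex k F)) (\<lambda>m. {const_cell 0 m})"
  using assms(2-)
proof (induction "card F" arbitrary: F rule: less_induct)
  case less
  note fin = less.prems(1) and F = less.prems(2) and down = less.prems(3) and z = less.prems(4)
  show ?case
  proof (cases "F = {{0}}")
    case True
    have "vertex_complex k F m = {const_cell 0 m}" for m
    proof -
      have "set s = {0} \<longleftrightarrow> s = const_cell 0 m" if s: "s \<in> cells (std_simplex k) m" for s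
        unfolding const_cell_iff[OF s] std_set[OF s] by auto
      then show ?thesis using const_cell_cells[of 0 k m] True by (auto simp: vertex_complex_def simp del: replicate_Suc)
    qed
    then have e: "vertex_complex k F = (\<lambda>m. {const_cell 0 m})" by blast
    have "lifts E B q (restr (std_simplex k) (vertex_complex k F)) (cells (restr (std_simplex k) (vertex_complex k F)))" by (rule lifts_refl)
    then show ?thesis by (simp add: e del: replicate_Suc)
  next
    case False
    \<comment> \<open>A member of largest size must contain the apex 0, since otherwise adding 0
      would give a larger one.\<close>
    define c where "c = Max (card ` F)"
    have "c \<in> card ` F" unfolding c_def by (rule Max_in) (use fin z in auto)
    then obtain A where A: "A \<in> F" "card A = c" by auto
    have max: "card A' \<le> card A" if "A' \<in> F" for A'
      using Max_ge[of "card ` F" "card A'"] fin that A(2) by (simp add: c_def)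
    have finA: "finite A'" if "A' \<in> F" for A' using F[OF that] finite_subset by blast
    have 0: "0 \<in> A"
    proof (rule ccontr)
      assume "0 \<notin> A"
      then have "card (insert 0 A) = Suc (card A)" using finA[OF A(1)] by simp
      then show False using max[of "insert 0 A"] F[OF A(1)] by simp
    qed
    have A0: "A \<noteq> {0}"
    proof
      assume e: "A = {0}"
      obtain A' where A': "A' \<in> F" "A' \<noteq> {0}" using False z by blast
      have "\<not> A' \<subseteq> {0}" using A'(2) F[OF A'(1)] by (auto simp: subset_singleton_iff)
      then obtain a where a: "a \<in> A'" "a \<noteq> 0" by blast
      have "insert 0 A' \<in> F" using F[OF A'(1)] by blast
      moreover have "card {0, a} \<le> card (insert 0 A')" by (rule card_mono) (use finA[OF A'(1)] a in auto)
      ultimately show False using max[of "insert 0 A'"] a e by simp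
    qed
    \<comment> \<open>\<open>D\<close> is the face of \<open>A\<close> opposite the apex. By
      maximality it lies in no member of \<open>F\<close> besides \<open>A\<close> and itself, so
      removing \<open>A\<close> and \<open>D\<close> leaves a smaller cone, to which
      \<open>A\<close> is attached along its horn at vertex 0.\<close>
    define D where "D = A - {0}"
    have D: "D \<noteq> {}" "D \<noteq> A" "insert 0 D = A" "D \<subseteq> A" "D \<in> F"
      using 0 A0 down[OF A(1), of D] by (auto simp: D_def)
    define F' where "F' = F - {A, D}"
    have supD: "C = A" if "C \<in> F" "D \<subseteq> C" "C \<noteq> D" for C
    proof -
      have "A \<subseteq> insert 0 C" using D that by blast
      moreover have "card (insert 0 C) \<le> card A" using max F[OF that(1)] by blast
      ultimately have e: "insert 0 C = A" using finA[OF that(1)] by (metis card_seteq finite_insert)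
      have "0 \<in> C" using that D e by (auto simp: D_def)
      then show ?thesis using e by auto
    qed
    have supA: "C = A" if "C \<in> F" "A \<subseteq> C" for C
      using card_seteq[OF finA[OF that(1)] that(2) max[OF that(1)]] by simp
    have down': "C \<in> F'" if "A' \<in> F'" "C \<subseteq> A'" "C \<noteq> {}" for A' C
      using that down[of A' C] supD[of A'] supA[of A'] by (auto simp: F'_def)
    have F'F: "F' \<subseteq> F" by (auto simp: F'_def)
    have IH: "lifts E B q (restr (std_simplex k) (vertex_complex k F')) (\<lambda>m. {const_cell 0 m})"
    proof (rule less.hyps)
      show "card F' < card F" by (rule psubset_card_mono[OF fin]) (use A(1) in \<open>auto simp: F'_def\<close>)
      show "finite F'" using F'F fin finite_subset by blast
      show "\<And>A' C. A' \<in> F' \<Longrightarrow> C \<subseteq> A' \<Longrightarrow> C \<noteq> {} \<Longrightarrow> C \<in> F'" by (rule down')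
      show "{0} \<in> F'" using z A0 D by (auto simp: F'_def D_def)
      fix C assume C: "C \<in> F'"
      have "insert 0 C \<noteq> D" by (auto simp: D_def)
      moreover have "insert 0 C \<noteq> A" using C by (auto simp: F'_def D_def)
      ultimately show "C \<subseteq> {..k} \<and> C \<noteq> {} \<and> card C \<le> N \<and> insert 0 C \<in> F'"
        using F[of C] C by (auto simp: F'_def)
    qed
    define m where "m = card A - 1"
    have cA: "card A = Suc m" using finA[OF A(1)] 0 by (cases "card A") (auto simp: m_def)
    have m: "1 \<le> m" "m < N"
    proof -
      have "card D = m" using 0 finA[OF A(1)] by (simp add: D_def m_def)
      then show "1 \<le> m" using D(1) finA[OF D(5)] by (cases m) auto
      show "m < N" using F[OF A(1)] cA by simp
    qed
    define x where "x = sorted_list_of_set A"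
    have x: "set x = A" "length x = Suc m" "sorted x" "distinct x"
      using finA[OF A(1)] cA by (simp_all add: x_def)
    have xs: "i < j \<Longrightarrow> j \<le> m \<Longrightarrow> x ! i < x ! j" for i j
      using strict_sorted_list_of_set[of A, folded x_def] x(2) by (simp add: sorted_wrt_iff_nth_less)
    have xi: "i = j" if "i \<le> m" "j \<le> m" "x ! i = x ! j" for i j
      using nth_eq_iff_index_eq[OF x(4)] x(2) that by simp
    have xA: "x ! i \<in> A" if "i \<le> m" for i using x nth_mem[of i x] that by simp
    have x0: "x ! 0 = 0"
    proof -
      obtain i where "i \<le> m" "x ! i = 0" using 0 x by (metis in_set_conv_nth less_Suc_eq_le)
      then show ?thesis using xs[of 0 i] by (cases i) auto
    qed
    have xc: "x \<in> cells (std_simplex k) m"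
      using x F[OF A(1)] by (auto simp: std_simplex_def cells_nerve)
    have xx: "set (act (std_simplex k) j m ((!) s) x) = (!) x ` set s" if s: "s \<in> cells (std_simplex m) j" for j s
      using std_set[OF ss_closed[OF simplicial_set_std std_deltaD[OF s] xc]] std_set[OF s]
      by (force simp: nth_act_std)
    have xim: "(!) x ` set s \<subseteq> A" "(!) x ` set s \<noteq> {}" if s: "s \<in> cells (std_simplex m) j" for j s
      using std_set_le[OF s] xA s by (auto simp: cells_std)
    have D': "D \<subseteq> (!) x ` T \<longleftrightarrow> {..m} - {0} \<subseteq> T" if T: "T \<subseteq> {..m}" for T
    proof
      assume D1: "D \<subseteq> (!) x ` T"
      show "{..m} - {0} \<subseteq> T"
      proof
        fix i assume i: "i \<in> {..m} - {0}"
        then have "x ! i \<noteq> 0" using xs[of 0 i] x0 by auto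
        then have "x ! i \<in> D" using xA i by (auto simp: D_def)
        then obtain j where "j \<in> T" "x ! i = x ! j" using D1 by auto
        then show "i \<in> T" using xi[of i j] i T by auto
      qed
    next
      assume T1: "{..m} - {0} \<subseteq> T"
      show "D \<subseteq> (!) x ` T"
      proof
        fix a assume a: "a \<in> D"
        then obtain i where i: "i \<le> m" "x ! i = a" using x D(4) by (metis in_set_conv_nth less_Suc_eq_le subsetD)
        then have "i \<noteq> 0" using a x0 by (cases i) (auto simp: D_def)
        then show "a \<in> (!) x ` T" using i T1 by auto
      qed
    qed
    have at: "lifts E B q (restr (std_simplex k) (\<lambda>j. vertex_complex k F' j \<union> generated (std_simplex k) m x j)) (vertex_complex k F')"
    proof (rule attach[OF simplicial_set_std subsset_vertex_complex[OF down'] xc _ subsset_horn_cells _ h[OF m]])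
      fix j s assume s: "s \<in> cells (std_simplex m) j"
      let ?T = "(!) x ` set s"
      have TF: "?T \<in> F" using down[OF A(1) xim[OF s]] .
      have "?T \<in> F' \<longleftrightarrow> \<not> D \<subseteq> ?T"
      proof
        assume "?T \<in> F'"
        then have "?T \<noteq> A" "?T \<noteq> D" unfolding F'_def by blast+
        then show "\<not> D \<subseteq> ?T" using supD[OF TF] by blast
      next
        assume "\<not> D \<subseteq> ?T"
        then have "?T \<noteq> A" "?T \<noteq> D" using D(4) by blast+
        then show "?T \<in> F'" using TF unfolding F'_def by blast
      qed
      then show "act (std_simplex k) j m ((!) s) x \<in> vertex_complex k F' j \<longleftrightarrow> s \<in> horn_cells m 0 j"
        using xx[OF s] D'[OF std_set_le[OF s]] s ss_closed[OF simplicial_set_std std_deltaD[OF s] xc]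
        by (simp add: vertex_complex_def horn_cells_def)
    next
      fix j s s' assume s: "s \<in> cells (std_simplex m) j" and s': "s' \<in> cells (std_simplex m) j"
        and e: "act (std_simplex k) j m ((!) s) x = act (std_simplex k) j m ((!) s') x"
      show "s = s'"
      proof (rule std_eqI[OF s])
        fix i assume i: "i \<le> j"
        have "x ! (s ! i) = x ! (s' ! i)" using nth_act_std[OF i] e by metis
        then show "s ! i = s' ! i" using xi s s' i by (auto simp: cells_std)
      qed (use s' in \<open>simp add: cells_std\<close>)
    qed
    have un: "(\<lambda>j. vertex_complex k F' j \<union> generated (std_simplex k) m x j) = vertex_complex k F"
    proof (intro ext set_eqI iffI)
      fix j s assume "s \<in> vertex_complex k F' j \<union> generated (std_simplex k) m x j"
      then show "s \<in> vertex_complex k F j"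
      proof
        assume "s \<in> generated (std_simplex k) m x j"
        then obtain t where t: "t \<in> cells (std_simplex m) j" "s = act (std_simplex k) j m ((!) t) x"
          by (auto simp: generated_def)
        then show ?thesis using xx[OF t(1)] down[OF A(1) xim[OF t(1)]] ss_closed[OF simplicial_set_std std_deltaD[OF t(1)] xc]
          by (simp add: vertex_complex_def)
      qed (auto simp: vertex_complex_def F'_def)
    next
      fix j s assume s: "s \<in> vertex_complex k F j"
      then have sc: "s \<in> cells (std_simplex k) j" by (simp add: vertex_complex_def)
      show "s \<in> vertex_complex k F' j \<union> generated (std_simplex k) m x j"
      proof (cases "set s \<in> F'")
        case True then show ?thesis using sc by (simp add: vertex_complex_def)
      next
        case False
        then have sA: "set s \<subseteq> A" using s D by (auto simp: vertex_complex_def F'_def)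
        have "\<exists>r. r \<le> m \<and> x ! r = s ! i" if "i \<le> j" for i
        proof -
          have "s ! i \<in> A" using sA std_set[OF sc] that by auto
          then show ?thesis using x by (metis in_set_conv_nth less_Suc_eq_le)
        qed
        then obtain \<theta> where \<theta>: "\<And>i. i \<le> j \<Longrightarrow> \<theta> i \<le> m \<and> x ! \<theta> i = s ! i" by metis
        have d: "delta_map j m \<theta>"
        proof (rule delta_mapI)
          fix a b assume ab: "a \<le> b" "b \<le> j"
          have "s ! a \<le> s ! b" using sc ab by (simp add: cells_std)
          then show "\<theta> a \<le> \<theta> b" using \<theta>[of a] \<theta>[of b] ab xs[of "\<theta> b" "\<theta> a"] by (cases "\<theta> a \<le> \<theta> b") auto
        qed (use \<theta> in blast)
        have "act (std_simplex k) j m ((!) (map \<theta> [0..<Suc j])) x = s"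
          by (rule std_eqI[symmetric, OF sc]) (simp_all add: nth_act_std nth_map_upt' \<theta> del: upt_Suc)
        then show ?thesis unfolding generated_def using std_of_delta[OF d] by (metis UnI2 imageI)
      qed
    qed
    show ?thesis
    proof (rule lifts_trans[of E B q "vertex_complex k F'" "restr (std_simplex k) (vertex_complex k F)"])
      show "lifts E B q (restr (restr (std_simplex k) (vertex_complex k F)) (vertex_complex k F')) (\<lambda>m. {const_cell 0 m})" using IH by simp
      show "lifts E B q (restr (std_simplex k) (vertex_complex k F)) (vertex_complex k F')" using at un by simp
      show "subsset (restr (std_simplex k) (vertex_complex k F)) (vertex_complex k F')"
        using subsset_vertex_complex[of F' k, OF down'] F'F by (auto simp: subsset_def vertex_complex_def)
      fix j
      have "set (const_cell 0 j) = {0}" by auto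
      then show "{const_cell 0 j} \<subseteq> vertex_complex k F' j"
        using z A0 D const_cell_cells[of 0 k j] by (auto simp: vertex_complex_def F'_def D_def simp del: replicate_Suc)
    qed
  qed
qed

lemma horn_cells_vertex_complex:
  assumes "1 \<le> k"
  shows "horn_cells k 0 = vertex_complex k {A. A \<noteq> {} \<and> A \<subseteq> {..k} \<and> \<not> {..k} - {0} \<subseteq> A}"
proof (intro ext set_eqI)
  fix m s
  have "s \<in> cells (std_simplex k) m \<Longrightarrow> set s \<noteq> {}" by (auto simp: cells_std)
  then show "s \<in> horn_cells k 0 m \<longleftrightarrow> s \<in> vertex_complex k {A. A \<noteq> {} \<and> A \<subseteq> {..k} \<and> \<not> {..k} - {0} \<subseteq> A} m"
    using std_set_le[of s k m] unfolding horn_cells_def vertex_complex_def mem_Collect_eq by blast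
qed

text \<open>The horn at 0 is a cone assembled from horns of smaller dimension, so the inclusion of
  its apex is handled by induction. The inclusion of the apex in the simplex is handled by
  \<open>root\<close>. Cancelling the former from the latter leaves the inclusion of the
  horn.\<close>

lemma outer_horn_blifts:
  assumes Z: "bisimplicial Z" and root: "\<And>p n. blifts Z p (boundary p) (std_simplex n) (\<lambda>m. {const_cell 0 m})"
    and fib: "\<And>p k. blifts Z (Suc p) (horn_cells (Suc p) (Suc p)) (std_simplex k) (horn_cells k 0)"
    and k: "1 \<le> k"
  shows "blifts Z p (boundary p) (std_simplex k) (horn_cells k 0)"
  using k
proof (induction k arbitrary: p rule: less_induct)
  case (less k)
  have s0: "subsset (std_simplex k) (\<lambda>m. {const_cell 0 m})" by (rule subsset_const_cell) simp
  have 01: "const_cell 0 m \<in> horn_cells k 0 m" for m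
  proof -
    have "k \<noteq> 0" "k \<notin> set (const_cell 0 m)" using less.prems by auto
    then show ?thesis using const_cell_cells[of 0 k m] unfolding horn_cells_def by blast
  qed
  have s0': "subsset (restr (std_simplex k) (horn_cells k 0)) (\<lambda>m. {const_cell 0 m})"
    using s0 01 by (auto simp: subsset_def simp del: replicate_Suc)
  show ?case
  proof (rule blifts_cancel[OF Z simplicial_set_std s0 subsset_horn_cells _ root _ fib])
    show "{const_cell 0 m} \<subseteq> horn_cells k 0 m" for m using 01 by blast
    fix p
    let ?F = "{A. A \<noteq> {} \<and> A \<subseteq> {..k} \<and> \<not> {..k} - {0} \<subseteq> A}"
    have "lifts (level Z p) (map_space (restr (std_simplex p) (boundary p)) Z) (restriction Z p (boundary p))
        (restr (std_simplex k) (vertex_complex k ?F)) (\<lambda>m. {const_cell 0 m})"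
    proof (rule cone_lifts[where N = k])
      fix m assume "1 \<le> m" "m < k"
      then show "lifts (level Z p) (map_space (restr (std_simplex p) (boundary p)) Z) (restriction Z p (boundary p)) (std_simplex m) (horn_cells m 0)"
        using less.IH blifts_iff_lifts[OF Z subsset_boundary simplicial_set_std subsset_horn_cells] by blast
    next
      \<comment> \<open>A member of the horn misses a vertex other than 0. It thus has at most
        \<open>k\<close> elements, which keeps the attached horns below dimension \<open>k\<close>,
        and adding 0 to it does not leave the horn.\<close>
      fix A assume A: "A \<in> ?F"
      then obtain u where u: "u \<le> k" "u \<noteq> 0" "u \<notin> A" by auto
      have "card A \<le> card ({..k} - {u})" by (rule card_mono) (use A u in auto)
      then show "A \<subseteq> {..k} \<and> A \<noteq> {} \<and> card A \<le> k \<and> insert 0 A \<in> ?F" using A u by auto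
    next
      have "k \<in> {..k} - {0}" "k \<notin> {0}" using less.prems by auto
      then show "{0} \<in> ?F" by blast
    qed (auto intro: finite_subset[of _ "Pow {..k}"])
    then show "blifts Z p (boundary p) (restr (std_simplex k) (horn_cells k 0)) (\<lambda>m. {const_cell 0 m})"
      unfolding horn_cells_vertex_complex[OF less.prems, symmetric]
      using blifts_iff_lifts[OF Z subsset_boundary ss_sub[OF simplicial_set_std subsset_horn_cells] s0'] by blast
  qed
qed

section \<open>The walking isomorphism\<close>

text \<open>Dependent choice picks lifts along the chain, each extending the previous one, so they
  glue on the union.\<close>

lemma lifts_chain:
  assumes N: "\<And>k. subsset L (N k)" and un: "\<And>n x. x \<in> cells L n \<Longrightarrow> \<exists>k. x \<in> N k n"
    and inc: "\<And>k n. N k n \<subseteq> N (Suc k) n" and l: "\<And>k. lifts E B q (restr L (N (Suc k))) (N k)"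
  shows "lifts E B q L (N 0)"
proof (rule liftsI)
  fix f b assume f: "simplicial_map (restr L (N 0)) E f" and b: "simplicial_map L B b"
    and c: "\<And>n x. x \<in> N 0 n \<Longrightarrow> q n (f n x) = b n x"
  define P where "P k h \<longleftrightarrow> simplicial_map (restr L (N k)) E h \<and> (\<forall>n. \<forall>x\<in>N k n. q n (h n x) = b n x) \<and>
      (k = 0 \<longrightarrow> h = f)" for k h
  have "\<exists>F. \<forall>k. P k (F k) \<and> (\<forall>n. \<forall>x\<in>N k n. F (Suc k) n x = F k n x)"
  proof (rule dependent_nat_choice)
    show "\<exists>x. P 0 x" using f c by (auto simp: P_def)
    fix h k assume h: "P k h"
    have "simplicial_map (restr (restr L (N (Suc k))) (N k)) E h" using h by (simp add: P_def)
    from liftsD[OF l this sm_sub[OF b N]] obtain h' where "simplicial_map (restr L (N (Suc k))) E h'"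
      "\<And>n x. x \<in> N k n \<Longrightarrow> h' n x = h n x" "\<And>n x. x \<in> N (Suc k) n \<Longrightarrow> q n (h' n x) = b n x"
      using h by (auto simp: P_def)
    then show "\<exists>y. P (Suc k) y \<and> (\<forall>n. \<forall>x\<in>N k n. y n x = h n x)" by (auto simp: P_def)
  qed
  then obtain F where F: "\<And>k. P k (F k)" "\<And>k n x. x \<in> N k n \<Longrightarrow> F (Suc k) n x = F k n x" by blast
  have inc': "x \<in> N k n \<Longrightarrow> x \<in> N (k + j) n \<and> F (k + j) n x = F k n x" for x k j n
    by (induction j) (use inc F(2) in auto)
  have agree: "F k n x = F k' n x" if "x \<in> N k n" "x \<in> N k' n" for x k k' n
    using inc'[OF that(1), of "k' - k"] inc'[OF that(2), of "k - k'"] by (cases "k \<le> k'") auto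
  define h where "h n x = F (SOME k. x \<in> N k n) n x" for n x
  have h: "h n x = F k n x" if "x \<in> N k n" for n x k
    unfolding h_def by (rule agree[OF someI[of "\<lambda>k. x \<in> N k n", OF that] that])
  have "simplicial_map L E h"
  proof (rule smI)
    fix n x assume "x \<in> cells L n"
    then obtain k where k: "x \<in> N k n" using un by blast
    have Fk: "simplicial_map (restr L (N k)) E (F k)" using F(1) by (simp add: P_def)
    show "h n x \<in> cells E n" using h[OF k] sm_closed[OF Fk, of x n] k by simp
    fix m \<theta> assume d: "delta_map m n \<theta>"
    show "h m (act L m n \<theta> x) = act E m n \<theta> (h n x)"
      using h[OF k] h[OF subsset_act[OF N d k]] sm_nat[OF Fk _ d, of x] k by simp
  qed
  moreover have "h n x = f n x" if "x \<in> N 0 n" for n x using h[OF that] F(1)[of 0] by (simp add: P_def)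
  moreover have "q n (h n x) = b n x" if "x \<in> cells L n" for n x
  proof -
    obtain k where k: "x \<in> N k n" using un[OF \<open>x \<in> cells L n\<close>] by blast
    then show ?thesis using h[OF k] F(1)[of k] by (auto simp: P_def)
  qed
  ultimately show "\<exists>h. simplicial_map L E h \<and> (\<forall>n. \<forall>x\<in>N 0 n. h n x = f n x) \<and> (\<forall>n. \<forall>x\<in>cells L n. q n (h n x) = b n x)"
    by blast
qed

lemma cells_walking_iso: "xs \<in> cells walking_iso n \<longleftrightarrow> length xs = Suc n \<and> (\<forall>i\<le>n. xs ! i < 2)"
proof -
  have "sorted_wrt (\<lambda>_ _. True) xs" by (induction xs) auto
  moreover have "set xs \<subseteq> {0, 1} \<longleftrightarrow> (\<forall>i\<le>n. xs ! i < 2)" if "length xs = Suc n"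
  proof -
    have "{0, 1} = {..<2::nat}" by auto
    then have "set xs \<subseteq> {0, 1} \<longleftrightarrow> (\<forall>x\<in>set xs. x < 2)" by (simp only:) auto
    then show ?thesis using that by (simp add: all_set_conv_all_nth less_Suc_eq_le)
  qed
  ultimately show ?thesis unfolding walking_iso_def cells_nerve by blast
qed

lemma act_walking_iso: "act walking_iso m n \<theta> xs = map (\<lambda>i. xs ! \<theta> i) [0..<Suc m]"
  by (simp add: walking_iso_def act_nerve)

lemma simplicial_set_walking_iso: "simplicial_set walking_iso"
  unfolding walking_iso_def by (rule simplicial_set_nerve) simp

lemma nth_act_J: "i \<le> m \<Longrightarrow> act walking_iso m n \<theta> xs ! i = xs ! \<theta> i"
  by (simp add: act_walking_iso nth_map_upt' del: upt_Suc)

text \<open>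
  \<open>xs\<close> is the image of the alternating simplex \<open>0101\<dots>\<close> under the map \<open>rank xs\<close>, the pointwise least such map.
\<close>

definition rank :: "nat list \<Rightarrow> nat \<Rightarrow> nat" where
  "rank xs j = xs ! 0 + (\<Sum>i<j. if xs ! i = xs ! Suc i then 0 else 1)"

lemma rank_0: "rank xs 0 = xs ! 0"
  and rank_Suc: "rank xs (Suc j) = rank xs j + (if xs ! j = xs ! Suc j then 0 else 1)"
  by (simp_all add: rank_def)

lemma rank_mono: "i \<le> j \<Longrightarrow> rank xs i \<le> rank xs j"
  by (induction j rule: dec_induct) (auto simp: rank_Suc)

lemma rank_mod: "(\<And>i. i \<le> j \<Longrightarrow> xs ! i < 2) \<Longrightarrow> rank xs j mod 2 = xs ! j"
proof (induction j)
  case 0 then show ?case by (simp add: rank_0)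
next
  case (Suc j)
  have "rank xs j mod 2 = xs ! j" "xs ! j < 2" "xs ! Suc j < 2" using Suc by auto
  then show ?case unfolding rank_Suc by (auto simp: less_2_cases_iff One_nat_def mod_Suc)
qed

lemma rank_le:
  assumes "\<And>i. i \<le> j \<Longrightarrow> xs ! i = \<theta> i mod 2" "\<And>i. i < j \<Longrightarrow> \<theta> i \<le> \<theta> (Suc i)"
  shows "rank xs j \<le> \<theta> j"
  using assms
proof (induction j)
  case 0 then show ?case by (simp add: rank_0)
next
  case (Suc j)
  have IH: "rank xs j \<le> \<theta> j" using Suc by simp
  have le: "\<theta> j \<le> \<theta> (Suc j)" using Suc.prems(2)[of j] by simp
  show ?case
  proof (cases "xs ! j = xs ! Suc j")
    case False
    then have "\<theta> j \<noteq> \<theta> (Suc j)" using Suc.prems(1)[of j] Suc.prems(1)[of "Suc j"] by auto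
    then show ?thesis using IH le False by (simp add: rank_Suc)
  qed (use IH le in \<open>simp add: rank_Suc\<close>)
qed

definition alternating :: "nat \<Rightarrow> nat list" where
  "alternating k = map (\<lambda>i. i mod 2) [0..<Suc k]"

lemma alternating_cells: "alternating k \<in> cells walking_iso k"
  by (auto simp: cells_walking_iso alternating_def nth_map_upt' simp del: upt_Suc)

lemma alternating_act: "s \<in> cells (std_simplex k) m \<Longrightarrow> act walking_iso m k ((!) s) (alternating k) = map (\<lambda>i. s ! i mod 2) [0..<Suc m]"
  by (auto simp: act_walking_iso alternating_def cells_std nth_map_upt' less_Suc_eq_le simp del: upt_Suc)

text \<open>\<open>N k\<close> consists of the simplices that factor through the alternating simplex
  of dimension \<open>k\<close>. In the next alternating simplex, the face opposite vertex 0 is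
  1010..., whose rank is \<open>Suc k\<close>; every other proper face lies in \<open>N k\<close>.
  Each stage thus attaches one simplex along its horn at 0.\<close>

lemma walking_iso_lifts:
  assumes h: "\<And>k. 1 \<le> k \<Longrightarrow> lifts E B q (std_simplex k) (horn_cells k 0)"
  shows "lifts E B q walking_iso (\<lambda>m. {const_cell 0 m})"
proof -
  define N where "N k n = {xs \<in> cells walking_iso n. rank xs n \<le> k}" for k n
  have lt2: "xs ! i < 2" if "xs \<in> cells walking_iso n" "i \<le> n" for xs n i using that by (simp add: cells_walking_iso)
  have N: "subsset walking_iso (N k)" for k
  proof (rule subssetI)
    fix m n \<theta> xs assume d: "delta_map m n \<theta>" and x: "xs \<in> N k n"
    then have xc: "xs \<in> cells walking_iso n" by (simp add: N_def)
    have "rank (act walking_iso m n \<theta> xs) m \<le> rank xs (\<theta> m)"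
    proof (rule rank_le[where \<theta> = "\<lambda>i. rank xs (\<theta> i)"])
      fix i assume "i \<le> m"
      then have "\<theta> i \<le> n" using delta_map_le[OF d] by simp
      then show "act walking_iso m n \<theta> xs ! i = rank xs (\<theta> i) mod 2"
        using rank_mod[of "\<theta> i" xs] lt2[OF xc] \<open>i \<le> m\<close> by (simp add: nth_act_J)
    next
      fix i assume "i < m" then show "rank xs (\<theta> i) \<le> rank xs (\<theta> (Suc i))"
        using delta_map_mono[OF d, of i "Suc i"] rank_mono by simp
    qed
    also have "\<dots> \<le> rank xs n" using rank_mono delta_map_le[OF d, of m] by simp
    finally show "act walking_iso m n \<theta> xs \<in> N k m"
      using x ss_closed[OF simplicial_set_walking_iso d xc] by (simp add: N_def)
  qed (simp add: N_def)
  have "lifts E B q (restr walking_iso (N (Suc k))) (N k)" for k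
  proof -
    let ?a = "\<lambda>m s. act walking_iso m (Suc k) ((!) s) (alternating (Suc k))"
    have nth_a: "?a m s ! i = s ! i mod 2" if "s \<in> cells (std_simplex (Suc k)) m" "i \<le> m" for m s i
      using that by (simp add: alternating_act nth_map_upt' del: upt_Suc)
    have rank_a: "rank (?a m s) j \<le> s ! j" if s: "s \<in> cells (std_simplex (Suc k)) m" "j \<le> m" for m s j
      by (rule rank_le) (use s nth_a in \<open>auto simp: cells_std\<close>)
    \<comment> \<open>If \<open>s\<close> meets every positive vertex, it starts at 0 or 1 and never
      grows by more than 1, so it coincides with the least map having the same parities.\<close>
    have rank_eq: "rank (?a m s) j = s ! j"
      if s: "s \<in> cells (std_simplex (Suc k)) m" and full: "{..Suc k} - {0} \<subseteq> set s" and j: "j \<le> m" for m s j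
      using j
    proof (induction j)
      case 0
      have "s ! 0 \<le> 1"
      proof (rule ccontr)
        assume n: "\<not> s ! 0 \<le> 1"
        have "1 \<in> set s" using full by auto
        then obtain r where "r \<le> m" "s ! r = 1" using std_set[OF s] by auto
        then show False using delta_map_mono[OF std_deltaD[OF s], of 0 r] n by simp
      qed
      then show ?case using nth_a[OF s, of 0] by (simp add: rank_0)
    next
      case (Suc j)
      have le: "s ! j \<le> s ! Suc j" using delta_map_mono[OF std_deltaD[OF s], of j "Suc j"] Suc.prems by simp
      have "s ! Suc j \<le> Suc (s ! j)"
      proof (rule ccontr)
        assume n: "\<not> s ! Suc j \<le> Suc (s ! j)"
        then have "Suc (s ! j) \<in> set s" using full delta_map_le[OF std_deltaD[OF s] Suc.prems] by auto
        then obtain r where r: "r \<le> m" "s ! r = Suc (s ! j)" using std_set[OF s] by auto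
        show False
        proof (cases "r \<le> j")
          case True then show False using delta_map_mono[OF std_deltaD[OF s], of r j] Suc.prems r by simp
        next
          case False then show False using delta_map_mono[OF std_deltaD[OF s], of "Suc j" r] n r by simp
        qed
      qed
      then have "s ! Suc j = s ! j \<or> s ! Suc j = Suc (s ! j)" using le by auto
      then show ?case
      proof
        assume e: "s ! Suc j = s ! j"
        then have "?a m s ! j = ?a m s ! Suc j" using nth_a[OF s] Suc.prems by (simp only: Suc_leD)
        then show ?thesis unfolding rank_Suc using Suc.IH Suc.prems e by (simp only: if_True Suc_leD add_0_right refl)
      next
        assume e: "s ! Suc j = Suc (s ! j)"
        have "s ! j mod 2 \<noteq> Suc (s ! j) mod 2" by presburger
        then have "?a m s ! j \<noteq> ?a m s ! Suc j" using nth_a[OF s] Suc.prems e by (simp only: Suc_leD) simp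
        then show ?thesis unfolding rank_Suc using Suc.IH Suc.prems e by (simp only: if_False Suc_leD One_nat_def add_Suc_right add_0_right)
      qed
    qed
    have at: "lifts E B q (restr walking_iso (\<lambda>m. N k m \<union> generated walking_iso (Suc k) (alternating (Suc k)) m)) (N k)"
    proof (rule attach[OF simplicial_set_walking_iso N alternating_cells _ subsset_horn_cells[of "Suc k" 0]])
      fix m s assume s: "s \<in> cells (std_simplex (Suc k)) m"
      have sm: "s ! m \<le> Suc k" using s by (simp add: cells_std)
      have "rank (?a m s) m \<le> k \<longleftrightarrow> s \<in> horn_cells (Suc k) 0 m"
      proof
        assume r: "rank (?a m s) m \<le> k"
        show "s \<in> horn_cells (Suc k) 0 m"
        proof (rule ccontr)
          assume "s \<notin> horn_cells (Suc k) 0 m"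
          then have full: "{..Suc k} - {0} \<subseteq> set s" using s by (simp add: horn_cells_def)
          then have "Suc k \<in> set s" by auto
          then obtain i where "i \<le> m" "s ! i = Suc k" using std_set[OF s] by auto
          then have "Suc k \<le> s ! m" using delta_map_mono[OF std_deltaD[OF s], of i m] by simp
          then show False using rank_eq[OF s full order_refl] r by simp
        qed
      next
        assume "s \<in> horn_cells (Suc k) 0 m"
        then obtain u where u: "u \<le> Suc k" "u \<noteq> 0" "\<And>r. r \<le> m \<Longrightarrow> s ! r \<noteq> u" using horn_cells_iff[OF s] by blast
        show "rank (?a m s) m \<le> k"
        proof -
          text \<open>Closing the gap at \<open>u\<close> keeps parities and lowers the last value.\<close>
          let ?t = "\<lambda>i. if s ! i < u then s ! i else s ! i - 2"
          have "rank (?a m s) m \<le> ?t m"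
          proof (rule rank_le[where \<theta> = ?t])
            fix i assume i: "i \<le> m"
            then have "s ! i \<noteq> u" by (rule u(3))
            then have "s ! i mod 2 = ?t i mod 2" using u(2) by (auto simp: le_mod_geq)
            then show "?a m s ! i = ?t i mod 2" using nth_a[OF s i] by simp
          next
            fix i assume i: "i < m"
            have "s ! i \<le> s ! Suc i" using delta_map_mono[OF std_deltaD[OF s], of i "Suc i"] i by simp
            then show "?t i \<le> ?t (Suc i)" using u(3)[of i] u(3)[of "Suc i"] i by auto
          qed
          also have "?t m \<le> k" using sm u by auto
          finally show ?thesis .
        qed
      qed
      then show "?a m s \<in> N k m \<longleftrightarrow> s \<in> horn_cells (Suc k) 0 m"
        using ss_closed[OF simplicial_set_walking_iso std_deltaD[OF s] alternating_cells] by (simp add: N_def)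
    next
      fix m s s' assume s: "s \<in> cells (std_simplex (Suc k)) m" and s': "s' \<in> cells (std_simplex (Suc k)) m"
        and n: "s \<notin> horn_cells (Suc k) 0 m" "s' \<notin> horn_cells (Suc k) 0 m" and e: "?a m s = ?a m s'"
      show "s = s'"
      proof (rule std_eqI[OF s])
        fix j assume j: "j \<le> m"
        show "s ! j = s' ! j"
          using rank_eq[OF s _ j] rank_eq[OF s' _ j] n s s' e by (auto simp: horn_cells_def)
      qed (use s' in \<open>simp add: cells_std\<close>)
    qed (rule h, simp)
    have "(\<lambda>m. N k m \<union> generated walking_iso (Suc k) (alternating (Suc k)) m) = N (Suc k)"
    proof (intro ext set_eqI iffI)
      fix m xs assume "xs \<in> N k m \<union> generated walking_iso (Suc k) (alternating (Suc k)) m"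
      then show "xs \<in> N (Suc k) m"
      proof
        assume "xs \<in> generated walking_iso (Suc k) (alternating (Suc k)) m"
        then obtain s where s: "s \<in> cells (std_simplex (Suc k)) m" "xs = ?a m s" by (auto simp: generated_def)
        have "rank xs m \<le> s ! m" using rank_a[OF s(1) order_refl] s(2) by simp
        also have "\<dots> \<le> Suc k" using s(1) by (simp add: cells_std)
        finally show ?thesis
          using ss_closed[OF simplicial_set_walking_iso std_deltaD[OF s(1)] alternating_cells] s(2) by (simp add: N_def)
      qed (simp add: N_def)
    next
      fix m xs assume x: "xs \<in> N (Suc k) m"
      then have xc: "xs \<in> cells walking_iso m" and r: "rank xs m \<le> Suc k" by (auto simp: N_def)
      let ?s = "map (rank xs) [0..<Suc m]"
      have s: "?s \<in> cells (std_simplex (Suc k)) m"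
      proof (rule std_of_delta, rule delta_mapI)
        fix i assume "i \<le> m" then show "rank xs i \<le> Suc k" using rank_mono[of i m xs] r by simp
      qed (rule rank_mono)
      have "?a m ?s = xs"
      proof (rule nth_equalityI)
        show "length (?a m ?s) = length xs" using xc by (simp add: act_walking_iso cells_walking_iso)
        fix i assume "i < length (?a m ?s)"
        then have "i \<le> m" by (simp add: act_walking_iso)
        then show "?a m ?s ! i = xs ! i"
          using nth_a[OF s, of i] rank_mod[of i xs] lt2[OF xc] by (simp add: nth_map_upt' del: upt_Suc)
      qed
      then show "xs \<in> N k m \<union> generated walking_iso (Suc k) (alternating (Suc k)) m"
        unfolding generated_def using s by (metis UnI2 imageI)
    qed
    then show ?thesis using at by simp
  qed
  then have "lifts E B q walking_iso (N 0)"
    by (intro lifts_chain[OF N]) (auto simp: N_def)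
  also have "N 0 = (\<lambda>m. {const_cell 0 m})"
  proof (intro ext set_eqI iffI)
    fix m xs assume "xs \<in> N 0 m"
    then have x: "xs \<in> cells walking_iso m" "rank xs m = 0" by (auto simp: N_def)
    have "xs ! i = 0" if "i \<le> m" for i
      using rank_mod[of i xs] rank_mono[OF that, of xs] x lt2[OF x(1)] that by simp
    then show "xs \<in> {const_cell 0 m}"
      using x(1) by (auto simp: cells_walking_iso less_Suc_eq_le intro!: nth_equalityI simp del: replicate_Suc)
  next
    fix m xs assume "xs \<in> {const_cell 0 m}"
    then have x: "xs = const_cell 0 m" by simp
    have "rank xs j = 0" if "j \<le> m" for j
      using that by (induction j) (auto simp: rank_0 rank_Suc x less_Suc_eq_le simp del: replicate_Suc)
    then show "xs \<in> N 0 m" by (auto simp: N_def cells_walking_iso x less_Suc_eq_le simp del: replicate_Suc)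
  qed
  finally show ?thesis .
qed

section \<open>Maps out of the walking isomorphism are degenerate\<close>

text \<open>Besides the identity, the operators from \<open>[1]\<close> to itself are constant and
  produce degenerate edges from any \<open>x\<close>.\<close>

lemma degenerate_vertices_1:
  assumes X: "complete_decomposition_space X" and x: "x \<in> cells (level X 1) 0"
  shows "x \<in> degenerate_vertices X 1 \<longleftrightarrow> degenerate X x"
proof
  note b = bisimp[OF X]
  assume "x \<in> degenerate_vertices X 1"
  then have "degenerate X (hact X 1 1 id 0 x)" using delta_map_id by (simp add: degenerate_vertices_def)
  then show "degenerate X x" using bs_id[OF b x, of id] by simp
next
  note b = bisimp[OF X]
  assume d: "degenerate X x"
  have "degenerate X (hact X 1 1 \<theta> 0 x)" if \<theta>: "delta_map 1 1 \<theta>" for \<theta>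
  proof (cases "\<theta> 0 = \<theta> 1")
    case True
    have le: "\<theta> 0 \<le> 1" using delta_map_le[OF \<theta>, of 0] by simp
    have "hact X 1 0 (\<lambda>_. 0) 0 (hact X 0 1 (\<lambda>_. \<theta> 0) 0 x) = hact X 1 1 (\<lambda>_. \<theta> 0) 0 x"
      by (rule bs_comp[OF b delta_map_const delta_map_const[OF le] x]) simp_all
    also have "\<dots> = hact X 1 1 \<theta> 0 x"
      by (rule bs_eq[OF b delta_map_const[OF le] x]) (use True in \<open>auto simp: One_nat_def le_Suc_eq\<close>)
    finally show ?thesis using degenerate_s0[OF b bs_closed[OF b delta_map_const[OF le] x]] by simp
  next
    case False
    then have "\<theta> 0 = 0" "\<theta> 1 = 1"
      using delta_map_le[OF \<theta>, of 0] delta_map_le[OF \<theta>, of 1] delta_map_mono[OF \<theta>, of 0 1] by (auto simp: One_nat_def le_Suc_eq)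
    then have "hact X 1 1 \<theta> 0 x = x" by (intro bs_id[OF b x]) (auto simp: One_nat_def le_Suc_eq)
    then show ?thesis using d by simp
  qed
  then show "x \<in> degenerate_vertices X 1" using x by (simp add: degenerate_vertices_def)
qed

text \<open>Stripping the first edge makes \<sigma> homotopic to a degenerate triangle on some edge
  \<open>?u\<close>. Both the long edge and the last edge of that triangle are \<open>?u\<close>, so
  the corresponding edges of \<sigma> are degenerate together.\<close>

lemma degenerate_triangle:
  assumes X: "complete_decomposition_space X" and \<sigma>: "\<sigma> \<in> cells (level X 2) 0"
    and 1: "degenerate X (hact X 1 2 (\<lambda>i. i) 0 \<sigma>)" and 2: "degenerate X (hact X 1 2 (coface 1) 0 \<sigma>)"
  shows "degenerate X (hact X 1 2 (coface 0) 0 \<sigma>)"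
proof -
  note b = bisimp[OF X]
  have L: "simplicial_set point" by (rule simplicial_set_std)
  have two: "2 = Suc 1" by (simp add: One_nat_def)
  have p0: "const_cell 0 0 \<in> cells point 0" by (simp only: cells_point)
  let ?w = "\<lambda>n (_ :: nat list). act (level X 2) n 0 (\<lambda>_. 0) \<sigma>"
  have w: "simplicial_map point (level X (Suc 1)) ?w"
    unfolding two[symmetric]
    by (rule smI) (use ss_closed[OF bs_level[OF b] delta_map_const \<sigma>] ss_comp'[OF bs_level[OF b] _ delta_map_const \<sigma>] in auto)
  have w0: "?w 0 l = \<sigma>" for l by (rule ss_id[OF bs_level[OF b] \<sigma>]) simp
  have "degenerate X (hact X 1 (Suc 1) (\<lambda>i. i) 0 (?w 0 l))" for l using 1 w0 by (simp only: two[symmetric])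
  then obtain v H where v: "simplicial_map point (level X 1) v" and H: "simplicial_map (sset_prod point interval) (level X 2) H"
    "\<And>n l. l \<in> cells point n \<Longrightarrow> H n (l, const_cell 0 n) = hact X 2 1 (\<lambda>i. i - 1) n (v n l)"
    "\<And>n l. l \<in> cells point n \<Longrightarrow> H n (l, const_cell 1 n) = ?w n l"
    using split_degenerate[OF X L w] unfolding two[symmetric] by blast
  have dc: "delta_map 1 2 (coface i)" if "i \<le> 1" for i
    using delta_map_coface[of i 1] that unfolding two by simp
  have ds: "delta_map 2 1 (\<lambda>i. i - 1)" by (rule delta_mapI) auto
  let ?u = "v 0 (const_cell 0 0)"
  have u: "?u \<in> cells (level X 1) 0" by (rule sm_closed[OF v p0])
  have e: "degenerate X ?u \<longleftrightarrow> degenerate X (hact X 1 2 (coface i) 0 \<sigma>)" if i: "i \<le> 1" for i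
  proof -
    let ?d = "hact X 1 2 (coface i)"
    have dH: "simplicial_map (sset_prod point interval) (level X 1) (\<lambda>n x. ?d n (H n x))"
      by (rule sm_comp[OF H(1) bs_hact[OF b dc[OF i]]])
    have "?d 0 (hact X 2 1 (\<lambda>i. i - 1) 0 ?u) = hact X 1 1 (\<lambda>i. i) 0 ?u"
      by (rule bs_comp[OF b dc[OF i] ds u]) (use i in \<open>auto simp: coface_def One_nat_def le_Suc_eq\<close>)
    then have 0: "?d 0 (H 0 (const_cell 0 0, const_cell 0 0)) = ?u" using H(2)[OF p0] bs_id[OF b u, of "\<lambda>i. i"] by simp
    have 1: "?d 0 (H 0 (const_cell 0 0, const_cell 1 0)) = ?d 0 \<sigma>" using H(3)[OF p0] w0 by simp
    have "?u \<in> degenerate_vertices X 1 \<longleftrightarrow> ?d 0 \<sigma> \<in> degenerate_vertices X 1"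
      using degenerate_vertices_homotopy[OF X dH L _ _ p0, of 0 1] degenerate_vertices_homotopy[OF X dH L _ _ p0, of 1 0] 0 1 by auto
    then show ?thesis using degenerate_vertices_1[OF X u] degenerate_vertices_1[OF X bs_closed[OF b dc[OF i] \<sigma>]] by simp
  qed
  show ?thesis using e[of 0] e[of 1] 2 by simp
qed

section \<open>Alternating simplices and tightness\<close>

lemma J_pair: "x < 2 \<Longrightarrow> y < 2 \<Longrightarrow> [x, y] \<in> cells walking_iso 1"
  by (auto simp: cells_walking_iso One_nat_def le_Suc_eq)

text \<open>The principal edges of the alternating simplex are in turn the images of 01 and 10. Even
  length makes its last vertex 0, so the long edge is the image of 00 whatever \<open>N\<close> is,
  and the simplex with a constant path is a point of the fibre over that one edge.\<close>

lemma alternating_hofibre: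
  assumes X: "complete_decomposition_space X" and \<phi>: "simplicial_map walking_iso (row X 0) \<phi>"
    and nd: "\<not> degenerate X (\<phi> 1 [0, 1])" "\<not> degenerate X (\<phi> 1 [1, 0])"
  shows "\<not> empty_sset (hofibre (nondegenerate_simplices X (2 * N)) (level X 1) (hact X 1 (2 * N) (long_edge (2 * N))) (\<phi> 1 [0, 0]))"
proof -
  note b = bisimp[OF X]
  let ?r = "2 * N"
  let ?x = "\<phi> ?r (alternating ?r)" and ?a = "\<phi> 1 [0, 0]"
  have x: "?x \<in> cells (level X ?r) 0" using sm_closed[OF \<phi> alternating_cells] by simp
  have a: "?a \<in> cells (level X 1) 0"
    using sm_closed[OF \<phi> J_pair[of 0 0]] by simp
  have two: "act walking_iso 1 ?r \<theta> (alternating ?r) = [\<theta> 0 mod 2, \<theta> 1 mod 2]" if "delta_map 1 ?r \<theta>" for \<theta>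
  proof -
    have "alternating ?r ! i = i mod 2" if "i \<le> ?r" for i
      using that by (simp add: alternating_def nth_map_upt' del: upt_Suc)
    then show ?thesis
      using delta_map_le[OF that, of 0] delta_map_le[OF that, of 1] by (simp add: act_walking_iso One_nat_def)
  qed
  have "hact X 1 ?r \<theta> 0 ?x = \<phi> 1 [\<theta> 0 mod 2, \<theta> 1 mod 2]" if "delta_map 1 ?r \<theta>" for \<theta>
    using sm_nat[OF \<phi> alternating_cells that] two[OF that] by simp
  note h = this
  have "nondegenerate_edge X (hact X 1 ?r (principal i) 0 ?x)" if i: "i < ?r" for i
  proof -
    have d: "delta_map 1 ?r (principal i)" by (rule delta_mapI) (use i in \<open>auto simp: principal_def One_nat_def le_Suc_eq\<close>)
    have "hact X 1 ?r (principal i) 0 ?x = \<phi> 1 [i mod 2, Suc i mod 2]" using h[OF d] by (simp add: principal_def One_nat_def)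
    moreover have "i mod 2 = 0 \<and> Suc i mod 2 = 1 \<or> i mod 2 = 1 \<and> Suc i mod 2 = 0" by presburger
    ultimately have "\<not> degenerate X (hact X 1 ?r (principal i) 0 ?x)" using nd by auto
    then show ?thesis using nondegenerate_iff[OF b bs_closed[OF b d x]] by simp
  qed
  then have xn: "?x \<in> cells (nondegenerate_simplices X ?r) 0"
    using x ss_id[OF bs_level[OF b] x, of "\<lambda>_. 0"] by (simp add: nondegenerate_simplices_def full_sub_def)
  have dl: "delta_map 1 ?r (long_edge ?r)" by (rule delta_mapI) (auto simp: long_edge_def)
  have xl: "hact X 1 ?r (long_edge ?r) 0 ?x = ?a" using h[OF dl] by (simp add: long_edge_def)
  let ?F = "\<lambda>n (_ :: nat list \<times> nat list). act (level X 1) n 0 (\<lambda>_. 0) ?a"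
  have F: "simplicial_map (sset_prod point interval) (level X 1) ?F"
    by (rule smI) (use ss_closed[OF bs_level[OF b] delta_map_const a] ss_comp'[OF bs_level[OF b] _ delta_map_const a] in auto)
  have p0: "const_cell 0 0 \<in> cells point 0" by (simp only: cells_point)
  have a0: "act (level X 1) 0 0 (\<lambda>_. 0) ?a = ?a" by (rule ss_id[OF bs_level[OF b] a]) simp
  have g: "untranspose point ?F 0 (const_cell 0 0) \<in> cells (path_space (level X 1)) 0"
    by (rule sm_closed[OF untranspose_map[OF F simplicial_set_std bs_level[OF b]] p0])
  have eg: "path_ev 0 (untranspose point ?F 0 (const_cell 0 0)) (const_cell i 0) = ?a" if "i \<le> 1" for i
    unfolding path_ev_untranspose[OF simplicial_set_std p0 const_cell_cells[OF that]] by (rule a0)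
  have "(?x, untranspose point ?F 0 (const_cell 0 0), const_cell 0 0) \<in>
      cells (hofibre (nondegenerate_simplices X ?r) (level X 1) (hact X 1 ?r (long_edge ?r)) ?a) 0"
    unfolding hofibre_def cells_hpb point_map_def using eg[of 0] eg[of 1] xn g p0 a0 xl by simp
  then show ?thesis unfolding empty_sset_def by blast
qed

lemma J_edges:
  assumes "k \<in> cells walking_iso 1"
  shows "k = [0, 0] \<or> k = [0, 1] \<or> k = [1, 0] \<or> k = [1, 1]"
proof -
  obtain x y where k: "k = [x, y]" using assms by (auto simp: cells_walking_iso One_nat_def length_Suc_conv)
  then have "x < 2" "y < 2" using assms by (auto simp: cells_walking_iso One_nat_def dest: spec[of _ 0] spec[of _ "Suc 0"])
  then show ?thesis using k by (auto simp: less_2_cases_iff One_nat_def)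
qed

text \<open>Tightness over the image of 00 prevents 01 and 10 from both being nondegenerate.
  Degeneracy passes from one to the other through the triangle \<open>[i, j, i]\<close>, whose long
  edge \<open>[i, i]\<close> is degenerate.\<close>

lemma J_vertex_degenerate:
  assumes X: "tight_decomposition_space X" and \<phi>: "simplicial_map walking_iso (row X 0) \<phi>"
    and k: "k \<in> cells walking_iso 1"
  shows "degenerate X (\<phi> 1 k)"
proof -
  have cX: "complete_decomposition_space X" using X by (simp add: tight_decomposition_space_def)
  note b = bisimp[OF cX]
  have const: "degenerate X (\<phi> 1 [i, i])" if "i < 2" for i
  proof -
    have i: "[i] \<in> cells walking_iso 0" using that by (simp add: cells_walking_iso)
    have "act walking_iso 1 0 (\<lambda>_. 0) [i] = [i, i]" by (simp add: act_walking_iso One_nat_def)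
    then have "\<phi> 1 [i, i] = hact X 1 0 (\<lambda>_. 0) 0 (\<phi> 0 [i])"
      using sm_nat[OF \<phi> i delta_map_const[of 0 0 1]] by simp
    then show ?thesis using degenerate_s0[OF b, of "\<phi> 0 [i]"] sm_closed[OF \<phi> i] by simp
  qed
  have flip: "degenerate X (\<phi> 1 [j, i])" if ij: "i < 2" "j < 2" and d: "degenerate X (\<phi> 1 [i, j])" for i j
  proof -
    have t: "[i, j, i] \<in> cells walking_iso 2"
      using ij by (auto simp: cells_walking_iso numeral_2_eq_2 le_Suc_eq)
    let ?\<sigma> = "\<phi> 2 [i, j, i]"
    have s: "?\<sigma> \<in> cells (level X 2) 0" using sm_closed[OF \<phi> t] by simp
    have e: "hact X 1 2 \<theta> 0 ?\<sigma> = \<phi> 1 [[i, j, i] ! \<theta> 0, [i, j, i] ! \<theta> 1]" if "delta_map 1 2 \<theta>" for \<theta>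
      using sm_nat[OF \<phi> t that] by (simp add: act_walking_iso One_nat_def)
    have "delta_map 1 2 (\<lambda>i. i)" "delta_map 1 2 (coface 0)" "delta_map 1 2 (coface 1)"
      by (rule delta_mapI; simp add: coface_def)+
    from this[THEN e] show ?thesis
      using degenerate_triangle[OF cX s] d const[OF ij(1)] by (simp add: coface_def One_nat_def)
  qed
  have a: "\<phi> 1 [0, 0] \<in> cells (level X 1) 0"
    using sm_closed[OF \<phi> J_pair[of 0 0]] by simp
  then obtain N where "\<And>r. r \<ge> N \<Longrightarrow>
      empty_sset (hofibre (nondegenerate_simplices X r) (level X 1) (hact X 1 r (long_edge r)) (\<phi> 1 [0, 0]))"
    using X unfolding tight_decomposition_space_def by blast
  then have "degenerate X (\<phi> 1 [0, 1]) \<or> degenerate X (\<phi> 1 [1, 0])"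
    using alternating_hofibre[OF cX \<phi>, of N] by fastforce
  then have "degenerate X (\<phi> 1 [0, 1]) \<and> degenerate X (\<phi> 1 [1, 0])" using flip[of 0 1] flip[of 1 0] by auto
  then show ?thesis using J_edges[OF k] const[of 0] const[of 1] by auto
qed

text \<open>By naturality each vertex of the \<open>p\<close>-dimensional family is itself a map
  from \<open>walking_iso\<close> to \<open>row X 0\<close>, so the case of vertices applies to
  it.\<close>

lemma J_map_dpart:
  assumes X: "tight_decomposition_space X" and \<phi>: "simplicial_map walking_iso (row X p) \<phi>"
    and k: "k \<in> cells walking_iso n"
  shows "\<phi> n k \<in> cells (level (degenerate_part X) n) p"
proof -
  have cX: "complete_decomposition_space X" using X by (simp add: tight_decomposition_space_def)
  note b = bisimp[OF cX]
  have c: "\<phi> n k \<in> cells (level X n) p" if "k \<in> cells walking_iso n" for n k using sm_closed[OF \<phi> that] by simp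
  have "act (level X n) 0 p (\<lambda>_. i) (\<phi> n k) \<in> degenerate_vertices X n" if i: "i \<le> p" for i
  proof -
    let ?\<phi> = "\<lambda>n k. act (level X n) 0 p (\<lambda>_. i) (\<phi> n k)"
    have \<phi>i: "simplicial_map walking_iso (row X 0) ?\<phi>"
      by (rule smI) (use ss_closed[OF bs_level[OF b] delta_map_const[OF i] c] sm_nat[OF \<phi>]
        bs_nat[OF b _ delta_map_const[OF i] c] in auto)
    have "degenerate X (hact X 1 n \<theta> 0 (?\<phi> n k))" if d: "delta_map 1 n \<theta>" for \<theta>
      using J_vertex_degenerate[OF X \<phi>i ss_closed[OF simplicial_set_walking_iso d k]] sm_nat[OF \<phi>i k d] by simp
    then show ?thesis using sm_closed[OF \<phi>i k] by (simp add: degenerate_vertices_def)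
  qed
  then show ?thesis using c[OF k] by (simp add: cells_degenerate_part)
qed

section \<open>Rezk completeness\<close>

lemma pt_in_J: "s \<in> cells point n \<Longrightarrow> s \<in> cells walking_iso n"
  by (auto simp: cells_point cells_walking_iso less_Suc_eq_le simp del: replicate_Suc)

lemma act_pt_J: "act walking_iso = act point"
  by (intro ext) (simp add: act_walking_iso act_std)

text \<open>Evaluation at the vertex 0 of \<open>walking_iso\<close>: cells are lists in both cases,
  and \<open>point\<close> is literally the subcomplex of lists of zeros.\<close>

definition res_pt :: "nat \<Rightarrow> (nat \<Rightarrow> nat list \<Rightarrow> 'a) \<Rightarrow> nat \<Rightarrow> nat list \<Rightarrow> 'a" where
  "res_pt p \<phi> = (\<lambda>n. restrict (\<phi> n) (cells point n))"

lemma res_pt_map: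
  assumes X: "bisimplicial X"
  shows "simplicial_map (map_space walking_iso X) (map_space point X) res_pt"
proof (rule smI)
  fix p \<phi> assume "\<phi> \<in> cells (map_space walking_iso X) p"
  then have \<phi>: "simplicial_map walking_iso (row X p) \<phi>" by (simp add: cells_map_space)
  show "res_pt p \<phi> \<in> cells (map_space point X) p"
    unfolding cells_map_space
  proof (intro conjI allI smI)
    fix n k assume k: "k \<in> cells point n"
    then show "res_pt p \<phi> n k \<in> cells (row X p) n" using sm_closed[OF \<phi> pt_in_J[OF k]] by (simp add: res_pt_def)
    fix m \<theta> assume d: "delta_map m n \<theta>"
    show "res_pt p \<phi> m (act point m n \<theta> k) = act (row X p) m n \<theta> (res_pt p \<phi> n k)"
      using sm_nat[OF \<phi> pt_in_J[OF k] d] k ss_closed[OF simplicial_set_std d k] by (simp add: res_pt_def act_pt_J)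
  qed (simp add: res_pt_def)
next
  fix q p \<theta> and \<phi> :: "nat \<Rightarrow> nat list \<Rightarrow> 'a"
  show "res_pt q (act (map_space walking_iso X) q p \<theta> \<phi>) = act (map_space point X) q p \<theta> (res_pt p \<phi>)"
  proof
    fix n
    show "res_pt q (act (map_space walking_iso X) q p \<theta> \<phi>) n = act (map_space point X) q p \<theta> (res_pt p \<phi>) n"
      unfolding res_pt_def act_map_space by (rule restrict_ext) (simp add: pt_in_J)
  qed
qed

lemma precompose_pt_map:
  assumes X: "bisimplicial X"
  shows "simplicial_map (map_space point X) (map_space walking_iso X) (precompose walking_iso to_point)"
proof (rule smI)
  have tp: "to_point n k \<in> cells point n" for n and k :: "nat list" unfolding cells_point by (rule to_point_cst)
  fix p \<phi> assume "\<phi> \<in> cells (map_space point X) p"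
  then have \<phi>: "simplicial_map point (row X p) \<phi>" by (simp add: cells_map_space)
  show "precompose walking_iso to_point p \<phi> \<in> cells (map_space walking_iso X) p"
    unfolding cells_map_space
  proof (intro conjI allI smI)
    fix n k assume k: "k \<in> cells walking_iso n"
    then show "precompose walking_iso to_point p \<phi> n k \<in> cells (row X p) n"
      using sm_closed[OF \<phi> tp] by (simp add: precompose_def)
    fix m \<theta> assume d: "delta_map m n \<theta>"
    have "to_point m (act walking_iso m n \<theta> k) = act point m n \<theta> (to_point n k)"
      unfolding to_point_cst using act_const_cell[OF d] by simp
    then show "precompose walking_iso to_point p \<phi> m (act walking_iso m n \<theta> k) =
        act (row X p) m n \<theta> (precompose walking_iso to_point p \<phi> n k)"
      using sm_nat[OF \<phi> tp d] k ss_closed[OF simplicial_set_walking_iso d k] by (simp add: precompose_def)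
  qed (simp add: precompose_def)
next
  have tp: "to_point n k \<in> cells point n" for n and k :: "nat list" unfolding cells_point by (rule to_point_cst)
  fix q p \<theta> and \<phi> :: "nat \<Rightarrow> nat list \<Rightarrow> 'a"
  show "precompose walking_iso to_point q (act (map_space point X) q p \<theta> \<phi>) =
      act (map_space walking_iso X) q p \<theta> (precompose walking_iso to_point p \<phi>)"
  proof
    fix n
    show "precompose walking_iso to_point q (act (map_space point X) q p \<theta> \<phi>) n =
      act (map_space walking_iso X) q p \<theta> (precompose walking_iso to_point p \<phi>) n"
      unfolding precompose_def act_map_space by (rule restrict_ext) (simp add: tp)
  qed
qed

text \<open>Maps out of \<open>walking_iso\<close> land in the degenerate part, so the lifting
  problem can be posed there. In bisimplicial form it is solved by attaching the cells of
  \<open>walking_iso\<close> to its vertex 0, and the adjunctions translate the solution back to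
  mapping spaces.\<close>

lemma res_pt_lifts:
  assumes X: "tight_decomposition_space X"
  shows "lifts (map_space walking_iso X) (map_space point X) res_pt (std_simplex p) (boundary p)"
proof (rule liftsI)
  have cX: "complete_decomposition_space X" using X by (simp add: tight_decomposition_space_def)
  note b = bisimp[OF cX] and boundary = bisimplicial_degenerate_part[OF cX]
  let ?J = walking_iso and ?T = "transposed (degenerate_part X)" and ?\<Delta> = "std_simplex p"
  have bT: "bisimplicial ?T" by (rule bisimplicial_transposed[OF boundary])
  have horn: "blifts ?T q (boundary q) (std_simplex k) (horn_cells k 0)" if "1 \<le> k" for q k
    by (rule outer_horn_blifts[OF bT dpart_root_lifts[OF cX]
      dpart_fib[OF cX order_refl simplicial_set_std subsset_horn_cells] that])
  have J0: "subsset ?J (\<lambda>m. {const_cell 0 m})"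
    by (rule subssetI) (use pt_in_J act_const_cell in \<open>auto simp: cells_point act_pt_J simp del: replicate_Suc\<close>)
  have "lifts (level ?T p) (map_space (restr ?\<Delta> (boundary p)) ?T) (restriction ?T p (boundary p)) ?J (\<lambda>m. {const_cell 0 m})"
    by (rule walking_iso_lifts) (use horn blifts_iff_lifts[OF bT subsset_boundary simplicial_set_std subsset_horn_cells] in blast)
  then have J: "blifts ?T p (boundary p) ?J (\<lambda>m. {const_cell 0 m})"
    using blifts_iff_lifts[OF bT subsset_boundary simplicial_set_walking_iso J0] by blast
  fix F \<beta> assume F: "simplicial_map (restr ?\<Delta> (boundary p)) (map_space ?J X) F" and \<beta>: "simplicial_map ?\<Delta> (map_space point X) \<beta>"
    and c: "\<And>m s. s \<in> boundary p m \<Longrightarrow> res_pt m (F m s) = \<beta> m s"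
  have Fs: "simplicial_map ?J (row X m) (F m s)" "F m s n \<in> extensional (cells ?J n)" if "s \<in> boundary p m" for m s n
    using sm_closed[OF F, of s m] that by (auto simp: cells_map_space)
  have Fa: "F m' (act ?\<Delta> m' m \<theta> s) n k = act (level X n) m' m \<theta> (F m s n k)"
    if "s \<in> boundary p m" "k \<in> cells ?J n" "delta_map m' m \<theta>" for m m' s n k \<theta>
    using sm_nat[OF F _ that(3), of s] that by (simp add: act_map_space)
  let ?id = "[0..<Suc p]"
  have \<beta>p: "simplicial_map point (row X p) (\<beta> p ?id)" "\<beta> p ?id n \<in> extensional (cells point n)" for n
    using sm_closed[OF \<beta> std_id] by (auto simp: cells_map_space)
  have \<beta>s: "\<beta> m s n k = act (level X n) m p ((!) s) (\<beta> p ?id n k)" if "s \<in> cells ?\<Delta> m" "k \<in> cells point n" for m s n k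
    using yoneda_eq[OF \<beta> that(1)] that(2) by (simp add: act_map_space)
  have "blifts ?T p (boundary p) ?J (\<lambda>m. {const_cell 0 m})" by (rule J)
  \<comment> \<open>A map out of the point extends to the constant map on
    \<open>walking_iso\<close>; by \<open>J_map_dpart\<close> its values lie in the degenerate
    part.\<close>
  have f0: "simplicial_map (restr ?J (\<lambda>m. {const_cell 0 m})) (level ?T p) (\<beta> p ?id)"
  proof (rule smI)
    fix n k assume "k \<in> cells (restr ?J (\<lambda>m. {const_cell 0 m})) n"
    then have k: "k \<in> cells point n" by (simp add: cells_point del: replicate_Suc)
    have "simplicial_map ?J (row X p) (precompose ?J to_point p (\<beta> p ?id))"
      using sm_closed[OF precompose_pt_map[OF b] sm_closed[OF \<beta> std_id]] by (simp add: cells_map_space)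
    from J_map_dpart[OF X this pt_in_J[OF k]] show "\<beta> p ?id n k \<in> cells (level ?T p) n"
      using k pt_in_J[OF k] by (simp add: precompose_def to_point_cst cells_point del: replicate_Suc upt_Suc)
    fix m \<theta> assume d: "delta_map m n \<theta>"
    show "\<beta> p ?id m (act (restr ?J (\<lambda>m. {const_cell 0 m})) m n \<theta> k) = act (level ?T p) m n \<theta> (\<beta> p ?id n k)"
      using sm_nat[OF \<beta>p(1) k d] by (simp add: act_pt_J del: upt_Suc)
  qed
  have bm: "bimap ?T (restr ?\<Delta> (boundary p)) ?J (\<lambda>m n s k. F m s n k)"
    by (rule bimapI) (use Fs Fa J_map_dpart[OF X] sm_nat[OF Fs(1)] in auto)
  obtain h where h: "simplicial_map ?J (level ?T p) h" "\<And>n k. k \<in> {const_cell 0 n} \<Longrightarrow> h n k = \<beta> p ?id n k"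
    "\<And>m n s k. s \<in> boundary p m \<Longrightarrow> k \<in> cells ?J n \<Longrightarrow> hact ?T m p ((!) s) n (h n k) = F m s n k"
  proof (rule bliftsD[OF J f0 bm])
    fix m n s k assume s: "s \<in> boundary p m" and k: "k \<in> {const_cell 0 n}"
    then have k': "k \<in> cells point n" by (simp add: cells_point del: replicate_Suc)
    have "F m s n k = \<beta> m s n k"
      using fun_cong[OF fun_cong[OF c[OF s], of n], of k] k' by (simp add: res_pt_def)
    then show "hact ?T m p ((!) s) n (\<beta> p ?id n k) = F m s n k"
      using \<beta>s[OF _ k', of s m] s by (simp add: boundary_def del: upt_Suc)
  qed blast
  have hX: "simplicial_map ?J (row X p) h"
    using h(1) unfolding simplicial_map_def by (auto simp: cells_degenerate_part Pi_iff)
  define y where "y = (\<lambda>n. restrict (h n) (cells ?J n))"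
  have y: "y \<in> cells (map_space ?J X) p"
    unfolding cells_map_space using sm_cong[OF simplicial_set_walking_iso hX, of y] by (simp add: y_def)
  let ?h = "\<lambda>m s. act (map_space ?J X) m p ((!) s) y"
  have "simplicial_map ?\<Delta> (map_space ?J X) ?h"
    by (rule yoneda_map[OF simplicial_set_map_space[OF b simplicial_set_walking_iso] y])
  moreover have "?h m s = F m s" if s: "s \<in> boundary p m" for m s
  proof
    fix n show "?h m s n = F m s n"
      unfolding act_map_space
      by (rule extensionalityI[OF _ Fs(2)[OF s]]) (use h(3)[OF s] in \<open>auto simp: y_def\<close>)
  qed
  moreover have "res_pt m (?h m s) = \<beta> m s" if s: "s \<in> cells ?\<Delta> m" for m s
  proof
    fix n
    have "\<beta> m s n \<in> extensional (cells point n)" using sm_closed[OF \<beta> s] by (simp add: cells_map_space)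
    then show "res_pt m (?h m s) n = \<beta> m s n"
      by (rule extensionalityI[rotated])
        (use h(2) \<beta>s[OF s] pt_in_J in \<open>auto simp: res_pt_def act_map_space y_def cells_point simp del: replicate_Suc upt_Suc\<close>)
  qed
  ultimately show "\<exists>h. simplicial_map ?\<Delta> (map_space ?J X) h \<and> (\<forall>n. \<forall>x\<in>boundary p n. h n x = F n x) \<and>
      (\<forall>n. \<forall>x\<in>cells ?\<Delta> n. res_pt n (h n x) = \<beta> n x)" by (intro exI[of _ ?h]) blast
qed

text \<open>The composite of the section with \<open>q\<close> is the identity on \<open>B\<close>.
  For the other composite, the constant homotopy at \<open>q\<close> is lifted over the cylinder on
  \<open>E\<close> relative to its two ends, which carry \<open>s\<close> after \<open>q\<close> and
  the identity.\<close>

lemma section_equivalence: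
  assumes l: "\<And>p. lifts E B q (std_simplex p) (boundary p)" and E: "simplicial_set E"
    and q: "simplicial_map E B q" and s: "simplicial_map B E s" and qs: "\<And>n x. x \<in> cells B n \<Longrightarrow> q n (s n x) = x"
  shows "equivalence B E s"
  unfolding equivalence_def
proof (intro conjI exI[of _ q])
  show "homotopic B B (\<lambda>n. q n \<circ> s n) (\<lambda>n. id)"
    unfolding homotopic_def
    by (intro exI[of _ "\<lambda>n. fst"] conjI sm_fst) (simp add: qs)
  let ?L = "sset_prod E interval"
  define M where "M n = cells E n \<times> {const_cell 0 n, const_cell 1 n}" for n
  define f where "f = (\<lambda>n (x, t). if t = const_cell 0 n then s n (q n x) else x)"
  have L: "simplicial_set ?L" by (rule simplicial_set_prod[OF E simplicial_set_std])
  have M: "subsset ?L M"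
    by (rule subssetI) (use const_cell_cells[of 0 1] const_cell_cells[of 1 1] ss_closed[OF E] act_const_cell in \<open>auto simp: M_def simp del: replicate_Suc\<close>)
  have sq: "simplicial_map E E (\<lambda>n x. s n (q n x))" by (rule sm_comp[OF q s])
  have ne: "const_cell 1 n \<noteq> const_cell 0 n" for n by simp
  have f: "simplicial_map (restr ?L M) E f"
    by (rule smI) (use sm_closed[OF sq] sm_nat[OF sq] ne act_const_cell in \<open>auto simp: M_def f_def simp del: replicate_Suc\<close>)
  have "lifts E B q ?L M" by (rule lifts_mono[OF l L M E])
  then obtain H where H: "simplicial_map ?L E H" "\<And>n x. x \<in> M n \<Longrightarrow> H n x = f n x"
  proof (rule liftsD[OF _ f sm_comp[OF sm_fst q]])
    fix n x assume "x \<in> M n"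
    then show "q n (f n x) = q n (fst x)" using qs sm_closed[OF q] by (auto simp: M_def f_def)
  qed blast
  show "homotopic E E (\<lambda>n. s n \<circ> q n) (\<lambda>n. id)"
    unfolding homotopic_def
    by (intro exI[of _ H] conjI H(1)) (use H(2) ne in \<open>auto simp: M_def f_def simp del: replicate_Suc\<close>)
qed (rule s q)+

theorem proposition3p5p5:
  fixes X :: "'a sspace"
  assumes "tight_decomposition_space X"
    and "segal_space X"
  shows "rezk_complete X"
proof -
  have b: "bisimplicial X"
    using assms(1) by (intro bisimp) (simp add: tight_decomposition_space_def)
  show ?thesis unfolding rezk_complete_def
  proof (rule section_equivalence[OF res_pt_lifts[OF assms(1)] simplicial_set_map_space[OF b simplicial_set_walking_iso]
        res_pt_map[OF b] precompose_pt_map[OF b]])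
    fix p \<phi> assume \<phi>: "\<phi> \<in> cells (map_space point X) p"
    show "res_pt p (precompose walking_iso to_point p \<phi>) = \<phi>"
    proof
      fix n
      show "res_pt p (precompose walking_iso to_point p \<phi>) n = \<phi> n"
        by (rule extensionalityI[of _ "cells point n"])
          (use \<phi> pt_in_J in \<open>auto simp: res_pt_def precompose_def cells_map_space cells_point to_point_cst simp del: replicate_Suc\<close>)
    qed
  qed
qed

end
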